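(* For every strict partition $\lambda$, \[ GP_\lambda(x\,|\,b)=\langle \mathrm{vac}|\, e^{H^{(\beta)}(x)}\,|\lambda\rangle_{(GP,b)},\qquad GQ_\lambda(x\,|\,b)=\langle \mathrm{vac}|\, e^{H^{(\beta)}(x)}\,|\lambda\rangle_{(GQ,b)}. \]
   Context: $K$-theoretic notation: $\beta$ is an indeterminate; $x\oplus y=x+y+\beta xy$, $x\ominus y=\frac{x-y}{1+\beta y}$. $b=(b_1,b_2,\ldots)$ is a sequence of indeterminates. A strict partition is $\lambda=(\lambda_1>\cdots>\lambda_r>0)$, $r=\ell(\lambda)$. For $k\ge1$ put $[\![x|b]\!]^k=(x\oplus x)(x\ominus b_1)\cdots(x\ominus b_{k-1})$ and $[x|b]^k=(x\ominus b_1)\cdots(x\ominus b_k)$, $[x|b]^0=1$. For $n\ge r$, $GQ_\lambda(x_1,\ldots,x_n|b)=\frac{1}{(n-r)!}\sum_{w\in S_n}w\big(\prod_{i=1}^r[\![x_i|b]\!]^{\lambda_i}\prod_{i=1}^r\prod_{j=i+1}^n\frac{x_i\oplus x_j}{x_i\ominus x_j}\big)$ and $GP_\lambda(x_1,\ldots,x_n|b)$ is defined by the same formula with $[\![x_i|b]\!]^{\lambda_i}$ replaced by $x_i[x_i|b]^{\lambda_i-1}$ ($w$ permutes the $x_i$). These are stable under setting $x_{n+1}=0$, which defines $GP_\lambda(x|b),GQ_\lambda(x|b)$ in $x=(x_1,x_2,\ldots)$. Fermions: $\mathcal C$ is the associative $\mathbb Q(\beta)$-algebra generated by $\phi_n$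 ($n\in\mathbb Z$) with $\phi_m\phi_n+\phi_n\phi_m=2(-1)^m\delta_{m+n,0}$. The Fock space $\mathcal F$ is the left $\mathcal C$-module generated by $|\mathrm{vac}\rangle$ with $\phi_n|\mathrm{vac}\rangle=0$ ($n<0$); $\mathcal F^\dagger$ is the right module generated by $\langle\mathrm{vac}|$ with $\langle\mathrm{vac}|\phi_n=0$ ($n>0$); $\langle\cdot|\cdot\rangle$ is the bilinear pairing with $\langle ua|v\rangle=\langle u|av\rangle$, $\langle\mathrm{vac}|\mathrm{vac}\rangle=1$, extended linearly treating $b_i,x_i$ as scalars (and to formal series). Deformed fermions $\phi^{(\beta)}_n$ are defined by $\sum_{n\ge0}\phi^{(\beta)}_nz^n=\sum_{n\ge0}\phi_n(z+\beta/2)^n$ and $\sum_{n\ge1}\phi^{(\beta)}_{-n}z^{-n}=\sum_{n\ge1}\phi_{-n}\big(\frac{z^{-1}}{1+\frac\beta2z^{-1}}\big)^n$; $\phi^{(\beta)}(z)=\sum_n\phi^{(\beta)}_nz^n$ and $\Phi^{(\beta)}(z)=\sum_n\Phi^{(\beta)}_nz^n:=(2+\beta z^{-1})^{-1}\phi^{(\beta)}(z)$, i.e. $\Phi^{(\beta)}_n=\frac12\sum_{k\ge0}(-\beta/2)^k\phi^{(\beta)}_{n+k}$. For $k\ge1$ let $\Phi^{(\beta)(k)}(z)=\prod_{j=1}^{k-1}\frac{1-zb_j}{1+\beta b_j}\Phi^{(\beta)}(z)=\sum_i\Phi^{(\beta)(k)}_iz^i$ and $\phi^{(\beta)(k)}(z)=\prod_{j=1}^{k-1}\frac{1-zb_j}{1+\beta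 b_j}\phi^{(\beta)}(z)=\sum_i\phi^{(\beta)(k)}_iz^i$. For odd $n$, $b_n=\frac14\sum_{i\in\mathbb Z}(-1)^i\phi_{-i-n}\phi_i$; $\theta^*=2\sum_{n>0\text{ odd}}(\beta/2)^n b_{-n}/n$; $H^{(\beta)}(x)=2\sum_{n>0\text{ odd}}\frac{p^{(\beta)}_n(x)}{n}b_n$ with $p_n^{(\beta)}(x)=\sum_k\big(\frac{x_k}{1+\beta x_k/2}\big)^n$. For a strict partition $\lambda$ of length $r$: if $r$ is even, $|\lambda\rangle_{(GP,b)}=\Phi^{(\beta)(\lambda_1)}_{\lambda_1}e^{\theta^*}\Phi^{(\beta)(\lambda_2)}_{\lambda_2}e^{\theta^*}\cdots\Phi^{(\beta)(\lambda_r)}_{\lambda_r}e^{\theta^*}|\mathrm{vac}\rangle$; if $r$ is odd, the same with an extra factor $\phi^{(\beta)}_0e^{\theta^*}$ inserted just before $|\mathrm{vac}\rangle$. $|\lambda\rangle_{(GQ,b)}$ is defined identically with every $\Phi^{(\beta)(\lambda_i)}_{\lambda_i}$ replaced by $\phi^{(\beta)(\lambda_i)}_{\lambda_i}$. *)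

theory Defs
  imports
    "HOL-Computational_Algebra.Formal_Power_Series"
    "HOL-Computational_Algebra.Fraction_Field"
    "HOL-Computational_Algebra.Polynomial"
    "HOL-Combinatorics.Permutations"
    "HOL-Library.Poly_Mapping"
begin

section \<open>Scalars\<close>

text \<open>
  \<open>qbeta\<close> is \<open>Q(\<beta>)\<close>, \<open>bfield\<close> is \<open>Q(\<beta>)(b\<^sub>1, b\<^sub>2, \<dots>)\<close>, \<open>xfield\<close> is
  \<open>Q(\<beta>)(b\<^sub>1, b\<^sub>2, \<dots>)(x\<^sub>1, x\<^sub>2, \<dots>)\<close>, and \<open>series\<close> is the type of formal power series in
  \<open>x\<^sub>1, x\<^sub>2, \<dots>\<close> over \<open>bfield\<close>: a series is its coefficient function on monomials.
  The families \<open>b\<close> and \<open>x\<close> are indexed from 0, so \<open>b\<^sub>j\<close> is \<open>bK (j - 1)\<close> and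
  \<open>x\<^sub>j\<close> is the variable with number \<open>j - 1\<close>.
\<close>

type_synonym qbeta = "rat poly fract"
type_synonym bfield = "((nat \<Rightarrow>\<^sub>0 nat) \<Rightarrow>\<^sub>0 qbeta) fract"
type_synonym xfield = "((nat \<Rightarrow>\<^sub>0 nat) \<Rightarrow>\<^sub>0 bfield) fract"
type_synonym series = "(nat \<Rightarrow>\<^sub>0 nat) \<Rightarrow> bfield"

definition const_fract :: "'a::idom \<Rightarrow> ((nat \<Rightarrow>\<^sub>0 nat) \<Rightarrow>\<^sub>0 'a) fract" where
  "const_fract c = Fraction_Field.Fract (Poly_Mapping.single 0 c) 1"

definition var_fract :: "nat \<Rightarrow> ((nat \<Rightarrow>\<^sub>0 nat) \<Rightarrow>\<^sub>0 'a::idom) fract" where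
  "var_fract i = Fraction_Field.Fract (Poly_Mapping.single (Poly_Mapping.single i 1) 1) 1"

definition beta :: qbeta where
  "beta = Fraction_Field.Fract [:0, 1:] 1"

definition betaK :: bfield where
  "betaK = const_fract beta"

definition bK :: "nat \<Rightarrow> bfield" where
  "bK j = var_fract j"

section \<open>Factorial Grothendieck P- and Q-functions\<close>

text \<open>A strict partition is the list of its parts.\<close>

definition strict_partition :: "nat list \<Rightarrow> bool" where
  "strict_partition l \<longleftrightarrow> sorted_wrt (>) l \<and> (\<forall>k \<in> set l. k > 0)"

definition oplus :: "'a::field \<Rightarrow> 'a \<Rightarrow> 'a \<Rightarrow> 'a" where
  "oplus \<beta> x y = x + y + \<beta> * x * y"

definition ominus :: "'a::field \<Rightarrow> 'a \<Rightarrow> 'a \<Rightarrow> 'a" where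
  "ominus \<beta> x y = (x - y) / (1 + \<beta> * y)"

definition bracket :: "'a::field \<Rightarrow> (nat \<Rightarrow> 'a) \<Rightarrow> 'a \<Rightarrow> nat \<Rightarrow> 'a" where
  "bracket \<beta> b x k = (\<Prod>j<k. ominus \<beta> x (b j))"

definition dbracket :: "'a::field \<Rightarrow> (nat \<Rightarrow> 'a) \<Rightarrow> 'a \<Rightarrow> nat \<Rightarrow> 'a" where
  "dbracket \<beta> b x k = oplus \<beta> x x * (\<Prod>j<k - 1. ominus \<beta> x (b j))"

definition symmetrization ::
    "'a::field \<Rightarrow> ('a \<Rightarrow> nat \<Rightarrow> 'a) \<Rightarrow> nat list \<Rightarrow> nat \<Rightarrow> (nat \<Rightarrow> 'a) \<Rightarrow> 'a" where
  "symmetrization \<beta> g l n x =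
     (1 / of_nat (fact (n - length l))) *
     (\<Sum>w | w permutes {..<n}.
        (\<Prod>i<length l. g (x (w i)) (l ! i)) *
        (\<Prod>i<length l. \<Prod>j\<in>{i<..<n}.
           oplus \<beta> (x (w i)) (x (w j)) / ominus \<beta> (x (w i)) (x (w j))))"

definition GQ_finite :: "'a::field \<Rightarrow> (nat \<Rightarrow> 'a) \<Rightarrow> nat list \<Rightarrow> nat \<Rightarrow> (nat \<Rightarrow> 'a) \<Rightarrow> 'a" where
  "GQ_finite \<beta> b = symmetrization \<beta> (dbracket \<beta> b)"

definition GP_finite :: "'a::field \<Rightarrow> (nat \<Rightarrow> 'a) \<Rightarrow> nat list \<Rightarrow> nat \<Rightarrow> (nat \<Rightarrow> 'a) \<Rightarrow> 'a" where
  "GP_finite \<beta> b = symmetrization \<beta> (\<lambda>x k. x * bracket \<beta> b x (k - 1))"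

text \<open>
  The series in infinitely many variables determined by a stable family \<open>G n\<close> (\<open>n \<ge> r\<close>):
  for every \<open>n \<ge> r\<close>, setting \<open>x\<^sub>j = 0\<close> for all \<open>j > n\<close> in the series gives a polynomial, and
  this polynomial equals the rational function \<open>G n\<close>. There is at most one such series.
\<close>

definition stable_limit :: "nat \<Rightarrow> (nat \<Rightarrow> xfield) \<Rightarrow> series" where
  "stable_limit r G = (THE f. \<forall>n\<ge>r. \<exists>p.
     (\<forall>\<alpha>. Poly_Mapping.lookup p \<alpha> = (if Poly_Mapping.keys \<alpha> \<subseteq> {..<n} then f \<alpha> else 0)) \<and>
     Fraction_Field.Fract p 1 = G n)"

definition GQ :: "nat list \<Rightarrow> series" where
  "GQ l = stable_limit (length l)
     (\<lambda>n. GQ_finite (const_fract betaK) (\<lambda>j. const_fract (bK j)) l n var_fract)"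

definition GP :: "nat list \<Rightarrow> series" where
  "GP l = stable_limit (length l)
     (\<lambda>n. GP_finite (const_fract betaK) (\<lambda>j. const_fract (bK j)) l n var_fract)"

section \<open>The Clifford algebra of neutral fermions\<close>

text \<open>Words in the letters \<open>\<phi>\<^sub>n\<close> (\<open>n\<close> an integer) form the free monoid, written additively so that
  finitely supported functions on it are the free associative algebra.\<close>

datatype fword = FWord "int list"

instantiation fword :: monoid_add
begin

definition zero_fword :: fword where
  "0 = FWord []"

fun plus_fword :: "fword \<Rightarrow> fword \<Rightarrow> fword" where
  "FWord u + FWord v = FWord (u @ v)"

instance
proof
  fix a b c :: fword
  show "a + b + c = a + (b + c)"
    by (cases a; cases b; cases c) simp
  show "0 + a = a" "a + 0 = a"
    by (cases a; simp add: zero_fword_def)+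
qed

end

type_synonym free_alg = "fword \<Rightarrow>\<^sub>0 qbeta"

definition free_gen :: "int \<Rightarrow> free_alg" where
  "free_gen n = Poly_Mapping.single (FWord [n]) 1"

definition cliff_rel :: "int \<Rightarrow> int \<Rightarrow> free_alg" where
  "cliff_rel m n = free_gen m * free_gen n + free_gen n * free_gen m
     - Poly_Mapping.single 0 (if m + n = 0 then 2 * (- 1) powi m else 0)"

inductive_set cliff_ideal :: "free_alg set" where
  zero: "0 \<in> cliff_ideal"
| add: "x \<in> cliff_ideal \<Longrightarrow> x + a * cliff_rel m n * c \<in> cliff_ideal"

lemma cliff_ideal_add:
  assumes "x \<in> cliff_ideal" "y \<in> cliff_ideal"
  shows "x + y \<in> cliff_ideal"
  using assms(2)
proof (induction y rule: cliff_ideal.induct)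
  case zero
  then show ?case using assms(1) by simp
next
  case (add y a m n c)
  from cliff_ideal.add[OF add.IH] show ?case by (simp only: add.assoc)
qed

lemma cliff_ideal_mult: "x \<in> cliff_ideal \<Longrightarrow> a * x * c \<in> cliff_ideal"
proof (induction x rule: cliff_ideal.induct)
  case (add x a' m n c')
  have "a * (x + a' * cliff_rel m n * c') * c = a * x * c + (a * a') * cliff_rel m n * (c' * c)"
    by (simp add: algebra_simps)
  then show ?case by (simp only:) (rule cliff_ideal.add[OF add.IH])
qed (simp add: cliff_ideal.zero)

lemma cliff_ideal_uminus: "x \<in> cliff_ideal \<Longrightarrow> - x \<in> cliff_ideal"
  using cliff_ideal_mult[of x "-1" 1] by simp

text \<open>
  The following action of the free algebra on the exterior algebra over \<open>\<phi>\<^sub>1, \<phi>\<^sub>2, \<dots>\<close>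
  (a vector is its coefficient function on finite sets of positive numbers) serves only to show
  that the quotients below do not collapse and that the pairing assumed later exists.
\<close>

definition mode_sign :: "nat \<Rightarrow> nat set \<Rightarrow> 'r::comm_ring_1" where
  "mode_sign m S = (- 1) ^ card {k \<in> S. k < m}"

definition mode :: "int \<Rightarrow> (nat set \<Rightarrow> 'r) \<Rightarrow> nat set \<Rightarrow> 'r::comm_ring_1" where
  "mode n f S =
    (if n > 0 then (if nat n \<in> S then mode_sign (nat n) S * f (S - {nat n}) else 0)
     else if n < 0 then
       (if nat (- n) \<in> S then 0
        else 2 * (- 1) ^ nat (- n) * mode_sign (nat (- n)) S * f (insert (nat (- n)) S))
     else (- 1) ^ card S * f S)"

lemma mode_sign_insert:
  assumes "finite S" "m \<notin> S"
  shows "mode_sign n (insert m S) = (if m < n then - mode_sign n S else mode_sign n S)"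
proof -
  have "{k \<in> insert m S. k < n} = (if m < n then insert m {k \<in> S. k < n} else {k \<in> S. k < n})"
    by auto
  then show ?thesis
    using assms by (simp add: mode_sign_def)
qed

lemma mode_sign_remove:
  assumes "finite S" "m \<in> S"
  shows "mode_sign n (S - {m}) =
    (if m < n then - mode_sign n S else (mode_sign n S :: 'r::comm_ring_1))"
proof -
  have "finite (S - {m})" "m \<notin> S - {m}" "insert m (S - {m}) = S"
    using assms by auto
  from mode_sign_insert[OF this(1,2), of n, where ?'a = 'r, unfolded this(3)] show ?thesis
    by simp
qed

lemma mode_sign_square: "mode_sign n S * mode_sign n S = 1"
  by (simp add: mode_sign_def flip: power_mult_distrib)

lemma mode_sign_square': "mode_sign n S * (mode_sign n S * x) = x"
  by (simp add: mode_sign_square flip: mult.assoc)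

lemma card_remove_sign:
  assumes "finite S" "m \<in> S"
  shows "(- 1 :: 'r::comm_ring_1) ^ (card S - Suc 0) = - ((- 1) ^ card S)"
proof -
  have "card S = Suc (card S - Suc 0)"
    using assms by (metis Suc_pred' card_gt_0_iff empty_iff One_nat_def)
  then show ?thesis
    by (metis power_Suc mult_minus1 minus_minus)
qed

lemma mode_anticomm:
  fixes f :: "nat set \<Rightarrow> 'r::comm_ring_1"
  assumes S: "finite S"
  shows "mode m (mode n f) S + mode n (mode m f) S =
    (if m + n = 0 then 2 * (- 1) ^ nat \<bar>m\<bar> else 0) * f S"
proof -
  have sq: "(- 1 :: 'r) ^ k * ((- 1) ^ k * x) = x" for k x
    by (simp flip: mult.assoc power_mult_distrib)
  have pp: "mode m (mode n f) S + mode n (mode m f) S = 0" if "m > 0" "n > 0" for m n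
  proof (cases "m = n")
    case False
    then have "nat m \<noteq> nat n" using that by simp
    then show ?thesis using that S
      by (cases "nat m < nat n")
        (auto simp: mode_def mode_sign_remove insert_commute Diff_insert2[symmetric] Diff_insert[symmetric])
  qed (use that in \<open>simp add: mode_def\<close>)
  have nn: "mode m (mode n f) S + mode n (mode m f) S = 0" if "m < 0" "n < 0" for m n
  proof (cases "m = n")
    case False
    then have "nat (-m) \<noteq> nat (-n)" using that by simp
    then show ?thesis using that S
      by (cases "nat (-m) < nat (-n)") (auto simp: mode_def mode_sign_insert insert_commute)
  qed (use that in \<open>simp add: mode_def\<close>)
  have pn: "mode m (mode n f) S + mode n (mode m f) S =
      (if m + n = 0 then 2 * (- 1) ^ nat \<bar>m\<bar> else 0) * f S" if "m > 0" "n < 0" for m n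
  proof (cases "m + n = 0")
    case True
    then have n: "n = - m" by simp
    show ?thesis using that S
      by (auto simp: n mode_def mode_sign_insert mode_sign_remove insert_absorb mode_sign_square' mult_ac)
  next
    case False
    then have ne: "nat m \<noteq> nat (- n)" using that by auto
    then have "insert (nat (- n)) S - {nat m} = insert (nat (- n)) (S - {nat m})" by auto
    with ne that S False show ?thesis
      by (cases "nat m < nat (-n)") (auto simp: mode_def mode_sign_insert mode_sign_remove)
  qed
  have z: "mode m (mode 0 f) S + mode 0 (mode m f) S = (if m = 0 then 2 else 0) * f S" for m
    using S by (auto simp: mode_def card_remove_sign[where ?'r = 'r] sq mult_ac)
  consider "m > 0" "n > 0" | "m < 0" "n < 0" | "m > 0" "n < 0" | "m < 0" "n > 0" | "m = 0" | "n = 0"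
    by linarith
  then show ?thesis
  proof cases
    case 4
    have "nat \<bar>n\<bar> = nat \<bar>m\<bar>" if "m + n = 0" using that by simp
    then show ?thesis using pn[of n m] 4 by (auto simp: add.commute)
  next
    case 5
    show ?thesis using z[of n] by (auto simp: 5 add.commute)
  next
    case 6
    show ?thesis using z[of m] by (auto simp: 6 add.commute)
  qed (use pp nn pn in auto)
qed

fun word_act :: "fword \<Rightarrow> (nat set \<Rightarrow> 'r) \<Rightarrow> nat set \<Rightarrow> 'r::comm_ring_1" where
  "word_act (FWord w) f = List.foldr mode w f"

lemma word_act_plus: "word_act (u + v) f = word_act u (word_act v f)"
  by (cases u; cases v) simp

lemma mode_sum: "mode n (\<lambda>S. \<Sum>i\<in>I. c i * f i S) S = (\<Sum>i\<in>I. c i * mode n (f i) S)"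
  by (simp add: mode_def sum_distrib_left mult_ac)

lemma word_act_sum:
  "word_act w (\<lambda>S. \<Sum>i\<in>I. c i * f i S) = (\<lambda>S. \<Sum>i\<in>I. c i * word_act w (f i) S)"
proof -
  have "List.foldr mode u (\<lambda>S. \<Sum>i\<in>I. c i * f i S) = (\<lambda>S. \<Sum>i\<in>I. c i * List.foldr mode u (f i) S)" for u
    by (induction u) (auto simp: mode_sum)
  then show ?thesis by (cases w) simp
qed

definition alg_act :: "(fword \<Rightarrow>\<^sub>0 'r) \<Rightarrow> (nat set \<Rightarrow> 'r) \<Rightarrow> nat set \<Rightarrow> 'r::comm_ring_1" where
  "alg_act a f S = (\<Sum>w\<in>Poly_Mapping.keys a. Poly_Mapping.lookup a w * word_act w f S)"

lemma alg_act_superset: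
  assumes "finite A" "Poly_Mapping.keys a \<subseteq> A"
  shows "alg_act a f S = (\<Sum>w\<in>A. Poly_Mapping.lookup a w * word_act w f S)"
  unfolding alg_act_def using assms
  by (intro sum.mono_neutral_left) (auto simp: in_keys_iff)

lemma alg_act_add: "alg_act (a + c) f S = alg_act a f S + alg_act c f S"
proof -
  let ?A = "Poly_Mapping.keys a \<union> Poly_Mapping.keys c"
  have "Poly_Mapping.keys (a + c) \<subseteq> ?A" by (rule Poly_Mapping.keys_add)
  then show ?thesis
    by (simp add: alg_act_superset[of ?A] lookup_add distrib_right sum.distrib)
qed

lemma alg_act_zero: "alg_act 0 f S = 0"
  by (simp add: alg_act_def)

lemma alg_act_uminus: "alg_act (- a) f S = - alg_act a f S"
  using alg_act_add[of a "- a" f S] by (simp add: alg_act_zero add_eq_0_iff)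

lemma alg_act_single: "alg_act (Poly_Mapping.single w c) f S = c * word_act w f S"
  by (simp add: alg_act_def)

lemma single_induct [case_names zero add]:
  assumes "P 0" and "\<And>a w c. P a \<Longrightarrow> P (a + Poly_Mapping.single w c)"
  shows "P (a :: fword \<Rightarrow>\<^sub>0 'r::comm_ring_1)"
proof (induction a rule: update_induct)
  case const
  show ?case by (rule assms(1))
next
  case (update f a b)
  have "Poly_Mapping.update a b f = f + Poly_Mapping.single a b"
    using update by (intro poly_mapping_eqI) (auto simp: lookup_update lookup_add lookup_single in_keys_iff when_def)
  with assms(2) update show ?case by simp
qed

lemma word_act_add: "word_act w (\<lambda>S. f S + g S) S = word_act w f S + word_act w g S"
  using word_act_sum[where w = w and I = "{True, False}" and c = "\<lambda>_. 1" and f = "\<lambda>b. if b then f else g"] by (simp add: fun_eq_iff)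

lemma word_act_scale: "word_act w (\<lambda>S. c * f S) S = c * word_act w f S"
  using word_act_sum[where w = w and I = "{True}" and c = "\<lambda>_. c" and f = "\<lambda>b. f"] by (simp add: fun_eq_iff)

lemma word_act_zero: "word_act w (\<lambda>S. 0) S = 0"
  using word_act_scale[of w 0 "\<lambda>_. 0"] by simp

lemma alg_act_mult: "alg_act (a * c) f S = alg_act a (alg_act c f) S"
proof (induction a rule: single_induct)
  case (add a w x)
  have "alg_act (Poly_Mapping.single w x * c) f S = x * word_act w (alg_act c f) S"
  proof (induction c rule: single_induct)
    case zero
    show ?case by (simp add: alg_act_zero[abs_def] word_act_zero alg_act_zero)
  next
    case (add c v y)
    have "alg_act (c + Poly_Mapping.single v y) f = (\<lambda>S. alg_act c f S + y * word_act v f S)"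
      by (rule ext) (simp add: alg_act_add alg_act_single)
    then show ?case using add
      by (simp add: distrib_left alg_act_add mult_single alg_act_single word_act_add word_act_scale
          word_act_plus algebra_simps)
  qed
  with add show ?case by (simp add: distrib_right alg_act_add alg_act_single)
qed (simp add: alg_act_zero)


lemma word_act_vanish:
  assumes "\<And>S. finite S \<Longrightarrow> f S = 0" "finite S"
  shows "word_act w f S = 0"
proof -
  have "List.foldr mode u f T = 0" if "finite T" for u T
    using that by (induction u arbitrary: T) (auto simp: mode_def assms(1))
  with assms(2) show ?thesis by (cases w) simp
qed

lemma alg_act_vanish:
  assumes "\<And>S. finite S \<Longrightarrow> f S = 0" "finite S"
  shows "alg_act a f S = 0"
  using assms by (simp add: alg_act_def word_act_vanish)

lemma alg_act_gen: "alg_act (free_gen n) f = mode n f"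
  by (simp add: fun_eq_iff free_gen_def alg_act_single)

lemma alg_act_scalar: "alg_act (Poly_Mapping.single 0 c) f S = c * f S"
  by (simp add: alg_act_single zero_fword_def)

lemma alg_act_rel:
  assumes "finite S"
  shows "alg_act (cliff_rel m n) f S = 0"
proof -
  have sgn: "(- 1 :: qbeta) powi m = (- 1) ^ nat \<bar>m\<bar>"
    by (cases m rule: int_cases2) (simp_all add: power_int_minus flip: power_inverse)
  have "alg_act (cliff_rel m n) f S =
      mode m (mode n f) S + mode n (mode m f) S - (if m + n = 0 then 2 * (- 1) powi m else 0) * f S"
    unfolding cliff_rel_def diff_conv_add_uminus
    by (simp only: alg_act_add alg_act_uminus alg_act_mult alg_act_gen alg_act_scalar)
  then show ?thesis
    using mode_anticomm[OF assms, of m n f] by (simp add: sgn)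
qed

lemma alg_act_ideal:
  assumes "x \<in> cliff_ideal" "finite S"
  shows "alg_act x f S = 0"
  using assms(1)
proof (induction x rule: cliff_ideal.induct)
  case (add x a m n c)
  have "alg_act (a * cliff_rel m n * c) f S = 0"
    using assms(2) by (simp add: alg_act_mult alg_act_vanish alg_act_rel)
  with add show ?case by (simp add: alg_act_add)
qed (simp add: alg_act_zero)

definition empty_state :: "nat set \<Rightarrow> qbeta" where
  "empty_state S = (if S = {} then 1 else 0)"

lemma one_notin_cliff_ideal: "1 \<notin> cliff_ideal"
proof
  assume "1 \<in> cliff_ideal"
  from alg_act_ideal[OF this, of "{}" empty_state] show False
    using alg_act_scalar[of 1 empty_state "{}"] by (simp add: empty_state_def)
qed

quotient_type cliff = free_alg / "\<lambda>x y. x - y \<in> cliff_ideal"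
proof (rule equivpI)
  show "reflp (\<lambda>x y. x - y \<in> cliff_ideal)"
    by (auto intro!: reflpI cliff_ideal.zero)
  show "symp (\<lambda>x y. x - y \<in> cliff_ideal)"
  proof (rule sympI)
    fix x y assume "x - y \<in> cliff_ideal"
    from cliff_ideal_uminus[OF this] show "y - x \<in> cliff_ideal" by simp
  qed
  show "transp (\<lambda>x y. x - y \<in> cliff_ideal)"
  proof (rule transpI)
    fix x y z assume "x - y \<in> cliff_ideal" "y - z \<in> cliff_ideal"
    from cliff_ideal_add[OF this] show "x - z \<in> cliff_ideal" by simp
  qed
qed

instantiation cliff :: ring_1
begin

lift_definition zero_cliff :: cliff is 0 .

lift_definition one_cliff :: cliff is 1 .

lift_definition plus_cliff :: "cliff \<Rightarrow> cliff \<Rightarrow> cliff" is "(+)"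
proof -
  fix a a' c c' :: free_alg
  assume "a - a' \<in> cliff_ideal" "c - c' \<in> cliff_ideal"
  from cliff_ideal_add[OF this] show "a + c - (a' + c') \<in> cliff_ideal"
    by (simp add: algebra_simps)
qed

lift_definition uminus_cliff :: "cliff \<Rightarrow> cliff" is uminus
proof -
  fix a a' :: free_alg
  assume "a - a' \<in> cliff_ideal"
  from cliff_ideal_uminus[OF this] show "- a - - a' \<in> cliff_ideal"
    by simp
qed

lift_definition minus_cliff :: "cliff \<Rightarrow> cliff \<Rightarrow> cliff" is "(-)"
proof -
  fix a a' c c' :: free_alg
  assume "a - a' \<in> cliff_ideal" "c - c' \<in> cliff_ideal"
  then have "(a - a') + - (c - c') \<in> cliff_ideal"
    by (intro cliff_ideal_add cliff_ideal_uminus)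
  then show "a - c - (a' - c') \<in> cliff_ideal"
    by (simp add: algebra_simps)
qed

lift_definition times_cliff :: "cliff \<Rightarrow> cliff \<Rightarrow> cliff" is "(*)"
proof -
  fix a a' c c' :: free_alg
  assume "a - a' \<in> cliff_ideal" "c - c' \<in> cliff_ideal"
  then have "1 * (a - a') * c + a' * (c - c') * 1 \<in> cliff_ideal"
    by (intro cliff_ideal_add cliff_ideal_mult)
  then show "a * c - a' * c' \<in> cliff_ideal"
    by (simp add: algebra_simps)
qed

instance
proof
  fix a b c :: cliff
  show "a + b + c = a + (b + c)" "a + b = b + a" "0 + a = a" "- a + a = 0" "a - b = a + - b"
    "a * b * c = a * (b * c)" "1 * a = a" "a * 1 = a"
    "(a + b) * c = a * c + b * c" "a * (b + c) = a * b + a * c"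
    by (transfer; simp add: algebra_simps cliff_ideal.zero)+
  show "(0 :: cliff) \<noteq> 1"
    by transfer (use cliff_ideal_uminus one_notin_cliff_ideal in force)
qed

end

lift_definition phi :: "int \<Rightarrow> cliff" is free_gen .

definition cliff_scalar :: "qbeta \<Rightarrow> cliff" where
  "cliff_scalar c = abs_cliff (Poly_Mapping.single 0 c)"

definition vac_value :: "cliff \<Rightarrow> qbeta" where
  "vac_value a = alg_act (rep_cliff a) empty_state {}"

lemma vac_value_abs: "vac_value (abs_cliff a) = alg_act a empty_state {}"
proof -
  have "rep_cliff (abs_cliff a) - a \<in> cliff_ideal"
    using Quotient3_rep_abs[OF Quotient3_cliff, of a] by (simp add: cliff_ideal.zero)
  from alg_act_ideal[OF this, of "{}" empty_state] show ?thesis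
    using alg_act_add[of "rep_cliff (abs_cliff a) - a" a empty_state "{}"]
    by (simp add: vac_value_def)
qed

lemma vac_value_add: "vac_value (a + c) = vac_value a + vac_value c"
  by (induction a rule: cliff.abs_induct, induction c rule: cliff.abs_induct)
    (simp add: plus_cliff.abs_eq vac_value_abs alg_act_add)

lemma vac_value_scalar: "vac_value (cliff_scalar s * a) = s * vac_value a"
  by (induction a rule: cliff.abs_induct)
    (simp add: cliff_scalar_def times_cliff.abs_eq vac_value_abs alg_act_mult alg_act_scalar)

lemma vac_value_one: "vac_value 1 = 1"
  using alg_act_scalar[of 1 empty_state "{}"]
  by (simp add: one_cliff.abs_eq vac_value_abs empty_state_def)

lemma vac_value_right:
  assumes "n < 0"
  shows "vac_value (a * phi n) = 0"
proof -
  have "mode n empty_state S = 0" for S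
    using assms by (simp add: mode_def empty_state_def)
  then show ?thesis
    by (induction a rule: cliff.abs_induct)
      (simp add: phi.abs_eq times_cliff.abs_eq vac_value_abs alg_act_mult alg_act_gen alg_act_vanish)
qed

lemma vac_value_left: "n > 0 \<Longrightarrow> vac_value (phi n * a) = 0"
  by (induction a rule: cliff.abs_induct)
    (simp add: phi.abs_eq times_cliff.abs_eq vac_value_abs alg_act_mult alg_act_gen mode_def)

lemma cliff_scalar_commute: "a * cliff_scalar s = cliff_scalar s * a"
proof (induction a rule: cliff.abs_induct)
  fix a :: free_alg
  have "a * Poly_Mapping.single 0 s = Poly_Mapping.single 0 s * a"
    by (induction a rule: single_induct) (simp_all add: algebra_simps mult_single)
  then show "abs_cliff a * cliff_scalar s = cliff_scalar s * abs_cliff a"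
    by (simp add: cliff_scalar_def times_cliff.abs_eq)
qed

lifting_forget cliff.lifting

section \<open>The Fock space, its dual and the pairing\<close>

text \<open>The Fock space is the Clifford algebra modulo the left ideal generated by \<open>\<phi>\<^sub>n\<close>
  (\<open>n < 0\<close>), its dual is the Clifford algebra modulo the right ideal generated by \<open>\<phi>\<^sub>n\<close> (\<open>n > 0\<close>).\<close>

inductive_set left_ideal :: "cliff set" where
  zero: "0 \<in> left_ideal"
| add: "x \<in> left_ideal \<Longrightarrow> n < 0 \<Longrightarrow> x + a * phi n \<in> left_ideal"

inductive_set right_ideal :: "cliff set" where
  zero: "0 \<in> right_ideal"
| add: "x \<in> right_ideal \<Longrightarrow> n > 0 \<Longrightarrow> x + phi n * a \<in> right_ideal"

lemma left_ideal_add: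
  assumes "x \<in> left_ideal" "y \<in> left_ideal"
  shows "x + y \<in> left_ideal"
  using assms(2)
proof (induction y rule: left_ideal.induct)
  case zero
  then show ?case using assms(1) by simp
next
  case (add y n a)
  from left_ideal.add[OF add.IH add.hyps(2)] show ?case by (simp only: add.assoc)
qed

lemma right_ideal_add:
  assumes "x \<in> right_ideal" "y \<in> right_ideal"
  shows "x + y \<in> right_ideal"
  using assms(2)
proof (induction y rule: right_ideal.induct)
  case zero
  then show ?case using assms(1) by simp
next
  case (add y n a)
  from right_ideal.add[OF add.IH add.hyps(2)] show ?case by (simp only: add.assoc)
qed

lemma left_ideal_mult: "x \<in> left_ideal \<Longrightarrow> c * x \<in> left_ideal"
proof (induction x rule: left_ideal.induct)
  case (add x n a)
  have "c * (x + a * phi n) = c * x + (c * a) * phi n"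
    by (simp add: algebra_simps)
  then show ?case by (simp only:) (rule left_ideal.add[OF add.IH add.hyps(2)])
qed (simp add: left_ideal.zero)

lemma right_ideal_mult: "x \<in> right_ideal \<Longrightarrow> x * c \<in> right_ideal"
proof (induction x rule: right_ideal.induct)
  case (add x n a)
  have "(x + phi n * a) * c = x * c + phi n * (a * c)"
    by (simp add: algebra_simps)
  then show ?case by (simp only:) (rule right_ideal.add[OF add.IH add.hyps(2)])
qed (simp add: right_ideal.zero)

lemma left_ideal_uminus: "x \<in> left_ideal \<Longrightarrow> - x \<in> left_ideal"
  using left_ideal_mult[of x "-1"] by simp

lemma right_ideal_uminus: "x \<in> right_ideal \<Longrightarrow> - x \<in> right_ideal"
  using right_ideal_mult[of x "-1"] by simp

quotient_type fock = cliff / "\<lambda>x y. x - y \<in> left_ideal"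
proof (rule equivpI)
  show "reflp (\<lambda>x y. x - y \<in> left_ideal)"
    by (auto intro!: reflpI left_ideal.zero)
  show "symp (\<lambda>x y. x - y \<in> left_ideal)"
  proof (rule sympI)
    fix x y assume "x - y \<in> left_ideal"
    from left_ideal_uminus[OF this] show "y - x \<in> left_ideal" by simp
  qed
  show "transp (\<lambda>x y. x - y \<in> left_ideal)"
  proof (rule transpI)
    fix x y z assume "x - y \<in> left_ideal" "y - z \<in> left_ideal"
    from left_ideal_add[OF this] show "x - z \<in> left_ideal" by simp
  qed
qed

quotient_type fock_dual = cliff / "\<lambda>x y. x - y \<in> right_ideal"
proof (rule equivpI)
  show "reflp (\<lambda>x y. x - y \<in> right_ideal)"
    by (auto intro!: reflpI right_ideal.zero)
  show "symp (\<lambda>x y. x - y \<in> right_ideal)"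
  proof (rule sympI)
    fix x y assume "x - y \<in> right_ideal"
    from right_ideal_uminus[OF this] show "y - x \<in> right_ideal" by simp
  qed
  show "transp (\<lambda>x y. x - y \<in> right_ideal)"
  proof (rule transpI)
    fix x y z assume "x - y \<in> right_ideal" "y - z \<in> right_ideal"
    from right_ideal_add[OF this] show "x - z \<in> right_ideal" by simp
  qed
qed

instantiation fock :: ab_group_add
begin

lift_definition zero_fock :: fock is 0 .

lift_definition plus_fock :: "fock \<Rightarrow> fock \<Rightarrow> fock" is "(+)"
proof -
  fix a a' c c' :: cliff
  assume "a - a' \<in> left_ideal" "c - c' \<in> left_ideal"
  from left_ideal_add[OF this] show "a + c - (a' + c') \<in> left_ideal"
    by (simp add: algebra_simps)
qed

lift_definition uminus_fock :: "fock \<Rightarrow> fock" is uminus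
proof -
  fix a a' :: cliff
  assume "a - a' \<in> left_ideal"
  from left_ideal_uminus[OF this] show "- a - - a' \<in> left_ideal" by simp
qed

definition minus_fock :: "fock \<Rightarrow> fock \<Rightarrow> fock" where
  "minus_fock u v = u + - v"

instance
proof
  fix a b c :: fock
  show "a + b + c = a + (b + c)" "a + b = b + a" "0 + a = a" "- a + a = 0"
    by (transfer; simp add: algebra_simps left_ideal.zero)+
  show "a - b = a + - b" by (rule minus_fock_def)
qed

end

instantiation fock_dual :: ab_group_add
begin

lift_definition zero_fock_dual :: fock_dual is 0 .

lift_definition plus_fock_dual :: "fock_dual \<Rightarrow> fock_dual \<Rightarrow> fock_dual" is "(+)"
proof -
  fix a a' c c' :: cliff
  assume "a - a' \<in> right_ideal" "c - c' \<in> right_ideal"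
  from right_ideal_add[OF this] show "a + c - (a' + c') \<in> right_ideal"
    by (simp add: algebra_simps)
qed

lift_definition uminus_fock_dual :: "fock_dual \<Rightarrow> fock_dual" is uminus
proof -
  fix a a' :: cliff
  assume "a - a' \<in> right_ideal"
  from right_ideal_uminus[OF this] show "- a - - a' \<in> right_ideal" by simp
qed

definition minus_fock_dual :: "fock_dual \<Rightarrow> fock_dual \<Rightarrow> fock_dual" where
  "minus_fock_dual u v = u + - v"

instance
proof
  fix a b c :: fock_dual
  show "a + b + c = a + (b + c)" "a + b = b + a" "0 + a = a" "- a + a = 0"
    by (transfer; simp add: algebra_simps right_ideal.zero)+
  show "a - b = a + - b" by (rule minus_fock_dual_def)
qed

end

lift_definition ket_vac :: fock is 1 .

lift_definition bra_vac :: fock_dual is 1 .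

lift_definition left_act :: "cliff \<Rightarrow> fock \<Rightarrow> fock" (infixr "\<rhd>" 70) is "(*)"
  by (metis left_ideal_mult right_diff_distrib)

lift_definition right_act :: "fock_dual \<Rightarrow> cliff \<Rightarrow> fock_dual" (infixl "\<lhd>" 70) is "(*)"
  by (metis right_ideal_mult left_diff_distrib)

text \<open>
  These axioms determine the pairing up to the value of \<open>\<langle>vac|\<phi>\<^sub>0|vac\<rangle>\<close>, which does not matter
  below: only products of an even number of fermions occur between the two vacua.
\<close>

definition fock_pairing :: "(fock_dual \<Rightarrow> fock \<Rightarrow> qbeta) \<Rightarrow> bool" where
  "fock_pairing B \<longleftrightarrow>
    (\<forall>u u' v. B (u + u') v = B u v + B u' v) \<and>
    (\<forall>u v v'. B u (v + v') = B u v + B u v') \<and>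
    (\<forall>c u v. B (u \<lhd> cliff_scalar c) v = c * B u v) \<and>
    (\<forall>c u v. B u (cliff_scalar c \<rhd> v) = c * B u v) \<and>
    (\<forall>u a v. B (u \<lhd> a) v = B u (a \<rhd> v)) \<and>
    B bra_vac ket_vac = 1"

lemma vac_value_left_ideal: "x \<in> left_ideal \<Longrightarrow> vac_value x = 0"
  by (induction rule: left_ideal.induct)
    (use vac_value_add[of 0 0] in \<open>simp_all add: vac_value_add vac_value_right\<close>)

lemma vac_value_right_ideal: "x \<in> right_ideal \<Longrightarrow> vac_value x = 0"
  by (induction rule: right_ideal.induct)
    (use vac_value_add[of 0 0] in \<open>simp_all add: vac_value_add vac_value_left\<close>)

lemma vac_value_diff:
  "u - u' \<in> right_ideal \<Longrightarrow> vac_value (u * v) = vac_value (u' * v)"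
  "v - v' \<in> left_ideal \<Longrightarrow> vac_value (u * v) = vac_value (u * v')"
  using vac_value_add[of "(u - u') * v" "u' * v"] vac_value_add[of "u * (v - v')" "u * v'"]
    vac_value_right_ideal[OF right_ideal_mult, of "u - u'" v]
    vac_value_left_ideal[OF left_ideal_mult, of "v - v'" u]
  by (simp_all add: algebra_simps)

definition vac_pairing :: "fock_dual \<Rightarrow> fock \<Rightarrow> qbeta" where
  "vac_pairing u v = vac_value (rep_fock_dual u * rep_fock v)"

lemma vac_pairing_abs: "vac_pairing (abs_fock_dual u) (abs_fock v) = vac_value (u * v)"
proof -
  have "rep_fock_dual (abs_fock_dual u) - u \<in> right_ideal"
    using Quotient3_rep_abs[OF Quotient3_fock_dual, of u] by (simp add: right_ideal.zero)
  moreover have "rep_fock (abs_fock v) - v \<in> left_ideal"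
    using Quotient3_rep_abs[OF Quotient3_fock, of v] by (simp add: left_ideal.zero)
  ultimately show ?thesis
    unfolding vac_pairing_def by (metis vac_value_diff)
qed

lemma fock_pairing_vac_pairing: "fock_pairing vac_pairing"
  unfolding fock_pairing_def
proof (intro conjI allI)
  fix u u' :: fock_dual and v v' :: fock and a c
  obtain x x' y y' where [simp]:
    "u = abs_fock_dual x" "u' = abs_fock_dual x'" "v = abs_fock y" "v' = abs_fock y'"
    by (metis Quotient3_abs_rep[OF Quotient3_fock] Quotient3_abs_rep[OF Quotient3_fock_dual])
  note abs = plus_fock.abs_eq plus_fock_dual.abs_eq left_act.abs_eq right_act.abs_eq vac_pairing_abs
  have scalar: "x * cliff_scalar c * y = cliff_scalar c * (x * y)"
    by (simp add: cliff_scalar_commute mult.assoc)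
  show "vac_pairing (u + u') v = vac_pairing u v + vac_pairing u' v"
    "vac_pairing u (v + v') = vac_pairing u v + vac_pairing u v'"
    by (simp_all add: abs distrib_left distrib_right vac_value_add)
  show "vac_pairing (u \<lhd> cliff_scalar c) v = c * vac_pairing u v"
    by (simp add: abs scalar vac_value_scalar)
  show "vac_pairing u (cliff_scalar c \<rhd> v) = c * vac_pairing u v"
    using scalar by (simp add: abs vac_value_scalar mult.assoc)
  show "vac_pairing (u \<lhd> a) v = vac_pairing u (a \<rhd> v)"
    by (simp add: abs mult.assoc)
  show "vac_pairing bra_vac ket_vac = 1"
    by (simp add: ket_vac.abs_eq bra_vac.abs_eq vac_pairing_abs vac_value_one)
qed

section \<open>Fermions acting on the completed Fock space\<close>

text \<open>
  Infinite combinations of vectors such as \<open>exp(\<theta>\<^sup>*)|vac\<rangle>\<close>, with \<open>b\<^sub>j\<close> and \<open>x\<^sub>j\<close> as further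
  scalars, are represented by the \<open>Q(\<beta>)\<close>-linear functional \<open>u \<mapsto> \<langle>u|v\<rangle>\<close> on the dual Fock
  space, with values in \<open>series\<close>. An element \<open>a\<close> of the Clifford algebra acts by
  \<open>\<langle>u|a v\<rangle> = \<langle>u a|v\<rangle>\<close>.

  Infinite sums are taken for each \<open>u\<close> and each monomial in \<open>x\<close> separately, where only finitely
  many terms are nonzero if the functional is linear: \<open>u \<phi>\<^sub>m = 0\<close> for large \<open>m\<close>; hence
  \<open>u \<phi>\<^bsub>-i-n\<^esub> \<phi>\<^sub>i = - u \<phi>\<^sub>i \<phi>\<^bsub>-i-n\<^esub>\<close> (\<open>n\<close> odd) is nonzero for finitely many \<open>i\<close> only, and the modes
  \<open>b\<^bsub>-n\<^esub>\<close> with \<open>n > 0\<close> lower the degree of \<open>u\<close>; the \<open>n\<close>-th power sum has no terms of degree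
  less than \<open>n\<close>.
\<close>

type_synonym ket = "fock_dual \<Rightarrow> series"

definition ket_sum :: "('i \<Rightarrow> ket) \<Rightarrow> ket" where
  "ket_sum F = (\<lambda>u \<alpha>. Sum_any (\<lambda>i. F i u \<alpha>))"

definition ket_scale :: "bfield \<Rightarrow> ket \<Rightarrow> ket" where
  "ket_scale c F = (\<lambda>u \<alpha>. c * F u \<alpha>)"

text \<open>\<open>prod_fun\<close> is the Cauchy product; the factors need not have finite support because a
  monomial has only finitely many divisors.\<close>

definition ket_mult :: "series \<Rightarrow> ket \<Rightarrow> ket" where
  "ket_mult p F = (\<lambda>u. prod_fun p (F u))"

definition ket_act :: "cliff \<Rightarrow> ket \<Rightarrow> ket" where
  "ket_act a F = (\<lambda>u. F (u \<lhd> a))"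

definition ket_exp :: "(ket \<Rightarrow> ket) \<Rightarrow> ket \<Rightarrow> ket" where
  "ket_exp A F = ket_sum (\<lambda>k::nat. ket_scale (1 / of_nat (fact k)) ((A ^^ k) F))"

definition vac :: "(fock_dual \<Rightarrow> fock \<Rightarrow> qbeta) \<Rightarrow> ket" where
  "vac B = (\<lambda>u \<alpha>. if \<alpha> = 0 then const_fract (B u ket_vac) else 0)"

text \<open>
  The scalar in front of \<open>\<phi>\<^sub>m\<close> is the coefficient of \<open>z\<^sup>n\<close> in \<open>(z + \<beta>/2)\<^sup>m\<close>; for negative \<open>n\<close>
  the scalar in front of \<open>\<phi>\<^bsub>-m\<^esub>\<close> is the coefficient of \<open>t\<^bsup>-n\<^esup>\<close> in \<open>(t/(1 + (\<beta>/2) t))\<^sup>m\<close>,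
  where \<open>t = 1/z\<close>.
\<close>

definition phiB :: "int \<Rightarrow> ket \<Rightarrow> ket" where
  "phiB n F =
    (if n \<ge> 0
     then ket_sum (\<lambda>m::nat. ket_scale (poly.coeff ([:betaK / 2, 1:] ^ m) (nat n))
                              (ket_act (phi (int m)) F))
     else ket_sum (\<lambda>m::nat. if m = 0 then (\<lambda>_ _. 0) else
                              ket_scale
                                (fps_nth ((fps_X / (1 + fps_const (betaK / 2) * fps_X)) ^ m) (nat (- n)))
                                (ket_act (phi (- int m)) F)))"

definition PhiB :: "int \<Rightarrow> ket \<Rightarrow> ket" where
  "PhiB n F = ket_scale (1 / 2) (ket_sum (\<lambda>k::nat. ket_scale ((- betaK / 2) ^ k) (phiB (n + int k) F)))"

text \<open>\<open>dressed P k i\<close> is the coefficient of \<open>z\<^sup>i\<close> in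
  \<open>(\<Prod>j=1..k-1. (1 - z b\<^sub>j)/(1 + \<beta> b\<^sub>j)) * (\<Sum>n. P n * z\<^sup>n)\<close>.\<close>

definition dressed :: "(int \<Rightarrow> ket \<Rightarrow> ket) \<Rightarrow> nat \<Rightarrow> int \<Rightarrow> ket \<Rightarrow> ket" where
  "dressed P k i F =
    ket_sum (\<lambda>s::nat. ket_scale
      (poly.coeff (\<Prod>j<k - 1. Polynomial.smult (1 / (1 + betaK * bK j)) [:1, - bK j:]) s)
      (P (i - int s) F))"

definition boson :: "int \<Rightarrow> ket \<Rightarrow> ket" where
  "boson n F =
    ket_scale (1 / 4) (ket_sum (\<lambda>i::int. ket_scale ((- 1) powi i) (ket_act (phi (- i - n) * phi i) F)))"

definition theta_star :: "ket \<Rightarrow> ket" where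
  "theta_star F =
    ket_sum (\<lambda>n::nat. ket_scale (if odd n then 2 * (betaK / 2) ^ n / of_nat n else 0)
                        (boson (- int n) F))"

text \<open>The image of a power series in one variable under \<open>z \<mapsto> x\<close>, where \<open>x\<close> is the variable with
  number \<open>i\<close>.\<close>

definition in_var :: "nat \<Rightarrow> bfield fps \<Rightarrow> series" where
  "in_var i f \<alpha> =
    (if Poly_Mapping.keys \<alpha> \<subseteq> {i} then fps_nth f (Poly_Mapping.lookup \<alpha> i) else 0)"

definition power_sum :: "nat \<Rightarrow> series" where
  "power_sum n \<alpha> =
    Sum_any (\<lambda>i. in_var i ((fps_X / (1 + fps_const (betaK / 2) * fps_X)) ^ n) \<alpha>)"

definition hamiltonian :: "ket \<Rightarrow> ket" where
  "hamiltonian F =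
    ket_sum (\<lambda>n::nat. ket_scale (if odd n then 2 / of_nat n else 0)
                        (ket_mult (power_sum n) (boson (int n) F)))"

text \<open>\<open>ket_of P B l\<close> is \<open>P\<^sub>1 exp(\<theta>\<^sup>*) \<dots> P\<^sub>r exp(\<theta>\<^sup>*)|vac\<rangle>\<close> for even \<open>r\<close> and
  \<open>P\<^sub>1 exp(\<theta>\<^sup>*) \<dots> P\<^sub>r exp(\<theta>\<^sup>*) \<phi>\<^sub>0\<^sup>(\<^sup>\<beta>\<^sup>) exp(\<theta>\<^sup>*)|vac\<rangle>\<close> for odd \<open>r\<close>, where \<open>P\<^sub>j\<close> is
  \<open>dressed P\<close> at the \<open>j\<close>-th part of \<open>l\<close>.\<close>

definition ket_of ::
    "(int \<Rightarrow> ket \<Rightarrow> ket) \<Rightarrow> (fock_dual \<Rightarrow> fock \<Rightarrow> qbeta) \<Rightarrow> nat list \<Rightarrow> ket" where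
  "ket_of P B l =
    List.foldr (\<lambda>k F. dressed P k (int k) (ket_exp theta_star F)) l
      (if even (length l) then vac B else phiB 0 (ket_exp theta_star (vac B)))"

definition ket_GP :: "(fock_dual \<Rightarrow> fock \<Rightarrow> qbeta) \<Rightarrow> nat list \<Rightarrow> ket" where
  "ket_GP = ket_of PhiB"

definition ket_GQ :: "(fock_dual \<Rightarrow> fock \<Rightarrow> qbeta) \<Rightarrow> nat list \<Rightarrow> ket" where
  "ket_GQ = ket_of phiB"

text \<open>\<open>\<langle>vac| exp(H\<^sup>(\<^sup>\<beta>\<^sup>)(x)) |F\<rangle>\<close>\<close>

definition expectation :: "ket \<Rightarrow> series" where
  "expectation F = ket_exp hamiltonian F bra_vac"

end

theory Submission
  imports
    Defs
    "HOL-Computational_Algebra.Formal_Laurent_Series"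
    "HOL-Computational_Algebra.Polynomial_FPS"
    "HOL-Combinatorics.Multiset_Permutations"
begin

text \<open>
  A ket is determined by its values on the words \<open>\<langle>vac|\<phi>\<^bsub>m\<^sub>1\<^esub> \<dots> \<phi>\<^bsub>m\<^sub>k\<^esub>\<close>. On generating functions of
  such words, \<open>exp(\<theta>\<^sup>*)\<close> and \<open>exp(H)\<close> multiply each letter \<open>\<phi>(z)\<close> by a scalar series; for
  \<open>exp(H)\<close> in \<open>n\<close> variables it is \<open>\<Prod>\<^sub>k (1 + X\<^sub>k z) / (1 - X\<^sub>k z)\<close> with
  \<open>X\<^sub>k = x\<^sub>k / (1 + \<beta> x\<^sub>k / 2)\<close>. Moving all exponentials to the left leaves the vacuum expectation
  value \<open>\<Prod>\<^bsub>i<j\<^esub> (z\<^sub>i - z\<^sub>j) / (z\<^sub>i + z\<^sub>j)\<close>. Now decompose the scalar series of the first letter into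
  partial fractions: at the pole \<open>z\<^sub>1 = 1 / X\<^sub>k\<close> the factor \<open>\<Prod>\<^bsub>j>1\<^esub> (z\<^sub>1 - z\<^sub>j) / (z\<^sub>1 + z\<^sub>j)\<close> cancels the
  contribution of \<open>X\<^sub>k\<close> to the other letters. So the expectation value satisfies the recursion that
  the symmetrization satisfies when one sums over the variable in the first place. After the
  substitution \<open>x\<^sub>k \<mapsto> x\<^sub>k t\<close> the coefficients of this recursion are polynomials in \<open>t\<close>; hence so is the
  expectation value, and at \<open>t = 1\<close> it is the symmetrization.
\<close>

text \<open>Two obstacles shape the proof. Every sum needs a reason to be finite: a functional on
  words that obeys the Clifford relations and vanishes on words with a positive first letter
  vanishes on all words of positive total, which bounds the modes; and the power t makes H start in
  degree 1, which bounds its exponential. Moreover the pairing is given by axioms only. So vacuum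
  values are identified by uniqueness, on words of even length, since <vac|phi_0|vac> is left open;
  the extra factor for odd r makes the number of fermions even.

  The constants come from beta/2. A raising exponential multiplies the coefficient series of a
  letter by (1 - beta z/2) / (1 + beta z/2), whose value at X_k is 1 / (1 + beta x_k), while exp(H)
  passing it yields the scalar prod_k (1 + beta x_k). When x_k is removed, all its factors cancel,
  and each other x_j has one factor 1 + beta x_j more than the remaining letters take. This is the
  denominator of x_k \<ominus> x_j: it turns (X_k + X_j) / (X_k - X_j) into (x_k \<oplus> x_j) /
  (x_k \<ominus> x_j).\<close>

unbundle fps_syntax

section \<open>Twisting functions of words\<close>

definition sg :: "int \<Rightarrow> 'a::comm_ring_1" where
  "sg p = (if even p then 1 else - 1)"

lemma sg_add: "sg (p + q) = sg p * sg q"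
  by (auto simp: sg_def)

lemma sg_uminus [simp]: "sg (- p) = sg p"
  by (simp add: sg_def)

lemma sg_diff: "sg (p - q) = sg p * sg q"
  by (auto simp: sg_def)

lemma sg_mult_self [simp]: "sg p * sg p = 1"
  by (simp add: sg_def)

lemma sg_nat: "sg (int n) = (- 1) ^ n"
  by (simp add: sg_def)

text \<open>\<open>twist s f d W m\<close> is the sum of \<open>(\<Prod>\<^sub>i f\<^bsub>j\<^sub>i\<^esub>) W(m - s j)\<close> over all \<open>j\<close> with \<open>\<Sum>\<^sub>i j\<^sub>i = d\<close>: the
  part of shift \<open>d\<close> of multiplying the generating function by \<open>\<Prod>\<^sub>i f(z\<^sub>i\<^sup>s)\<close>.\<close>

fun twist :: "int \<Rightarrow> 'a::comm_ring_1 fps \<Rightarrow> nat \<Rightarrow> (int list \<Rightarrow> 'a) \<Rightarrow> int list \<Rightarrow> 'a" where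
  "twist s f d W [] = (if d = 0 then W [] else 0)"
| "twist s f d W (m # w) =
    (\<Sum>j\<le>d. fps_nth f j * twist s f (d - j) (\<lambda>u. W ((m - s * int j) # u)) w)"

lemma twist_add: "twist s f d (\<lambda>u. W u + W' u) w = twist s f d W w + twist s f d W' w"
  by (induction w arbitrary: d W W') (simp_all add: distrib_left sum.distrib)

lemma twist_scale: "twist s f d (\<lambda>u. c * W u) w = c * twist s f d W w"
proof (induction w arbitrary: d W)
  case (Cons m w)
  then show ?case by (simp add: sum_distrib_left mult.left_commute)
qed auto

lemma twist_zero [simp]: "twist s f d (\<lambda>u. 0) w = 0"
  using twist_scale[of s f d 0 "\<lambda>_. 0"] by simp

lemma twist_sum: "twist s f d (\<lambda>u. \<Sum>i\<in>I. F i u) w = (\<Sum>i\<in>I. twist s f d (F i) w)"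
  by (induction I rule: infinite_finite_induct) (simp_all add: twist_add)

text \<open>\<open>twist\<close> evaluates its argument only at words of the same length whose total
  is lowered by \<open>s * d\<close>. Through this, values on words of a given total are compared or
  shown to vanish.\<close>

lemma twist_cong:
  assumes "\<And>u. length u = length w \<Longrightarrow> sum_list u = sum_list w - s * int d \<Longrightarrow> W u = W' u"
  shows "twist s f d W w = twist s f d W' w"
  using assms
proof (induction w arbitrary: d W W')
  case (Cons m w)
  show ?case unfolding twist.simps
    by (intro sum.cong refl arg_cong2[where f = times] Cons.IH Cons.prems)
      (auto simp: of_nat_diff algebra_simps)
qed auto

lemma twist_eq_0:
  assumes "\<And>u. length u = length w \<Longrightarrow> sum_list u = sum_list w - s * int d \<Longrightarrow> W u = 0"
  shows "twist s f d W w = 0"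
  using twist_cong[of w s d W "\<lambda>_. 0" f] assms by simp

text \<open>Both sides run over the quadruples (j, l, a, c) of total \<open>s\<close>, grouped once
  as (j + a) + (l + c) and once as (j + l) + (a + c).\<close>

lemma sum_triangle_swap:
  fixes F :: "nat \<Rightarrow> nat \<Rightarrow> nat \<Rightarrow> nat \<Rightarrow> 'a::comm_monoid_add"
  shows "(\<Sum>u\<le>s. \<Sum>j\<le>u. \<Sum>l\<le>s - u. F j l (u - j) (s - u - l)) =
   (\<Sum>n\<le>s. \<Sum>j\<le>n. \<Sum>u\<le>s - n. F j (n - j) u (s - n - u))"
proof -
  let ?A = "SIGMA u:{..s}. SIGMA j:{..u}. {..s - u}"
  let ?B = "SIGMA n:{..s}. SIGMA j:{..n}. {..s - n}"
  have "(\<Sum>(u, j, l)\<in>?A. F j l (u - j) (s - u - l)) =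
        (\<Sum>(n, j, u)\<in>?B. F j (n - j) u (s - n - u))"
    by (rule sum.reindex_bij_witness[of _ "\<lambda>(n, j, u). (u + j, j, n - j)" "\<lambda>(u, j, l). (j + l, j, u - j)"])
      (auto simp: algebra_simps intro: arg_cong2)
  then show ?thesis by (simp add: sum.Sigma)
qed

lemma twist_twist:
  "twist s f d (twist s' g e W) (m # w) =
    (\<Sum>j\<le>d. \<Sum>l\<le>e. fps_nth f j * fps_nth g l *
       twist s f (d - j) (twist s' g (e - l) (\<lambda>u. W ((m - s * int j - s' * int l) # u))) w)"
  by (simp add: twist_sum twist_scale sum_distrib_left mult.assoc)

text \<open>Letterwise multiplications by \<open>f\<close> and by \<open>g\<close> compose to the
  one by their product; the sum distributes the total shift over the two.\<close>

lemma twist_comp: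
  "(\<Sum>u\<le>d. twist s f u (twist s g (d - u) W) w) = twist s (f * g) d W w"
proof (induction w arbitrary: d W)
  case Nil
  have "(\<Sum>u\<le>d. if u = 0 then if d - u = 0 then W [] else 0 else 0) = (if d = 0 then W [] else 0)"
    by (subst sum.delta) auto
  then show ?case by (simp cong: if_cong)
next
  case (Cons m w)
  let ?F = "\<lambda>j l a b. fps_nth f j * fps_nth g l *
       twist s f a (twist s g b (\<lambda>u. W ((m - s * int (j + l)) # u))) w"
  have "(\<Sum>u\<le>d. twist s f u (twist s g (d - u) W) (m # w)) =
      (\<Sum>u\<le>d. \<Sum>j\<le>u. \<Sum>l\<le>d - u. ?F j l (u - j) (d - u - l))"
    by (simp only: twist_twist) (simp add: algebra_simps)
  also have "\<dots> = (\<Sum>n\<le>d. \<Sum>j\<le>n. \<Sum>u\<le>d - n. ?F j (n - j) u (d - n - u))"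
    by (rule sum_triangle_swap)
  also have "\<dots> = (\<Sum>n\<le>d. \<Sum>j\<le>n. fps_nth f j * fps_nth g (n - j) *
       twist s (f * g) (d - n) (\<lambda>u. W ((m - s * int n) # u)) w)"
    by (intro sum.cong refl) (simp flip: Cons.IH add: sum_distrib_left)
  also have "\<dots> = twist s (f * g) d W (m # w)"
    by (simp add: fps_mult_nth sum_distrib_right atLeast0AtMost)
  finally show ?case .
qed

lemma twist_comm:
  "twist s f d (twist s' g e W) w = twist s' g e (twist s f d W) w"
proof (induction w arbitrary: d e W)
  case (Cons m w)
  show ?case unfolding twist_twist Cons.IH[of _ _ "\<lambda>u. W (_ # u)"]
    by (subst sum.swap) (simp add: mult_ac algebra_simps)
qed auto

lemma twist_one: "twist s 1 d W w = (if d = 0 then W w else 0)"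
proof (induction w arbitrary: d W)
  case (Cons m w)
  have "twist s 1 d W (m # w) = (\<Sum>j\<le>d. if j = 0 then if d = 0 then W (m # w) else 0 else 0)"
    unfolding twist.simps Cons.IH by (intro sum.cong) auto
  then show ?case by simp
qed auto

text \<open>The substitution z |-> c z. The condition \<open>f * fps_scale (- 1) f = 1\<close> below
  thus reads f(z) f(-z) = 1.\<close>

definition fps_scale :: "'a::comm_ring_1 \<Rightarrow> 'a fps \<Rightarrow> 'a fps" where
  "fps_scale c f = Abs_fps (\<lambda>n. c ^ n * fps_nth f n)"

lemma fps_scale_nth [simp]: "fps_nth (fps_scale c f) n = c ^ n * fps_nth f n"
  by (simp add: fps_scale_def)

lemma twist_scale_fps: "twist s (fps_scale c f) d W w = c ^ d * twist s f d W w"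
proof (induction w arbitrary: d W)
  case (Cons m w)
  have "c ^ j * f $ j * (c ^ (d - j) * x) = c ^ d * (f $ j * x)" if "j \<le> d" for j x
    using power_add[of c j "d - j"] that by (simp add: algebra_simps)
  with Cons show ?case by (simp add: sum_distrib_left)
qed auto

lemma twist_scale_fps': "twist s (fps_scale c f) d W = (\<lambda>w. c ^ d * twist s f d W w)"
  by (rule ext) (rule twist_scale_fps)

lemma twist_snoc:
  "twist s f d W (u @ [m]) = (\<Sum>j\<le>d. fps_nth f j * twist s f (d - j) (\<lambda>v. W (v @ [m - s * int j])) u)"
proof (induction u arbitrary: d W)
  case Nil
  have "(\<Sum>j\<le>d. f $ j * (if d - j = 0 then W [m - s * int j] else 0)) =
     (\<Sum>j\<le>d. if j = d then f $ j * W [m - s * int j] else 0)"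
    by (intro sum.cong) auto
  also have "\<dots> = f $ d * W [m - s * int d]" by simp
  finally show ?case by (simp only: append_Nil twist.simps)
next
  case (Cons k u)
  have "twist s f d W ((k # u) @ [m]) =
     (\<Sum>i\<le>d. f $ i * (\<Sum>j\<le>d - i. f $ j * twist s f (d - i - j) (\<lambda>v. W ((k - s * int i) # v @ [m - s * int j])) u))"
    by (simp add: Cons.IH)
  also have "\<dots> = (\<Sum>i\<le>d. \<Sum>j\<le>d - i. f $ i * f $ j * twist s f (d - i - j) (\<lambda>v. W ((k - s * int i) # v @ [m - s * int j])) u)"
    by (simp add: sum_distrib_left mult.assoc)
  also have "\<dots> = (\<Sum>j\<le>d. \<Sum>i\<le>d - j. f $ i * f $ j * twist s f (d - i - j) (\<lambda>v. W ((k - s * int i) # v @ [m - s * int j])) u)"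
    unfolding sum.Sigma[OF finite_atMost ballI[OF finite_atMost]]
    by (rule sum.reindex_bij_witness[of _ "\<lambda>(i, j). (j, i)" "\<lambda>(i, j). (j, i)"]) auto
  also have "\<dots> = (\<Sum>j\<le>d. f $ j * twist s f (d - j) (\<lambda>v. W (v @ [m - s * int j])) (k # u))"
    by (simp add: sum_distrib_left mult_ac add.commute)
  finally show ?case .
qed

section \<open>The Clifford relation for functions of words\<close>

definition clifford_at :: "nat \<Rightarrow> (int list \<Rightarrow> 'a::comm_ring_1) \<Rightarrow> bool" where
  "clifford_at n W \<longleftrightarrow> (\<forall>a p q b. length a = n \<longrightarrow> W (a @ p # q # b) + W (a @ q # p # b) =
     (if p + q = 0 then 2 * sg p * W (a @ b) else 0))"

definition clifford :: "(int list \<Rightarrow> 'a::comm_ring_1) \<Rightarrow> bool" where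
  "clifford W \<longleftrightarrow> (\<forall>n. clifford_at n W)"

lemma cliffordD:
  "clifford W \<Longrightarrow> W (a @ p # q # b) + W (a @ q # p # b) = (if p + q = 0 then 2 * sg p * W (a @ b) else 0)"
  by (simp add: clifford_def clifford_at_def)

lemma cliffordI:
  assumes "\<And>a p q b. W (a @ p # q # b) + W (a @ q # p # b) = (if p + q = 0 then 2 * sg p * W (a @ b) else 0)"
  shows "clifford W"
  using assms by (simp add: clifford_def clifford_at_def)

lemma clifford_append: "clifford W \<Longrightarrow> clifford (\<lambda>u. W (u @ v))"
  by (rule cliffordI) (simp add: cliffordD)

lemma sum_diagonal:
  fixes F :: "nat \<Rightarrow> nat \<Rightarrow> 'a::comm_monoid_add"
  shows "(\<Sum>j\<le>d. \<Sum>l\<le>d - j. if j + l = s then F j l else 0) =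
   (if s \<le> d then \<Sum>j\<le>s. F j (s - j) else 0)"
proof -
  have "(\<Sum>j\<le>d. \<Sum>l\<le>d - j. if j + l = s then F j l else 0) =
        (\<Sum>j\<le>d. if j \<le> s \<and> s \<le> d then F j (s - j) else 0)"
  proof (intro sum.cong refl)
    fix j assume "j \<in> {..d}"
    have "(\<Sum>l\<le>d - j. if j + l = s then F j l else 0) = (\<Sum>l\<le>d - j. if l = s - j \<and> j \<le> s then F j (s - j) else 0)"
      by (intro sum.cong) auto
    also have "\<dots> = (if j \<le> s \<and> s \<le> d then F j (s - j) else 0)"
      using \<open>j \<in> {..d}\<close> by (cases "j \<le> s") auto
    finally show "(\<Sum>l\<le>d - j. if j + l = s then F j l else 0) = (if j \<le> s \<and> s \<le> d then F j (s - j) else 0)" .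
  qed
  also have "\<dots> = (if s \<le> d then \<Sum>j\<le>s. F j (s - j) else 0)"
  proof (cases "s \<le> d")
    case True
    have "(\<Sum>j\<le>s. F j (s - j)) = (\<Sum>j\<le>d. if j \<le> s then F j (s - j) else 0)"
      by (rule sum.mono_neutral_cong_left) (use True in auto)
    with True show ?thesis by simp
  qed simp
  finally show ?thesis .
qed

text \<open>The anticommutator of phi(z) and phi(w) is a delta function at w = -z, where the factors
  of the two letters multiply to f(z^s) f(-z^s) = 1. So letterwise multiplication by such a series
  respects the relation.\<close>

lemma twist_clifford_at:
  assumes W: "clifford_at n W" and f: "f * fps_scale (- 1) f = 1" and s: "s = 1 \<or> s = - 1"
  shows "clifford_at n (twist s f d W)"
  unfolding clifford_at_def
proof (intro allI impI)
  fix a :: "int list" and p q b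
  assume "length a = n"
  with W show "twist s f d W (a @ p # q # b) + twist s f d W (a @ q # p # b) =
     (if p + q = 0 then 2 * sg p * twist s f d W (a @ b) else 0)"
  proof (induction a arbitrary: n d W)
    case (Cons m a)
    then obtain n' where n: "n = Suc n'" by (cases n) auto
    have "clifford_at n' (\<lambda>u. W (k # u))" for k
      using Cons.prems(1) unfolding n clifford_at_def
      by (metis append_Cons length_Cons)
    note IH = Cons.IH[OF this]
    have "length a = n'" using Cons.prems(2) n by simp
    then show ?case using IH
      by (cases "p + q = 0") (simp_all flip: sum.distrib distrib_left add: sum_distrib_left mult_ac)
  next
    case (Nil n d W)
    have s2: "s * s = 1" using s by auto
    let ?t = "\<lambda>p q j l. fps_nth f j * fps_nth f l *
       twist s f (d - j - l) (\<lambda>u. W ((p - s * int j) # (q - s * int l) # u)) b"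
    have ex: "twist s f d W (p # q # b) = (\<Sum>j\<le>d. \<Sum>l\<le>d - j. ?t p q j l)" for p q
      by (simp add: sum_distrib_left mult.assoc)
    have swap: "(\<Sum>j\<le>d. \<Sum>l\<le>d - j. ?t q p j l) = (\<Sum>j\<le>d. \<Sum>l\<le>d - j. ?t q p l j)"
      unfolding sum.Sigma[OF finite_atMost ballI[OF finite_atMost]]
      by (rule sum.reindex_bij_witness[of _ "\<lambda>(i, j). (j, i)" "\<lambda>(i, j). (j, i)"]) auto
    \<comment> \<open>The shifted letters contract only if the two shifts add up to
      \<open>s * (p + q)\<close>; on this diagonal the coefficients of f(z) f(-z) appear.\<close>
    have cond: "p - s * int j + (q - s * int l) = 0 \<longleftrightarrow> int (j + l) = s * (p + q)" for j l
      using s by auto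
    let ?n = "nat (s * (p + q))"
    have "twist s f d W (p # q # b) + twist s f d W (q # p # b) =
       (\<Sum>j\<le>d. \<Sum>l\<le>d - j. ?t p q j l + ?t q p l j)"
      unfolding ex swap by (simp add: sum.distrib)
    also have "\<dots> = (\<Sum>j\<le>d. \<Sum>l\<le>d - j. if int (j + l) = s * (p + q) then
        2 * sg p * ((- 1) ^ j * fps_nth f j * fps_nth f l) * twist s f (d - j - l) W b else 0)"
    proof (intro sum.cong refl)
      fix j l
      have *: "twist s f (d - j - l) (\<lambda>u. W ((p - s * int j) # (q - s * int l) # u)) b
        + twist s f (d - j - l) (\<lambda>u. W ((q - s * int l) # (p - s * int j) # u)) b
        = (if int (j + l) = s * (p + q) then 2 * sg p * (- 1) ^ j * twist s f (d - j - l) W b else 0)"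
        unfolding twist_add[symmetric]
        using Nil s unfolding clifford_at_def
        by (auto simp: cond twist_scale sg_diff sg_nat)
      have "?t p q j l + ?t q p l j = f $ j * f $ l * (twist s f (d - j - l) (\<lambda>u. W ((p - s * int j) # (q - s * int l) # u)) b
        + twist s f (d - j - l) (\<lambda>u. W ((q - s * int l) # (p - s * int j) # u)) b)"
        by (simp add: algebra_simps diff_commute)
      also have "\<dots> = (if int (j + l) = s * (p + q) then
        2 * sg p * ((- 1) ^ j * fps_nth f j * fps_nth f l) * twist s f (d - j - l) W b else 0)"
        unfolding * by simp
      finally show "?t p q j l + ?t q p l j = (if int (j + l) = s * (p + q) then
        2 * sg p * ((- 1) ^ j * fps_nth f j * fps_nth f l) * twist s f (d - j - l) W b else 0)" .
    qed
    also have "\<dots> = (if p + q = 0 then 2 * sg p * twist s f d W b else 0)"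
    proof (cases "s * (p + q) \<ge> 0")
      case True
      then have c: "int (j + l) = s * (p + q) \<longleftrightarrow> j + l = ?n" for j l by auto
      have z: "?n = 0 \<longleftrightarrow> p + q = 0" using True s by auto
      \<comment> \<open>The coefficients of f(-z) f(z) = 1. Only the diagonal 0 survives, which is
        the case p + q = 0.\<close>
      have d: "(\<Sum>j\<le>n. (- 1) ^ j * fps_nth f j * fps_nth f (n - j)) = (if n = 0 then 1 else 0)" for n
      proof -
        have "fps_nth (fps_scale (- 1) f * f) n = (if n = 0 then 1 else 0)"
          using f by (simp add: mult.commute)
        then show ?thesis by (simp add: fps_mult_nth atLeast0AtMost)
      qed
      show ?thesis unfolding c sum_diagonal
        using d[of ?n] by (auto simp: z[symmetric] sum_distrib_left[symmetric] sum_distrib_right[symmetric] mult.assoc[symmetric]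
           cong: if_cong intro!: sum.cong)
          (simp_all add: mult.assoc sum_distrib_left[symmetric] sum_distrib_right[symmetric])
    next
      case False
      then show ?thesis by auto
    qed
    finally show ?case by simp
  qed
qed

lemma twist_clifford:
  "clifford W \<Longrightarrow> f * fps_scale (- 1) f = 1 \<Longrightarrow> s = 1 \<or> s = - 1 \<Longrightarrow> clifford (twist s f d W)"
  unfolding clifford_def by (blast intro: twist_clifford_at)


section \<open>Generating series of Schur Q-functions in one variable\<close>

text \<open>The power series \<open>(1 + X z) / (1 - X z)\<close>.\<close>

definition qgen :: "'a::comm_ring_1 \<Rightarrow> 'a fps" where
  "qgen X = Abs_fps (\<lambda>n. if n = 0 then 1 else 2 * X ^ n)"

lemma qgen_nth: "qgen X $ n = (if n = 0 then 1 else 2 * X ^ n)"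
  by (simp add: qgen_def)

lemma qgen_0 [simp]: "qgen X $ 0 = 1"
  by (simp add: qgen_nth)

lemma qgen_mult: "(1 - fps_const X * fps_X) * qgen X = 1 + fps_const X * fps_X"
proof (rule fps_ext)
  fix n
  show "((1 - fps_const X * fps_X) * qgen X) $ n = (1 + fps_const X * fps_X) $ n"
    by (cases n) (auto simp: left_diff_distrib qgen_nth mult.assoc)
qed

lemma fps_scale_qgen: "fps_scale c (qgen X) = qgen (c * X)"
  by (rule fps_ext) (simp add: qgen_nth power_mult_distrib)

text \<open>The constant term of 1 - X z is 1, so it can be cancelled even when the coefficient ring
  has zero divisors.\<close>

lemma one_minus_cancel:
  fixes X :: "'a::comm_ring_1"
  assumes "(1 - fps_const X * fps_X) * f = (1 - fps_const X * fps_X) * g"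
  shows "f = g"
proof (rule fps_ext)
  fix n
  show "f $ n = g $ n"
  proof (induction n)
    case 0
    show ?case using arg_cong[OF assms, of "\<lambda>h. h $ 0"] by simp
  next
    case (Suc n)
    then show ?case using arg_cong[OF assms, of "\<lambda>h. h $ Suc n"]
      by (simp add: left_diff_distrib mult.assoc)
  qed
qed

lemma qgen_uminus: "qgen X * qgen (- X) = (1 :: 'a::comm_ring_1 fps)"
proof -
  have "(1 - fps_const (- X) * fps_X) * (qgen X * qgen (- X)) = qgen X * (1 + fps_const (- X) * fps_X)"
    using qgen_mult[of "- X"] by (metis mult.left_commute)
  also have "\<dots> = (1 - fps_const X * fps_X) * qgen X"
    by (simp add: algebra_simps flip: fps_const_neg)
  also have "\<dots> = (1 - fps_const (- X) * fps_X) * 1"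
    unfolding qgen_mult by (simp flip: fps_const_neg)
  finally show ?thesis by (rule one_minus_cancel)
qed

lemma qgen_uminus': "qgen X * fps_scale (- 1) (qgen X) = 1"
  by (simp add: fps_scale_qgen qgen_uminus)

section \<open>Vacuum expectation values of words\<close>

text \<open>The vacuum expectation value of a word: the coefficient of \<open>z\<^sub>1\<^bsup>m\<^sub>1\<^esup> \<dots> z\<^sub>r\<^bsup>m\<^sub>r\<^esup>\<close> in
  \<open>\<Prod>\<^bsub>i<j\<^esub> (z\<^sub>i - z\<^sub>j) / (z\<^sub>i + z\<^sub>j)\<close>, expanded for \<open>|z\<^sub>1| > |z\<^sub>2| > \<dots>\<close>.\<close>

primrec vev_len :: "nat \<Rightarrow> int list \<Rightarrow> 'a::comm_ring_1" where
  "vev_len 0 w = 1"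
| "vev_len (Suc n) w = (if sum_list w = 0 \<and> hd w \<le> 0
     then twist 1 (qgen (- 1)) (nat (- hd w)) (vev_len n) (tl w) else 0)"

definition vev :: "int list \<Rightarrow> 'a::comm_ring_1" where
  "vev w = vev_len (length w) w"

lemma vev_Nil [simp]: "vev [] = 1"
  by (simp add: vev_def)

text \<open>Each factor (z_1 - z_j) / (z_1 + z_j) is \<open>qgen (- 1)\<close> at z_j / z_1, so the
  exponent of z_1 is minus the total shift of the other letters. The words evaluated are not
  sublists, which is why \<open>vev_len\<close> recurses on the length; \<open>twist\<close> keeps
  the length, which brings back \<open>vev\<close>.\<close>

lemma vev_Cons:
  "vev (m # w) = (if m + sum_list w = 0 \<and> m \<le> 0 then twist 1 (qgen (- 1)) (nat (- m)) vev w else (0 :: 'a::comm_ring_1))"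
proof -
  have "twist 1 (qgen (- 1)) d (vev_len (length w)) w = (twist 1 (qgen (- 1)) d vev w :: 'a)" for d
    by (rule twist_cong) (simp add: vev_def)
  then show ?thesis by (simp add: vev_def del: twist.simps cong: if_cong)
qed

lemma vev_sum_nonzero: "sum_list w \<noteq> 0 \<Longrightarrow> vev w = 0"
  by (cases w) (auto simp: vev_Cons)

lemma vev_pos: "m > 0 \<Longrightarrow> vev (m # w) = 0"
  by (simp add: vev_Cons)

text \<open>In the chosen expansion the last variable has only nonnegative exponents; expanding the
  first letter can only lower the last one further.\<close>

lemma vev_snoc_neg: "m < 0 \<Longrightarrow> vev (w @ [m]) = (0 :: 'a::comm_ring_1)"
proof (induction "length w" arbitrary: w m)
  case 0
  then show ?case by (simp add: vev_Cons)
next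
  case (Suc n)
  then obtain k v where w: "w = k # v" "length v = n" by (cases w) auto
  have "twist 1 (qgen (- 1)) d vev (v @ [m]) = (0 :: 'a)" for d
    unfolding twist_snoc
  proof (intro sum.neutral ballI)
    fix j
    have "twist 1 (qgen (- 1)) (d - j) (\<lambda>u. vev (u @ [m - 1 * int j])) v = (0 :: 'a)"
      by (rule twist_eq_0) (rule Suc.hyps(1), use w Suc.prems in auto)
    then show "qgen (- 1) $ j * twist 1 (qgen (- 1)) (d - j) (\<lambda>u. vev (u @ [m - 1 * int j])) v = (0 :: 'a)"
      by simp
  qed
  then show ?case by (simp add: w vev_Cons)
qed

text \<open>Moving \<open>\<phi>\<^sub>p\<close> past \<open>\<phi>\<^sub>q\<close> adds the two expansions of \<open>(z - w) / (z + w)\<close> for \<open>|z| > |w|\<close> and for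
  \<open>|w| > |z|\<close>; their sum is a formal delta function, at which the remaining factors cancel.\<close>

lemma vev_swap:
  "vev (p # q # b) + vev (q # p # b) = (if p + q = 0 then 2 * sg p * vev b else (0 :: 'a::comm_ring_1))"
proof (cases "p + q + sum_list b = 0")
  case False
  then show ?thesis by (auto simp: vev_sum_nonzero)
next
  case True
  define s where "s = sum_list b"
  \<comment> \<open>\<open>u\<close> and \<open>v\<close> are the total shifts of \<open>b\<close>
    caused by the first and by the second letter in front of it.\<close>
  define C :: "nat \<Rightarrow> nat \<Rightarrow> 'a" where
    "C u v = twist 1 (qgen (- 1)) u (twist 1 (qgen (- 1)) v vev) b" for u v
  have C_sym: "C u v = C v u" for u v
    unfolding C_def by (rule twist_comm)
  \<comment> \<open>The coefficients of (1 - z) / (1 + z), extended by zero. Together with the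
    reflected expansion they give 2 (-1)^j for all integers j, a delta function.\<close>
  define Q :: "int \<Rightarrow> 'a" where "Q j = (if j < 0 then 0 else qgen (- 1) $ nat j)" for j
  have Q: "Q j + Q (- j) = 2 * sg j" for j
  proof (cases "j = 0")
    case False
    have "(- 1 :: 'a) ^ nat \<bar>j\<bar> = sg j" using sg_nat[of "nat \<bar>j\<bar>", where ?'a = 'a] by (auto simp: sg_def)
    then show ?thesis using False by (auto simp: Q_def qgen_nth abs_if split: if_splits)
  qed (simp add: Q_def sg_def)
  \<comment> \<open>If \<open>q\<close> shifts the rest by v, it must have been lowered to -v, so
    the factor that it shares with \<open>p\<close> contributes its coefficient at v + q.\<close>
  have vev2: "vev (p # q # b) = (\<Sum>v\<le>nat s. Q (int v + q) * C (nat s - v) v)"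
    if "s \<ge> 0" "p + q + s = 0" for p q
  proof (cases "p \<le> 0")
    case False
    have "Q (int v + q) = 0" if "v \<le> nat s" for v
      using that False \<open>p + q + s = 0\<close> \<open>s \<ge> 0\<close> by (auto simp: Q_def)
    then show ?thesis using False by (simp add: vev_Cons)
  next
    case True
    have "vev (p # q # b) = twist 1 (qgen (- 1)) (nat (- p)) vev (q # b)"
      using that True by (simp add: vev_Cons s_def)
    also have "\<dots> = (\<Sum>j\<le>nat (- p). qgen (- 1) $ j *
        (if int j \<ge> q then C (nat (- p) - j) (nat (int j - q)) else 0))"
      unfolding twist.simps
    proof (intro sum.cong refl arg_cong2[where f = times])
      fix j assume j: "j \<in> {..nat (- p)}"
      show "twist 1 (qgen (- 1)) (nat (- p) - j) (\<lambda>u. vev ((q - 1 * int j) # u)) b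
        = (if int j \<ge> q then C (nat (- p) - j) (nat (int j - q)) else 0)"
      proof (cases "int j \<ge> q")
        case True
        have "twist 1 (qgen (- 1)) (nat (- p) - j) (\<lambda>u. vev ((q - 1 * int j) # u)) b = C (nat (- p) - j) (nat (int j - q))"
          unfolding C_def
        proof (rule twist_cong)
          fix u :: "int list" assume "sum_list u = sum_list b - 1 * int (nat (- p) - j)"
          then have "q - int j + sum_list u = 0"
            using j \<open>p \<le> 0\<close> \<open>p + q + s = 0\<close> by (auto simp: s_def of_nat_diff)
          with True show "vev ((q - 1 * int j) # u) = twist 1 (qgen (- 1)) (nat (int j - q)) vev u"
            by (simp add: vev_Cons)
        qed
        with True show ?thesis by simp
      qed (auto intro!: twist_eq_0 simp: vev_pos)
    qed
    also have "\<dots> = (\<Sum>j\<in>{j. j \<le> nat (- p) \<and> int j \<ge> q}. qgen (- 1) $ j * C (nat (- p) - j) (nat (int j - q)))"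
      by (rule sum.mono_neutral_cong_right) auto
    also have "\<dots> = (\<Sum>v\<in>{v. v \<le> nat s \<and> int v + q \<ge> 0}. Q (int v + q) * C (nat s - v) v)"
    proof (rule sum.reindex_bij_witness[of _ "\<lambda>v. nat (int v + q)" "\<lambda>j. nat (int j - q)"])
      fix j assume "j \<in> {j. j \<le> nat (- p) \<and> int j \<ge> q}"
      then have "nat s - nat (int j - q) = nat (- p) - j" "int (nat (int j - q)) + q = int j"
        using that True by auto
      then show "Q (int (nat (int j - q)) + q) * C (nat s - nat (int j - q)) (nat (int j - q)) =
          qgen (- 1) $ j * C (nat (- p) - j) (nat (int j - q))"
        by (simp add: Q_def)
    qed (use that True in auto)
    also have "\<dots> = (\<Sum>v\<le>nat s. Q (int v + q) * C (nat s - v) v)"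
      by (rule sum.mono_neutral_left) (auto simp: Q_def)
    finally show ?thesis .
  qed
  show ?thesis
  proof (cases "s \<ge> 0")
    case False
    have "vev (p # q # b) = (0 :: 'a)" if "p + q + s = 0" for p q
      unfolding vev_Cons[of p]
      by (cases "p \<le> 0") (use that False in \<open>auto simp: vev_pos intro!: sum.neutral twist_eq_0\<close>)
    then show ?thesis using False True by (auto simp: s_def)
  next
    case s: True
    have pq: "p + q + s = 0" using True by (simp add: s_def)
    have "vev (q # p # b) = (\<Sum>v\<le>nat s. Q (int v + p) * C (nat s - v) v)"
      using vev2[of q p] s pq by (simp add: add.commute)
    also have "\<dots> = (\<Sum>v\<le>nat s. Q (- (int v + q)) * C (nat s - v) v)"
    proof (rule sum.reindex_bij_witness[of _ "\<lambda>v. nat s - v" "\<lambda>v. nat s - v"])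
      fix v assume v: "v \<in> {..nat s}"
      then have "- (int (nat s - v) + q) = int v + p" using s pq by auto
      moreover have "nat s - (nat s - v) = v" using v by simp
      ultimately show "Q (- (int (nat s - v) + q)) * C (nat s - (nat s - v)) (nat s - v) = Q (int v + p) * C (nat s - v) v"
        by (metis C_sym)
    qed auto
    finally have "vev (p # q # b) + vev (q # p # b) =
        (\<Sum>v\<le>nat s. (Q (int v + q) + Q (- (int v + q))) * C (nat s - v) v)"
      using vev2[OF s pq] by (simp add: distrib_right sum.distrib)
    \<comment> \<open>The sign (-1)^v turns one of the two twists into its inverse, the twist by
      \<open>qgen (- 1)\<close> at -z, so they cancel and leave only the shift 0.\<close>
    also have "\<dots> = (\<Sum>v\<le>nat s. 2 * sg q * ((- 1) ^ v * C (nat s - v) v))"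
      unfolding Q by (simp add: sg_add sg_nat mult_ac)
    also have "\<dots> = 2 * sg q * (\<Sum>v\<le>nat s. twist 1 (qgen (- 1)) (nat s - v) (twist 1 (fps_scale (- 1) (qgen (- 1))) v vev) b)"
      unfolding C_def by (simp only: twist_scale_fps' twist_scale sum_distrib_left)
    also have "(\<Sum>v\<le>nat s. twist 1 (qgen (- 1)) (nat s - v) (twist 1 (fps_scale (- 1) (qgen (- 1))) v vev) b)
        = (\<Sum>u\<le>nat s. twist 1 (qgen (- 1)) u (twist 1 (fps_scale (- 1) (qgen (- 1))) (nat s - u) vev) b)"
      by (rule sum.reindex_bij_witness[of _ "\<lambda>v. nat s - v" "\<lambda>v. nat s - v"]) auto
    also have "\<dots> = (if s = 0 then vev b else (0 :: 'a))"
      unfolding twist_comp qgen_uminus' twist_one using s by auto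
    finally have *: "vev (p # q # b) + vev (q # p # b) = 2 * sg q * (if s = 0 then vev b else (0 :: 'a))" .
    show ?thesis
    proof (cases "s = 0")
      case True
      then have "q = - p" using pq by simp
      then show ?thesis using * True by simp
    next
      case False
      then show ?thesis using * pq by simp
    qed
  qed
qed

text \<open>Here the localization of the relation at a position pays off: behind the first letter it
  is the relation one position earlier, for a twisted \<open>vev\<close>.\<close>

lemma vev_clifford: "clifford (vev :: int list \<Rightarrow> 'a::comm_ring_1)"
  unfolding clifford_def
proof
  fix n
  show "clifford_at n (vev :: int list \<Rightarrow> 'a)"
  proof (induction n)
    case 0
    show ?case by (simp add: clifford_at_def vev_swap)
  next
    case (Suc n)
    show ?case unfolding clifford_at_def
    proof (intro allI impI)
      fix a :: "int list" and p q b
      assume "length a = Suc n"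
      then obtain m a' where a: "a = m # a'" "length a' = n" by (cases a) auto
      have "twist 1 (qgen (- 1)) d vev (a' @ p # q # b) + twist 1 (qgen (- 1)) d vev (a' @ q # p # b) =
        (if p + q = 0 then 2 * sg p * twist 1 (qgen (- 1)) d vev (a' @ b) else (0 :: 'a))" for d
        using twist_clifford_at[OF Suc.IH qgen_uminus'] a(2) by (simp add: clifford_at_def)
      then show "vev (a @ p # q # b) + vev (a @ q # p # b) =
        (if p + q = 0 then 2 * sg p * vev (a @ b) else (0 :: 'a))"
        by (auto simp: a vev_Cons add_ac)
    qed
  qed
qed

section \<open>Bosons on Clifford functionals\<close>

text \<open>What remains of evaluation at <vac| followed by a word: the Clifford relation, and
  <vac|phi_m = 0 for m > 0.\<close>

definition bra_like :: "(int list \<Rightarrow> 'a::comm_ring_1) \<Rightarrow> bool" where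
  "bra_like W \<longleftrightarrow> clifford W \<and> (\<forall>m w. m > 0 \<longrightarrow> W (m # w) = 0)"

lemma bra_like_clifford: "bra_like W \<Longrightarrow> clifford W"
  by (simp add: bra_like_def)

lemma bra_like_append: "bra_like W \<Longrightarrow> bra_like (\<lambda>u. W (u @ v))"
  by (simp add: bra_like_def clifford_append)

lemma clifford_sum:
  "(\<And>i. i \<in> I \<Longrightarrow> clifford (F i)) \<Longrightarrow> clifford (\<lambda>u. \<Sum>i\<in>I. c i * F i u)"
  by (rule cliffordI)
    (simp flip: sum.distrib distrib_left add: cliffordD sum_distrib_left mult_ac)

lemma bra_like_sum:
  "(\<And>i. i \<in> I \<Longrightarrow> bra_like (F i)) \<Longrightarrow> bra_like (\<lambda>u. \<Sum>i\<in>I. c i * F i u)"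
  by (auto simp: bra_like_def intro!: clifford_sum)

lemma bra_like_scale: "bra_like F \<Longrightarrow> bra_like (\<lambda>u. c * F u)"
  using bra_like_sum[of "{0::nat}" "\<lambda>_. F" "\<lambda>_. c"] by simp

text \<open>Cut-offs may depend on the total of the word, because exchanging letters and contracting
  letters with p + q = 0 both keep it.\<close>

lemma bra_like_sum_cong:
  assumes "\<And>u w. sum_list u = sum_list w \<Longrightarrow> I u = I w" and "\<And>i. bra_like (F i)"
  shows "bra_like (\<lambda>u. \<Sum>i\<in>I u. c i * F i u)"
  unfolding bra_like_def
proof (intro conjI allI impI cliffordI)
  fix a b :: "int list" and p q :: int
  have I: "I (a @ q # p # b) = I (a @ p # q # b)" "p + q = 0 \<Longrightarrow> I (a @ b) = I (a @ p # q # b)"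
    by (rule assms(1); simp)+
  have "clifford (F i)" for i using assms(2) bra_like_clifford by blast
  from cliffordD[OF this]
  show "(\<Sum>i\<in>I (a @ p # q # b). c i * F i (a @ p # q # b)) + (\<Sum>i\<in>I (a @ q # p # b). c i * F i (a @ q # p # b))
    = (if p + q = 0 then 2 * sg p * (\<Sum>i\<in>I (a @ b). c i * F i (a @ b)) else 0)"
    by (auto simp: I simp flip: sum.distrib distrib_left) (simp add: sum_distrib_left mult_ac)
next
  fix m :: int and w
  assume "m > 0"
  with assms(2) show "(\<Sum>i\<in>I (m # w). c i * F i (m # w)) = 0" by (simp add: bra_like_def)
qed

text \<open>A word of positive total has a positive letter. Moving it to the front leaves only
  contraction terms, which are shorter words of the same total.\<close>

lemma bra_like_pos:
  assumes W: "bra_like W" and "sum_list w > 0"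
  shows "W w = 0"
  using assms(2)
proof (induction "length w" arbitrary: w rule: less_induct)
  case less
  have shift: "W (a @ p # b) = 0" if "p > 0" "w = a @ p # b" for a p b
  proof -
    have "W (c @ p # d) = 0" if "length (c @ d) = length (a @ b)" "sum_list (c @ d) = sum_list (a @ b)" for c d
      using that
    proof (induction c arbitrary: d rule: rev_induct)
      case Nil
      then show ?case using W \<open>p > 0\<close> by (simp add: bra_like_def)
    next
      case (snoc x c)
      have "W ((c @ [x]) @ p # d) = - W (c @ p # x # d) + (if x + p = 0 then 2 * sg x * W (c @ d) else 0)"
        using cliffordD[OF bra_like_clifford[OF W], of c x p d] by (simp add: algebra_simps)
      moreover have "W (c @ p # x # d) = 0"
        using snoc.prems by (intro snoc.IH) auto
      moreover have "W (c @ d) = 0" if "x + p = 0"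
        using snoc.prems less.prems that \<open>w = a @ p # b\<close> by (intro less.hyps) auto
      ultimately show ?case by simp
    qed
    then show ?thesis by simp
  qed
  have "\<exists>p\<in>set w. p > 0"
  proof (rule ccontr)
    assume "\<not> ?thesis"
    then have "sum_list w \<le> 0" by (intro sum_list_nonpos) auto
    with less.prems show False by simp
  qed
  then obtain a p b where "w = a @ p # b" "p > 0" by (metis split_list)
  with shift show ?case by simp
qed

lemma bra_like_prefix: "bra_like W \<Longrightarrow> sum_list u > 0 \<Longrightarrow> W (u @ v) = 0"
  using bra_like_pos[OF bra_like_append] .

text \<open>\<open>Bos n\<close> is \<open>4 b\<^sub>n\<close> on functionals that vanish for the bra words killed by \<open>right_act\<close>; the
  summation range contains all nonzero terms if \<open>n\<close> is odd.\<close>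

definition Bos :: "int \<Rightarrow> (int list \<Rightarrow> 'a::comm_ring_1) \<Rightarrow> int list \<Rightarrow> 'a" where
  "Bos n W u = (\<Sum>i\<in>{sum_list u - n..- sum_list u}. sg i * W (u @ [- i - n, i]))"

text \<open>For small \<open>i\<close> the letter -i-n makes the prefix positive. For large
  \<open>i\<close> the letters are exchanged first, without a contraction term since their sum -n is
  not zero.\<close>

lemma Bos_range:
  assumes "bra_like W" "odd n" "i \<notin> {sum_list u - n..- sum_list u}"
  shows "W (u @ [- i - n, i]) = 0"
proof (cases "i < sum_list u - n")
  case True
  then show ?thesis using bra_like_prefix[OF assms(1), of "u @ [- i - n]" "[i]"] by simp
next
  case False
  then have "i > - sum_list u" using assms(3) by simp
  then have "W (u @ [i, - i - n]) = 0" using bra_like_prefix[OF assms(1), of "u @ [i]" "[- i - n]"] by simp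
  moreover have "- i - n + i \<noteq> 0" using assms(2) by auto
  ultimately show ?thesis
    using cliffordD[OF bra_like_clifford[OF assms(1)], of u "- i - n" i "[]"] by simp
qed

lemma Bos_superset:
  assumes "bra_like W" "odd n" "finite J" "{sum_list u - n..- sum_list u} \<subseteq> J"
  shows "Bos n W u = (\<Sum>i\<in>J. sg i * W (u @ [- i - n, i]))"
  unfolding Bos_def using assms Bos_range[OF assms(1,2)] by (intro sum.mono_neutral_left) auto

lemma Bos_bra_like:
  assumes "bra_like W" shows "bra_like (Bos n W)"
  unfolding Bos_def
  using bra_like_append[OF assms] by (intro bra_like_sum_cong) auto

lemma Bos_sum: "Bos n (\<lambda>u. \<Sum>i\<in>I. c i * F i u) u = (\<Sum>i\<in>I. c i * Bos n (F i) u)"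
  by (simp add: Bos_def sum_distrib_left sum.swap[of _ I] mult_ac)

lemma Bos_add: "Bos n (\<lambda>u. F u + G u) u = Bos n F u + Bos n G u"
  by (simp add: Bos_def distrib_left sum.distrib)

lemma Bos_scale: "Bos n (\<lambda>u. c * F u) u = c * Bos n F u"
  by (simp add: Bos_def sum_distrib_left mult_ac)

lemma Bos_cong:
  assumes "\<And>v. sum_list v = sum_list u - n \<Longrightarrow> W v = W' v"
  shows "Bos n W u = Bos n W' u"
  unfolding Bos_def by (intro sum.cong refl arg_cong2[where f = times] assms) simp

text \<open>The commutator [b_n, phi_m] = phi_(m-n). Two summands contract with phi_m, those with i
  = m - n and i = -m; they are distinct as n is odd, and each contributes 2.\<close>

lemma Bos_phi:
  assumes W: "bra_like W" and n: "odd n"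
  shows "Bos n (\<lambda>v. W (v @ [m])) u = Bos n W (u @ [m]) + 4 * W (u @ [m - n])"
proof -
  \<comment> \<open>Large enough for one index range that contains both supports and both
    contraction indices.\<close>
  define N where "N = \<bar>sum_list u\<bar> + \<bar>m\<bar> + \<bar>n\<bar> + 1"
  define J where "J = {- N - N..N + N}"
  have J: "finite J" "{sum_list u - n..- sum_list u} \<subseteq> J"
    "{sum_list (u @ [m]) - n..- sum_list (u @ [m])} \<subseteq> J" "m - n \<in> J" "- m \<in> J"
    by (auto simp: J_def N_def)
  have sg: "sg (m - n) * sg m = (- 1 :: 'a)" "sg (- m) * sg m = (1 :: 'a)"
    using n by (auto simp: sg_def)
  have "m * 2 \<noteq> n" using n by auto
  note C = cliffordD[OF bra_like_clifford[OF W]]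
  have "sg i * W (u @ [- i - n, i, m]) = sg i * W (u @ [m, - i - n, i])
      + (if i = m - n then 2 * W (u @ [m - n]) else 0) + (if i = - m then 2 * W (u @ [m - n]) else 0)" for i
  proof -
    have "W (u @ [- i - n, i, m]) = - W (u @ [- i - n, m, i]) + (if i = - m then 2 * sg m * W (u @ [m - n]) else 0)"
      using C[of "u @ [- i - n]" i m "[]"] by (auto simp: add_eq_0_iff2 algebra_simps split: if_splits)
    moreover have "W (u @ [- i - n, m, i]) = - W (u @ [m, - i - n, i]) + (if i = m - n then 2 * sg m * W (u @ [m - n]) else 0)"
      using C[of u m "- i - n" "[i]"] by (auto simp: algebra_simps split: if_splits)
    ultimately have E: "W (u @ [- i - n, i, m]) = W (u @ [m, - i - n, i])
       - (if i = m - n then 2 * sg m * W (u @ [m - n]) else 0) + (if i = - m then 2 * sg m * W (u @ [m - n]) else 0)"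
      by simp
    then have "sg i * W (u @ [- i - n, i, m]) = sg i * W (u @ [m, - i - n, i])
       - (if i = m - n then 2 * (sg (m - n) * sg m) * W (u @ [m - n]) else 0)
       + (if i = - m then 2 * (sg (- m) * sg m) * W (u @ [m - n]) else 0)"
      using \<open>m * 2 \<noteq> n\<close> unfolding E by (simp add: distrib_left right_diff_distrib mult_ac del: sg_uminus sg_mult_self)
    then show ?thesis unfolding sg by simp
  qed
  then have "(\<Sum>i\<in>J. sg i * W (u @ [- i - n, i, m])) = (\<Sum>i\<in>J. sg i * W (u @ [m, - i - n, i]))
     + 2 * W (u @ [m - n]) + 2 * W (u @ [m - n])"
    using J by (simp add: sum.distrib)
  then show ?thesis
    using Bos_superset[OF bra_like_append[OF W] n J(1,2), of "[m]"] Bos_superset[OF W n J(1,3)] by simp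
qed

section \<open>Bosons as derivations on letters\<close>

lemma Bos_neg_Nil:
  assumes "bra_like W" "n > 0"
  shows "Bos (- n) W [] = 0"
  using assms(2) by (simp add: Bos_def)

text \<open>The derivation that replaces phi(z) by z^(s n) phi(z), one letter at a time.
  Exponentials of combinations of these are the twists.\<close>

fun shift_der :: "int \<Rightarrow> nat \<Rightarrow> (int list \<Rightarrow> 'a::comm_ring_1) \<Rightarrow> int list \<Rightarrow> 'a" where
  "shift_der s n W [] = 0"
| "shift_der s n W (m # w) = W ((m - s * int n) # w) + shift_der s n (\<lambda>u. W (m # u)) w"

lemma shift_der_snoc: "shift_der s n W (u @ [m]) = shift_der s n (\<lambda>v. W (v @ [m])) u + W (u @ [m - s * int n])"
  by (induction u arbitrary: W) (simp_all add: add_ac)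

lemma shift_der_add: "shift_der s n (\<lambda>u. W u + W' u) w = shift_der s n W w + shift_der s n W' w"
  by (induction w arbitrary: W W') (simp_all add: algebra_simps)

lemma shift_der_scale: "shift_der s n (\<lambda>u. c * W u) w = c * shift_der s n W w"
  by (induction w arbitrary: W) (simp_all add: algebra_simps)

lemma shift_der_zero [simp]: "shift_der s n (\<lambda>u. 0) w = 0"
  using shift_der_scale[of s n 0 "\<lambda>_. 0"] by simp

lemma shift_der_sum: "shift_der s n (\<lambda>u. \<Sum>i\<in>I. F i u) w = (\<Sum>i\<in>I. shift_der s n (F i) w)"
  by (induction I rule: infinite_finite_induct) (simp_all add: shift_der_add)

lemma shift_der_cong:
  assumes "\<And>u. length u = length w \<Longrightarrow> sum_list u = sum_list w - s * int n \<Longrightarrow> W u = W' u"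
  shows "shift_der s n W w = shift_der s n W' w"
  using assms
proof (induction w arbitrary: W W')
  case (Cons m w)
  show ?case unfolding shift_der.simps
    by (intro arg_cong2[where f = plus] Cons.IH Cons.prems) auto
qed auto

text \<open><vac| b_(-n) = 0, so moving b_(-n) to the left through the word leaves only the
  commutators with its letters, with a minus sign.\<close>

lemma Bos_neg:
  assumes "bra_like W" "odd n"
  shows "Bos (- int n) W w = - 4 * shift_der (- 1) n W w"
  using assms(1)
proof (induction w arbitrary: W rule: rev_induct)
  case Nil
  then show ?case using assms(2) by (simp add: Bos_neg_Nil odd_pos)
next
  case (snoc m w)
  from Bos_phi[OF snoc.prems, of "- int n" m w] snoc.IH[OF bra_like_append[OF snoc.prems], of "[m]"] assms(2)
  show ?case by (simp add: shift_der_snoc algebra_simps)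
qed

text \<open>The mirror image: b_n |vac> = 0, so moving b_n to the right through \<open>w\<close>
  leaves the commutators with the letters of \<open>w\<close>.\<close>

lemma Bos_pos_word:
  assumes V: "bra_like V" and kill: "\<And>w m. m < 0 \<Longrightarrow> V (w @ [m]) = 0" and n: "odd n"
  shows "Bos (int n) (\<lambda>u. V (u @ w)) u = 4 * shift_der 1 n (\<lambda>w. V (u @ w)) w"
proof (induction w arbitrary: u)
  case Nil
  have "V (u @ [- i - int n, i]) = 0" for i
  proof (cases "i < 0")
    case True
    then show ?thesis using kill[of i "u @ [- i - int n]"] by simp
  next
    case False
    moreover have "n > 0" using n by (rule odd_pos)
    ultimately have "V ((u @ [i]) @ [- i - int n]) = 0" by (intro kill) auto
    then show ?thesis using cliffordD[OF bra_like_clifford[OF V], of u "- i - int n" i "[]"] \<open>n > 0\<close> by simp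
  qed
  then show ?case by (simp add: Bos_def)
next
  case (Cons m w)
  have "Bos (int n) (\<lambda>u. V (u @ m # w)) u = Bos (int n) (\<lambda>v. V ((v @ [m]) @ w)) u" by simp
  also have "\<dots> = Bos (int n) (\<lambda>v. V (v @ w)) (u @ [m]) + 4 * V ((u @ [m - int n]) @ w)"
    by (rule Bos_phi[OF bra_like_append[OF V]]) (use n in simp)
  also have "\<dots> = 4 * shift_der 1 n (\<lambda>w. V (u @ w)) (m # w)"
    unfolding Cons.IH by (simp add: algebra_simps)
  finally show ?case .
qed

section \<open>The Heisenberg relation\<close>

text \<open>By the Jacobi identity the commutator of two bosons commutes with all fermions, so it is
  determined by its value on the left vacuum.\<close>

lemma Bos_comm_Nil:
  fixes W :: "int list \<Rightarrow> 'a::{idom,ring_char_0}"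
  assumes W: "bra_like W" and n: "odd n" and m: "odd m"
  shows "Bos (int n) (Bos (- int m) W) [] = (if n = m then 8 * of_nat n * W [] else 0)"
proof -
  have nm: "n > 0" "m > 0" using n m by (auto simp: odd_pos)
  note C = cliffordD[OF bra_like_clifford[OF W]]
  have kill: "W [a, b] = 0" if "a > 0" for a b using W that by (simp add: bra_like_def)
  \<comment> \<open>Both parts of the double sum are sums of this one function up to sign, over
    windows that differ by a shift of \<open>m\<close>.\<close>
  define g where "g i = sg i * W [- i - (int n - int m), i]" for i
  have "Bos (int n) (Bos (- int m) W) [] =
     (\<Sum>i\<in>{- int n..0}. - 4 * g i + - 4 * (sg i * W [- i - int n, i + int m]))"
    using m by (simp add: Bos_def[of "int n"] Bos_neg[OF W] g_def algebra_simps)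
  also have "\<dots> = - 4 * ((\<Sum>i\<in>{- int n..0}. g i) + (\<Sum>i\<in>{- int n..0}. sg i * W [- i - int n, i + int m]))"
    by (simp only: sum.distrib distrib_left sum_distrib_left)
  also have "(\<Sum>i\<in>{- int n..0}. sg i * W [- i - int n, i + int m]) = (\<Sum>i\<in>{int m - int n..int m}. - g i)"
    by (rule sum.reindex_bij_witness[of _ "\<lambda>i. i - int m" "\<lambda>i. i + int m"])
      (use m in \<open>auto simp: g_def sg_def algebra_simps\<close>)
  also have "- 4 * ((\<Sum>i\<in>{- int n..0}. g i) + (\<Sum>i\<in>{int m - int n..int m}. - g i)) =
      (if n = m then 8 * of_nat n * W [] else 0)"
  \<comment> \<open>For n \<noteq> m the function vanishes outside the overlap of the two windows,
    so they cancel. For n = m its values at negative, zero and positive indices are 0,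
    \<open>W []\<close> and \<open>2 * W []\<close>, and the second window has n positive
    indices.\<close>
  proof (cases "n = m")
    case False
    have g0: "g i = 0" if "i \<notin> {int m - int n..0}" for i
    proof (cases "i < int m - int n")
      case True
      then show ?thesis by (simp add: g_def kill)
    next
      case False
      with that have "W [i, - i - (int n - int m)] = 0" by (intro kill) auto
      then show ?thesis using C[of "[]" i "- i - (int n - int m)" "[]"] \<open>n \<noteq> m\<close> by (simp add: g_def)
    qed
    have "sum g {- int n..0} = sum g {int m - int n..0}" "sum g {int m - int n..int m} = sum g {int m - int n..0}"
      using g0 nm by (intro sum.mono_neutral_right; auto)+
    with False show ?thesis by (simp add: sum_negf)
  next
    case True
    have gneg: "g i = 0" if "i < 0" for i using that by (simp add: g_def True kill)
    have "2 * W [0, 0] = 2 * W []" using C[of "[]" 0 0 "[]"] by (simp add: sg_def)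
    then have g0: "g 0 = W []" by (simp add: g_def True sg_def)
    have gpos: "g i = 2 * W []" if "i > 0" for i
    proof -
      have "W [- i, i] = 2 * sg i * W []"
        using C[of "[]" "- i" i "[]"] that kill[of i "- i"] by simp
      then have "g i = 2 * (sg i * sg i) * W []" by (simp add: g_def True mult_ac)
      then show ?thesis by simp
    qed
    have "sum g {- int n..0} = sum g {0}" using gneg by (intro sum.mono_neutral_right) auto
    moreover have "{int m - int n..int m} = insert 0 {1..int n}" using nm True by auto
    then have "sum g {int m - int n..int m} = g 0 + of_nat n * (2 * W [])" using gpos by simp
    ultimately show ?thesis using True by (simp add: sum_negf g0 algebra_simps)
  qed
  finally show ?thesis .
qed

lemma Bos_comm:
  fixes W :: "int list \<Rightarrow> 'a::{idom,ring_char_0}"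
  assumes "bra_like W" "odd n" "odd m"
  shows "Bos (int n) (Bos (- int m) W) u = Bos (- int m) (Bos (int n) W) u
    + (if n = m then 8 * of_nat n * W u else 0)"
  using assms(1)
proof (induction u arbitrary: W rule: rev_induct)
  case Nil
  have "Bos (- int m) (Bos (int n) W) [] = 0"
    using assms(3) Nil by (intro Bos_neg_Nil Bos_bra_like) (auto simp: odd_pos)
  then show ?case using Bos_comm_Nil[OF Nil assms(2,3)] by simp
next
  case (snoc k u)
  note W = snoc.prems
  have P: "Bos (int n) (\<lambda>v. W (v @ [k])) = (\<lambda>v. Bos (int n) W (v @ [k]) + 4 * W (v @ [k - int n]))"
    "Bos (- int m) (\<lambda>v. W (v @ [k])) = (\<lambda>v. Bos (- int m) W (v @ [k]) + 4 * W (v @ [k + int m]))" for k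
    using Bos_phi[OF W, of "int n" k] Bos_phi[OF W, of "- int m" k] assms(2,3) by (simp_all add: fun_eq_iff)
  have "Bos (int n) (Bos (- int m) W) (u @ [k]) =
     Bos (int n) (\<lambda>v. Bos (- int m) W (v @ [k])) u - 4 * Bos (- int m) W (u @ [k - int n])"
    using Bos_phi[OF Bos_bra_like[OF W], of "int n" "- int m" k u] assms(2) by simp
  also have "Bos (int n) (\<lambda>v. Bos (- int m) W (v @ [k])) u =
     Bos (int n) (Bos (- int m) (\<lambda>v. W (v @ [k]))) u - 4 * Bos (int n) (\<lambda>v. W (v @ [k + int m])) u"
    unfolding P(2) Bos_add Bos_scale by simp
  also have "Bos (int n) (Bos (- int m) (\<lambda>v. W (v @ [k]))) u =
     Bos (- int m) (Bos (int n) (\<lambda>v. W (v @ [k]))) u + (if n = m then 8 * of_nat n * W (u @ [k]) else 0)"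
    by (rule snoc.IH[OF bra_like_append[OF W]])
  also have "Bos (- int m) (Bos (int n) (\<lambda>v. W (v @ [k]))) u =
     Bos (- int m) (\<lambda>v. Bos (int n) W (v @ [k])) u + 4 * Bos (- int m) (\<lambda>v. W (v @ [k - int n])) u"
    unfolding P(1) Bos_add Bos_scale by simp
  also have "Bos (- int m) (\<lambda>v. Bos (int n) W (v @ [k])) u =
     Bos (- int m) (Bos (int n) W) (u @ [k]) + 4 * Bos (int n) W (u @ [k + int m])"
    using Bos_phi[OF Bos_bra_like[OF W], of "- int m" "int n" k u] assms(3) by simp
  finally show ?case unfolding P by (simp add: algebra_simps)
qed

section \<open>Exponentials of derivations\<close>

lemma shift_der_eq_0:
  assumes "\<And>u. length u = length w \<Longrightarrow> sum_list u = sum_list w - s * int n \<Longrightarrow> W u = 0"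
  shows "shift_der s n W w = 0"
  using shift_der_cong[of w s n W "\<lambda>_. 0"] assms by simp

text \<open>The part of total shift \<open>d\<close> of the k-th power of the derivation sum_n h_n
  \<open>shift_der s n\<close>.\<close>

fun shift_pow :: "int \<Rightarrow> 'a::comm_ring_1 fps \<Rightarrow> nat \<Rightarrow> nat \<Rightarrow> (int list \<Rightarrow> 'a) \<Rightarrow> int list \<Rightarrow> 'a" where
  "shift_pow s h 0 d W w = (if d = 0 then W w else 0)"
| "shift_pow s h (Suc k) d W w = (\<Sum>n\<le>d. h $ n * shift_der s n (shift_pow s h k (d - n) W) w)"

lemma shift_pow_Nil: "shift_pow s h k d W [] = (if k = 0 \<and> d = 0 then W [] else 0)"
  by (cases k) simp_all

lemma shift_pow_eq_0: "h $ 0 = 0 \<Longrightarrow> k > d \<Longrightarrow> shift_pow s h k d W w = 0"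
proof (induction k arbitrary: d w)
  case (Suc k)
  show ?case unfolding shift_pow.simps
  proof (intro sum.neutral ballI)
    fix n assume "n \<in> {..d}"
    then show "h $ n * shift_der s n (shift_pow s h k (d - n) W) w = 0"
    proof (cases "n = 0")
      case False
      have "shift_pow s h k (d - n) W u = 0" for u
        using Suc.prems False \<open>n \<in> {..d}\<close> by (intro Suc.IH) auto
      then show ?thesis by (simp add: shift_der_eq_0)
    qed (use Suc.prems in simp)
  qed
qed simp

lemma fps_pow_nth_eq_0: "h $ 0 = (0 :: 'a::comm_ring_1) \<Longrightarrow> n < p \<Longrightarrow> (h ^ p) $ n = 0"
proof (induction p arbitrary: n)
  case (Suc p)
  have "h $ i * (h ^ p) $ (n - i) = 0" if "i \<le> n" for i
    using Suc that by (cases "i = 0") auto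
  then show ?case by (simp add: fps_mult_nth)
qed simp

lemma fps_conv_sum:
  fixes h f :: "'a::comm_ring_1 fps"
  shows "(\<Sum>n\<le>d. h $ n * (\<Sum>m\<le>d - n. f $ m * A (n + m))) = (\<Sum>t\<le>d. (h * f) $ t * A t)"
proof -
  have "(\<Sum>n\<le>d. h $ n * (\<Sum>m\<le>d - n. f $ m * A (n + m))) =
      (\<Sum>(n, m)\<in>(SIGMA n:{..d}. {..d - n}). h $ n * f $ m * A (n + m))"
    by (simp add: sum.Sigma[symmetric] sum_distrib_left mult.assoc)
  also have "\<dots> = (\<Sum>(t, n)\<in>(SIGMA t:{..d}. {..t}). h $ n * f $ (t - n) * A t)"
    by (rule sum.reindex_bij_witness[of _ "\<lambda>(t, n). (n, t - n)" "\<lambda>(n, m). (n + m, n)"]) auto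
  also have "\<dots> = (\<Sum>t\<le>d. (h * f) $ t * A t)"
    by (simp add: sum.Sigma[symmetric] fps_mult_nth atLeast0AtMost sum_distrib_right)
  finally show ?thesis .
qed

text \<open>Pascal's rule, shaped for inductions on the power of a sum of two commuting
  operators.\<close>

lemma binomial_step:
  fixes A :: "nat \<Rightarrow> 'a::comm_ring_1"
  shows "(\<Sum>p\<le>k. of_nat (k choose p) * (A (Suc p) + A p)) = (\<Sum>p\<le>Suc k. of_nat (Suc k choose p) * A p)"
proof -
  have "(\<Sum>p\<le>Suc k. of_nat (Suc k choose p) * A p) =
     A 0 + (\<Sum>p\<le>k. of_nat (k choose Suc p) * A (Suc p)) + (\<Sum>p\<le>k. of_nat (k choose p) * A (Suc p))"
    by (subst sum.atMost_Suc_shift) (simp add: sum.distrib distrib_right add_ac)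
  also have "A 0 + (\<Sum>p\<le>k. of_nat (k choose Suc p) * A (Suc p)) = (\<Sum>p\<le>Suc k. of_nat (k choose p) * A p)"
    by (subst sum.atMost_Suc_shift) simp
  also have "\<dots> = (\<Sum>p\<le>k. of_nat (k choose p) * A p)"
    by (simp add: binomial_eq_0)
  finally show ?thesis by (simp add: sum.distrib distrib_left add_ac)
qed

text \<open>Leibniz rule: the derivation is the sum of commuting derivations on the first letter and
  on the rest, and p applications to the first letter multiply it by h^p.\<close>

lemma shift_pow_Cons:
  "shift_pow s h k d W (m # w) = (\<Sum>p\<le>k. of_nat (k choose p) *
     (\<Sum>n\<le>d. (h ^ p) $ n * shift_pow s h (k - p) (d - n) (\<lambda>u. W ((m - s * int n) # u)) w))"
proof (induction k arbitrary: d m w)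
  case 0
  have "(\<Sum>n\<le>d. 1 $ n * (if d - n = 0 then W ((m - s * int n) # w) else 0)) =
        (\<Sum>n\<le>d. if n = 0 then if d = 0 then W (m # w) else 0 else 0)"
    by (intro sum.cong) auto
  then show ?case by simp
next
  case (Suc k)
  define X where "X n = (\<lambda>u. W ((m - s * int n) # u))" for n
  define G where "G f j = (\<Sum>n\<le>d. f $ n * shift_pow s h j (d - n) (X n) w)" for f j
  have "shift_pow s h (Suc k) d W (m # w) =
     (\<Sum>n\<le>d. h $ n * shift_pow s h k (d - n) W ((m - s * int n) # w)) +
     (\<Sum>n\<le>d. h $ n * shift_der s n (\<lambda>u. shift_pow s h k (d - n) W (m # u)) w)"
    by (simp add: sum.distrib distrib_left)
  also have "(\<Sum>n\<le>d. h $ n * shift_pow s h k (d - n) W ((m - s * int n) # w)) =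
     (\<Sum>p\<le>k. of_nat (k choose p) * G (h ^ Suc p) (k - p))"
  proof -
    have "(\<Sum>n\<le>d. h $ n * shift_pow s h k (d - n) W ((m - s * int n) # w)) =
        (\<Sum>n\<le>d. \<Sum>p\<le>k. of_nat (k choose p) *
          (h $ n * (\<Sum>m\<le>d - n. (h ^ p) $ m * shift_pow s h (k - p) (d - (n + m)) (X (n + m)) w)))"
      unfolding Suc.IH X_def by (simp add: sum_distrib_left algebra_simps)
    also have "\<dots> = (\<Sum>p\<le>k. of_nat (k choose p) * (\<Sum>n\<le>d. h $ n * (\<Sum>m\<le>d - n. (h ^ p) $ m *
          shift_pow s h (k - p) (d - (n + m)) (X (n + m)) w)))"
      by (subst sum.swap) (simp only: sum_distrib_left)
    also have "\<dots> = (\<Sum>p\<le>k. of_nat (k choose p) * G (h ^ Suc p) (k - p))"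
    proof (intro sum.cong refl arg_cong2[where f = times])
      fix p
      show "(\<Sum>n\<le>d. h $ n * (\<Sum>m\<le>d - n. (h ^ p) $ m * shift_pow s h (k - p) (d - (n + m)) (X (n + m)) w))
          = G (h ^ Suc p) (k - p)"
        using fps_conv_sum[of h "h ^ p" "\<lambda>t. shift_pow s h (k - p) (d - t) (X t) w" d] by (simp add: G_def)
    qed
    finally show ?thesis .
  qed
  also have "(\<Sum>n\<le>d. h $ n * shift_der s n (\<lambda>u. shift_pow s h k (d - n) W (m # u)) w) =
     (\<Sum>p\<le>k. of_nat (k choose p) * G (h ^ p) (Suc (k - p)))"
  proof -
    have "(\<Sum>n\<le>d. h $ n * shift_der s n (\<lambda>u. shift_pow s h k (d - n) W (m # u)) w) =
       (\<Sum>n\<le>d. \<Sum>p\<le>k. \<Sum>l\<le>d - n. of_nat (k choose p) * ((h ^ p) $ l * (h $ n *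
          shift_der s n (shift_pow s h (k - p) (d - n - l) (X l)) w)))"
      unfolding Suc.IH X_def by (simp add: sum_distrib_left shift_der_sum shift_der_scale mult_ac)
    also have "\<dots> = (\<Sum>p\<le>k. \<Sum>n\<le>d. \<Sum>l\<le>d - n. of_nat (k choose p) * ((h ^ p) $ l * (h $ n *
          shift_der s n (shift_pow s h (k - p) (d - n - l) (X l)) w)))"
      by (rule sum.swap)
    also have "\<dots> = (\<Sum>p\<le>k. \<Sum>l\<le>d. \<Sum>n\<le>d - l. of_nat (k choose p) * ((h ^ p) $ l * (h $ n *
          shift_der s n (shift_pow s h (k - p) (d - l - n) (X l)) w)))"
      unfolding sum.Sigma[OF finite_atMost ballI[OF finite_atMost]]
      by (intro sum.cong refl sum.reindex_bij_witness[of _ "\<lambda>(i, j). (j, i)" "\<lambda>(i, j). (j, i)"])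
        (auto simp: add.commute)
    also have "\<dots> = (\<Sum>p\<le>k. of_nat (k choose p) * G (h ^ p) (Suc (k - p)))"
      by (simp add: G_def sum_distrib_left)
    finally show ?thesis .
  qed
  also have "(\<Sum>p\<le>k. of_nat (k choose p) * G (h ^ Suc p) (k - p)) +
      (\<Sum>p\<le>k. of_nat (k choose p) * G (h ^ p) (Suc (k - p))) =
      (\<Sum>p\<le>k. of_nat (k choose p) * (G (h ^ Suc p) (Suc k - Suc p) + G (h ^ p) (Suc k - p)))"
    by (simp add: sum.distrib distrib_left Suc_diff_le)
  also have "\<dots> = (\<Sum>p\<le>Suc k. of_nat (Suc k choose p) * G (h ^ p) (Suc k - p))"
    by (rule binomial_step[of k "\<lambda>p. G (h ^ p) (Suc k - p)"])
  finally show ?case by (simp only: G_def X_def)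
qed

text \<open>\<open>\<iota> k\<close> plays the role of \<open>1 / k!\<close> in rings that are not fields.\<close>

definition fact_inv :: "(nat \<Rightarrow> 'a::comm_ring_1) \<Rightarrow> bool" where
  "fact_inv \<iota> \<longleftrightarrow> (\<forall>k. \<iota> k * of_nat (fact k) = 1)"

lemma fact_inv_0: "fact_inv \<iota> \<Longrightarrow> \<iota> 0 = 1"
  unfolding fact_inv_def by (metis fact_0 mult.right_neutral of_nat_1)

lemma fact_inv_Suc: "fact_inv \<iota> \<Longrightarrow> \<iota> (Suc p) * of_nat (Suc p) = \<iota> p"
proof -
  assume \<iota>: "fact_inv \<iota>"
  have "\<iota> (Suc p) * of_nat (Suc p) = \<iota> (Suc p) * of_nat (Suc p) * (\<iota> p * of_nat (fact p))"
    using \<iota> by (simp add: fact_inv_def)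
  also have "\<dots> = \<iota> p * (\<iota> (Suc p) * of_nat (fact (Suc p)))"
    by (simp only: fact_Suc of_nat_mult of_nat_id mult_ac)
  finally show ?thesis using \<iota> by (simp add: fact_inv_def del: fact_Suc)
qed

lemma fact_inv_binomial:
  assumes \<iota>: "fact_inv \<iota>" and "p \<le> k"
  shows "\<iota> k * of_nat (k choose p) = \<iota> p * \<iota> (k - p)"
proof -
  have "\<iota> k * of_nat (k choose p) =
      \<iota> k * of_nat (k choose p) * (\<iota> p * of_nat (fact p)) * (\<iota> (k - p) * of_nat (fact (k - p)))"
    using \<iota> by (simp add: fact_inv_def)
  also have "\<dots> = \<iota> k * of_nat (fact p * fact (k - p) * (k choose p)) * (\<iota> p * \<iota> (k - p))"
    by (simp only: of_nat_mult mult_ac)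
  also have "\<dots> = \<iota> k * of_nat (fact k) * (\<iota> p * \<iota> (k - p))"
    using binomial_fact_lemma[OF assms(2)] by simp
  finally show ?thesis using \<iota> by (simp add: fact_inv_def)
qed

text \<open>The exponential of a series without constant term: powers beyond h^n do not reach degree
  n.\<close>

definition fps_expo :: "(nat \<Rightarrow> 'a::comm_ring_1) \<Rightarrow> 'a fps \<Rightarrow> 'a fps" where
  "fps_expo \<iota> h = Abs_fps (\<lambda>n. \<Sum>p\<le>n. \<iota> p * (h ^ p) $ n)"

text \<open>The exponential of a derivation is multiplicative, so it multiplies every letter by
  exp(h). Powers beyond \<open>d\<close> shift by more than \<open>d\<close>; hence any cut-off N
  \<ge> d will do.\<close>

lemma exp_shift_pow:
  assumes \<iota>: "fact_inv \<iota>" and h: "h $ 0 = 0"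
  shows "N \<ge> d \<Longrightarrow> (\<Sum>k\<le>N. \<iota> k * shift_pow s h k d W w) = twist s (fps_expo \<iota> h) d W w"
proof (induction w arbitrary: d W N)
  case Nil
  have "(\<Sum>k\<le>N. \<iota> k * shift_pow s h k d W []) = (\<Sum>k\<le>N. if k = 0 then if d = 0 then W [] else 0 else 0)"
    by (intro sum.cong) (auto simp: shift_pow_Nil fact_inv_0[OF \<iota>])
  then show ?case by simp
next
  case (Cons m w)
  define X where "X n = (\<lambda>u. W ((m - s * int n) # u))" for n
  define T where "T n p i = \<iota> p * (h ^ p) $ n * (\<iota> i * shift_pow s h i (d - n) (X n) w)" for n p i
  have "(\<Sum>k\<le>N. \<iota> k * shift_pow s h k d W (m # w)) = (\<Sum>k\<le>N. \<Sum>p\<le>k. \<Sum>n\<le>d. T n p (k - p))"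
  proof (intro sum.cong refl)
    fix k
    have "\<iota> k * (of_nat (k choose p) * ((h ^ p) $ n * z)) = \<iota> p * (h ^ p) $ n * (\<iota> (k - p) * z)" if "p \<le> k" for p n z
      using fact_inv_binomial[OF \<iota> that] by (metis (no_types, lifting) mult.assoc mult.left_commute)
    then show "\<iota> k * shift_pow s h k d W (m # w) = (\<Sum>p\<le>k. \<Sum>n\<le>d. T n p (k - p))"
      unfolding shift_pow_Cons T_def X_def by (simp add: sum_distrib_left)
  qed
  also have "\<dots> = (\<Sum>k\<le>N. \<Sum>n\<le>d. \<Sum>p\<le>k. T n p (k - p))"
    by (intro sum.cong refl sum.swap)
  also have "\<dots> = (\<Sum>n\<le>d. \<Sum>k\<le>N. \<Sum>p\<le>k. T n p (k - p))"
    by (rule sum.swap)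
  also have "\<dots> = (\<Sum>n\<le>d. fps_expo \<iota> h $ n * twist s (fps_expo \<iota> h) (d - n) (X n) w)"
  proof (intro sum.cong refl)
    fix n assume n: "n \<in> {..d}"
    have "(\<Sum>k\<le>N. \<Sum>p\<le>k. T n p (k - p)) = (\<Sum>(p, i)\<in>{(p, i). p + i \<le> N}. T n p i)"
      unfolding sum.Sigma[OF finite_atMost ballI[OF finite_atMost]]
      by (rule sum.reindex_bij_witness[of _ "\<lambda>(p, i). (p + i, p)" "\<lambda>(k, p). (p, k - p)"]) auto
    also have "\<dots> = (\<Sum>(p, i)\<in>{..n} \<times> {..d - n}. T n p i)"
    proof (rule sum.mono_neutral_right)
      show "finite {(p, i). p + i \<le> N}"
        by (rule finite_subset[of _ "{..N} \<times> {..N}"]) auto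
      show "{..n} \<times> {..d - n} \<subseteq> {(p, i). p + i \<le> N}" using n Cons.prems by auto
      show "\<forall>x\<in>{(p, i). p + i \<le> N} - {..n} \<times> {..d - n}. (case x of (p, i) \<Rightarrow> T n p i) = 0"
      proof
        fix x assume x: "x \<in> {(p, i). p + i \<le> N} - {..n} \<times> {..d - n}"
        obtain p i where pi: "x = (p, i)" by (cases x)
        with x have "n < p \<or> d - n < i" by auto
        then have "T n p i = 0"
          using fps_pow_nth_eq_0[OF h, of n p] shift_pow_eq_0[OF h, of "d - n" i s "X n" w] by (auto simp: T_def)
        then show "(case x of (p, i) \<Rightarrow> T n p i) = 0" by (simp add: pi)
      qed
    qed
    also have "\<dots> = fps_expo \<iota> h $ n * (\<Sum>i\<le>d - n. \<iota> i * shift_pow s h i (d - n) (X n) w)"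
      by (simp add: T_def fps_expo_def sum_product sum.cartesian_product)
    also have "\<dots> = fps_expo \<iota> h $ n * twist s (fps_expo \<iota> h) (d - n) (X n) w"
      by (simp add: Cons.IH)
    finally show "(\<Sum>k\<le>N. \<Sum>p\<le>k. T n p (k - p)) = fps_expo \<iota> h $ n * twist s (fps_expo \<iota> h) (d - n) (X n) w" .
  qed
  finally show ?case by (simp add: X_def)
qed

section \<open>The logarithm of (1 + X z) / (1 - X z)\<close>

lemma fps_expo_deriv:
  assumes \<iota>: "fact_inv \<iota>" and h: "h $ 0 = 0"
  shows "fps_deriv (fps_expo \<iota> h) = fps_deriv h * fps_expo \<iota> h"
proof (rule fps_ext)
  fix n
  have "fps_deriv (fps_expo \<iota> h) $ n = (\<Sum>p\<le>Suc n. \<iota> p * fps_deriv (h ^ p) $ n)"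
    unfolding fps_expo_def fps_deriv_nth fps_nth_Abs_fps sum_distrib_left Suc_eq_plus1
    by (intro sum.cong refl mult.left_commute)
  also have "\<dots> = (\<Sum>p\<le>n. \<iota> (Suc p) * of_nat (Suc p) * (fps_deriv h * h ^ p) $ n)"
    by (subst sum.atMost_Suc_shift)
      (simp add: fps_deriv_power' fps_of_nat[symmetric] mult.assoc del: of_nat_Suc power_Suc)
  also have "\<dots> = (\<Sum>p\<le>n. \<iota> p * (fps_deriv h * h ^ p) $ n)"
    by (simp only: fact_inv_Suc[OF \<iota>])
  also have "\<dots> = (\<Sum>i\<le>n. \<Sum>p\<le>n. fps_deriv h $ i * (\<iota> p * (h ^ p) $ (n - i)))"
    by (subst sum.swap) (simp add: fps_mult_nth atLeast0AtMost sum_distrib_left mult_ac)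
  also have "\<dots> = (\<Sum>i\<le>n. \<Sum>p\<le>n - i. fps_deriv h $ i * (\<iota> p * (h ^ p) $ (n - i)))"
    by (intro sum.cong refl sum.mono_neutral_right) (auto simp: fps_pow_nth_eq_0[OF h])
  also have "\<dots> = (fps_deriv h * fps_expo \<iota> h) $ n"
    by (simp add: fps_mult_nth atLeast0AtMost fps_expo_def sum_distrib_left)
  finally show "fps_deriv (fps_expo \<iota> h) $ n = (fps_deriv h * fps_expo \<iota> h) $ n" .
qed

lemma fps_ode_unique:
  fixes f g a :: "'a::{idom,ring_char_0} fps"
  assumes "fps_deriv f = a * f" "fps_deriv g = a * g" "f $ 0 = g $ 0"
  shows "f = g"
proof (rule fps_ext)
  fix n
  show "f $ n = g $ n"
  proof (induction n rule: less_induct)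
    case (less n)
    show ?case
    proof (cases n)
      case 0
      with assms(3) show ?thesis by simp
    next
      case (Suc m)
      have "(a * f) $ m = (a * g) $ m"
        unfolding fps_mult_nth using less Suc by (intro sum.cong) auto
      then have "fps_deriv f $ m = fps_deriv g $ m" using assms by simp
      then show ?thesis using Suc by (simp del: of_nat_Suc)
    qed
  qed
qed

text \<open>The logarithmic derivative is 2 X / (1 - X^2 z^2). To avoid division in the coefficient
  ring, both sides are multiplied by (1 - X z)^2, which is then cancelled.\<close>

lemma qgen_deriv:
  "fps_deriv (qgen X) = Abs_fps (\<lambda>n. if even n then 2 * X ^ Suc n else 0) * qgen (X :: 'a::comm_ring_1)"
proof -
  define a b :: "'a fps" where "a = 1 - fps_const X * fps_X" and "b = 1 + fps_const X * fps_X"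
  define D where "D = Abs_fps (\<lambda>n. if even n then 2 * X ^ Suc n else 0)"
  have ab: "a * qgen X = b" unfolding a_def b_def by (rule qgen_mult)
  have "a * b * D = D - fps_const (X * X) * (fps_X * (fps_X * D))"
    by (simp add: a_def b_def algebra_simps flip: fps_const_mult)
  also have "\<dots> = 2 * fps_const X"
  proof (rule fps_ext)
    fix n
    show "(D - fps_const (X * X) * (fps_X * (fps_X * D))) $ n = (2 * fps_const X) $ n"
      by (cases n; cases "n - 1") (auto simp: D_def numeral_fps_const algebra_simps)
  qed
  finally have abD: "a * b * D = 2 * fps_const X" .
  have "fps_deriv (a * qgen X) = fps_deriv b" using ab by simp
  then have "a * fps_deriv (qgen X) = fps_const X * qgen X + fps_const X"
    by (simp add: a_def b_def algebra_simps)
  then have "a * (a * fps_deriv (qgen X)) = fps_const X * (a * qgen X) + fps_const X * a"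
    by (simp add: algebra_simps)
  also have "\<dots> = 2 * fps_const X" unfolding ab by (simp add: a_def b_def algebra_simps numeral_fps_const)
  also have "\<dots> = a * (a * qgen X * D)" unfolding ab using abD by (simp add: mult.assoc)
  also have "\<dots> = a * (a * (D * qgen X))" by (simp add: mult_ac)
  finally show ?thesis unfolding a_def D_def by (blast dest: one_minus_cancel)
qed

lemma fps_deriv_prod_qgen:
  "finite A \<Longrightarrow> fps_deriv (\<Prod>k\<in>A. qgen (X k)) =
    (\<Sum>k\<in>A. Abs_fps (\<lambda>n. if even n then 2 * X k ^ Suc n else 0)) * (\<Prod>k\<in>A. qgen (X k :: 'a::comm_ring_1))"
  by (induction A rule: finite_induct) (simp_all add: qgen_deriv algebra_simps)

lemma prod_qgen_0 [simp]: "(\<Prod>k\<in>A. qgen (X k)) $ 0 = 1"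
  by (induction A rule: infinite_finite_induct) simp_all

text \<open>log((1 + X z) / (1 - X z)) is twice the sum of X^n z^n / n over odd n, so both sides
  solve the same linear differential equation. The hypothesis on \<open>h\<close> is multiplied by n
  so that it makes sense in rings of power series.\<close>

lemma fps_expo_eq_prod_qgen:
  fixes h :: "'a::{idom,ring_char_0} fps"
  assumes \<iota>: "fact_inv \<iota>" and A: "finite A"
    and h: "\<And>n. of_nat n * h $ n = (if odd n then 2 * (\<Sum>k\<in>A. X k ^ n) else 0)" and h_nth_0: "h $ 0 = 0"
  shows "fps_expo \<iota> h = (\<Prod>k\<in>A. qgen (X k))"
proof (rule fps_ode_unique[OF fps_expo_deriv[OF \<iota> h_nth_0]])
  have "fps_deriv h = (\<Sum>k\<in>A. Abs_fps (\<lambda>n. if even n then 2 * X k ^ Suc n else 0))"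
  proof (rule fps_ext)
    fix n
    show "fps_deriv h $ n = (\<Sum>k\<in>A. Abs_fps (\<lambda>n. if even n then 2 * X k ^ Suc n else 0)) $ n"
      using h[of "Suc n"] by (simp add: fps_sum_nth sum_distrib_left)
  qed
  then show "fps_deriv (\<Prod>k\<in>A. qgen (X k)) = fps_deriv h * (\<Prod>k\<in>A. qgen (X k))"
    using fps_deriv_prod_qgen[OF A, of X] by simp
  show "fps_expo \<iota> h $ 0 = (\<Prod>k\<in>A. qgen (X k)) $ 0"
    by (simp add: fps_expo_def fact_inv_0[OF \<iota>])
qed

section \<open>The exponential of \<open>\<theta>\<^sup>*\<close>\<close>

text \<open>Letterwise multiplication by f(1/z), over all shifts. The cut-off keeps the sum finite
  for every \<open>W\<close>; for \<open>bra_like\<close> ones it drops only zeros, since larger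
  shifts lead to words of positive total.\<close>

definition raise_op :: "'a::comm_ring_1 fps \<Rightarrow> (int list \<Rightarrow> 'a) \<Rightarrow> int list \<Rightarrow> 'a" where
  "raise_op f W u = (\<Sum>d\<le>nat (- sum_list u). twist (- 1) f d W u)"

definition raise_der :: "'a::comm_ring_1 fps \<Rightarrow> (int list \<Rightarrow> 'a) \<Rightarrow> int list \<Rightarrow> 'a" where
  "raise_der h W u = (\<Sum>n\<le>nat (- sum_list u). h $ n * shift_der (- 1) n W u)"

lemma raise_der_pow:
  assumes h: "h $ 0 = 0"
  shows "(raise_der h ^^ k) W u = (\<Sum>d\<le>nat (- sum_list u). shift_pow (- 1) h k d W u)"
proof (induction k arbitrary: u)
  case (Suc k)
  let ?N = "nat (- sum_list u)"
  have "(raise_der h ^^ Suc k) W u = (\<Sum>n\<le>?N. h $ n * shift_der (- 1) n ((raise_der h ^^ k) W) u)"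
    by (simp add: raise_der_def)
  also have "\<dots> = (\<Sum>n\<le>?N. \<Sum>d\<le>?N - n. h $ n * shift_der (- 1) n (shift_pow (- 1) h k d W) u)"
  proof (intro sum.cong refl)
    fix n assume n: "n \<in> {..?N}"
    have "shift_der (- 1) n ((raise_der h ^^ k) W) u = shift_der (- 1) n (\<lambda>v. \<Sum>d\<le>?N - n. shift_pow (- 1) h k d W v) u"
    proof (rule shift_der_cong)
      fix v :: "int list" assume "sum_list v = sum_list u - - 1 * int n"
      then have "nat (- sum_list v) = ?N - n" by simp
      then show "(raise_der h ^^ k) W v = (\<Sum>d\<le>?N - n. shift_pow (- 1) h k d W v)" by (simp add: Suc.IH)
    qed
    then show "h $ n * shift_der (- 1) n ((raise_der h ^^ k) W) u =
        (\<Sum>d\<le>?N - n. h $ n * shift_der (- 1) n (shift_pow (- 1) h k d W) u)"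
      by (simp add: shift_der_sum sum_distrib_left)
  qed
  also have "\<dots> = (\<Sum>d\<le>?N. shift_pow (- 1) h (Suc k) d W u)"
  proof -
    have "(\<Sum>n\<le>?N. \<Sum>d\<le>?N - n. h $ n * shift_der (- 1) n (shift_pow (- 1) h k d W) u) =
      (\<Sum>d\<le>?N. \<Sum>n\<le>d. h $ n * shift_der (- 1) n (shift_pow (- 1) h k (d - n) W) u)"
      unfolding sum.Sigma[OF finite_atMost ballI[OF finite_atMost]]
      by (rule sum.reindex_bij_witness[of _ "\<lambda>(d, n). (n, d - n)" "\<lambda>(n, d). (n + d, n)"]) auto
    then show ?thesis by simp
  qed
  finally show ?case .
qed simp

lemma raise_der_pow_eq_0:
  assumes "h $ 0 = 0" "k > nat (- sum_list u)"
  shows "(raise_der h ^^ k) W u = 0"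
  unfolding raise_der_pow[OF assms(1)] using assms by (intro sum.neutral) (auto simp: shift_pow_eq_0)

lemma exp_raise_der:
  assumes "fact_inv \<iota>" "h $ 0 = 0" "N \<ge> nat (- sum_list u)"
  shows "(\<Sum>k\<le>N. \<iota> k * (raise_der h ^^ k) W u) = raise_op (fps_expo \<iota> h) W u"
  unfolding raise_der_pow[OF assms(2)] raise_op_def sum_distrib_left
  using assms(3) by (subst sum.swap) (auto intro!: sum.cong exp_shift_pow[OF assms(1,2)])

lemma raise_op_cong:
  assumes "\<And>v. sum_list v \<ge> sum_list u \<Longrightarrow> W v = W' v"
  shows "raise_op f W u = raise_op f W' u"
  unfolding raise_op_def by (intro sum.cong refl twist_cong assms) simp

lemma raise_op_sum: "raise_op f (\<lambda>v. \<Sum>i\<in>I. c i * F i v) u = (\<Sum>i\<in>I. c i * raise_op f (F i) u)"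
  unfolding raise_op_def sum_distrib_left
  by (simp add: twist_sum twist_scale sum.swap[of _ I])

lemma raise_op_add: "raise_op f (\<lambda>v. F v + G v) u = raise_op f F u + raise_op f G u"
  by (simp add: raise_op_def twist_add sum.distrib)

lemma raise_op_scale: "raise_op f (\<lambda>v. c * F v) u = c * raise_op f F u"
  by (simp add: raise_op_def twist_scale sum_distrib_left)

lemma raise_op_diff_scale: "raise_op f (\<lambda>v. F v - c * G v) u = raise_op f F u - c * raise_op f G u"
  using raise_op_add[of f F "\<lambda>v. - c * G v" u] raise_op_scale[of f "- c" G u] by simp

lemma raise_op_bra_like:
  assumes W: "bra_like W" and f: "f * fps_scale (- 1) f = 1"
  shows "bra_like (raise_op f W)"
proof -
  have "bra_like (twist (- 1) f d W)" for d
    unfolding bra_like_def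
  proof (intro conjI allI impI)
    show "clifford (twist (- 1) f d W)"
      by (rule twist_clifford[OF bra_like_clifford[OF W] f]) simp
    fix m :: int and w assume "m > 0"
    then show "twist (- 1) f d W (m # w) = 0"
      using W by (auto simp: bra_like_def intro!: sum.neutral)
  qed
  then have "bra_like (\<lambda>u. \<Sum>d\<in>{..nat (- sum_list u)}. 1 * twist (- 1) f d W u)"
    by (intro bra_like_sum_cong) auto
  then show ?thesis by (simp add: raise_op_def[abs_def])
qed

lemma raise_op_pow_bra_like:
  "bra_like W \<Longrightarrow> f * fps_scale (- 1) f = 1 \<Longrightarrow> bra_like ((raise_op f ^^ a) W)"
  by (induction a) (simp_all add: raise_op_bra_like)

lemma raise_op_pow_add: "(raise_op f ^^ a) (\<lambda>v. F v + G v) = (\<lambda>u. (raise_op f ^^ a) F u + (raise_op f ^^ a) G u)"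
proof (induction a)
  case (Suc a)
  then show ?case by (auto simp: raise_op_add intro!: ext)
qed simp

lemma raise_op_pow_scale: "(raise_op f ^^ a) (\<lambda>v. c * F v) = (\<lambda>u. c * (raise_op f ^^ a) F u)"
proof (induction a)
  case (Suc a)
  then show ?case by (auto simp: raise_op_scale intro!: ext)
qed simp

text \<open>The derivation acts on the letters \<open>w\<close> to the right of the exponentials, so
  linearity of the exponentials is enough.\<close>

lemma raise_op_pow_shift_der:
  "(raise_op f ^^ a) (\<lambda>v. shift_der s n (\<lambda>w. F w v) w) u = shift_der s n (\<lambda>w. (raise_op f ^^ a) (F w) u) w"
proof (induction w arbitrary: F)
  case Nil
  show ?case using raise_op_pow_scale[of a f 0 "\<lambda>_. 0"] by (simp add: fun_eq_iff)
qed (simp add: raise_op_pow_add)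

lemma twist_superset:
  assumes W: "bra_like W" and "M \<ge> nat (- sum_list u)"
  shows "raise_op f W u = (\<Sum>d\<le>M. twist (- 1) f d W u)"
  unfolding raise_op_def
proof (rule sum.mono_neutral_left)
  show "\<forall>i\<in>{..M} - {..nat (- sum_list u)}. twist (- 1) f i W u = 0"
    by (intro ballI twist_eq_0) (rule bra_like_pos[OF W], auto)
qed (use assms(2) in auto)

text \<open>Conjugation of a fermion: an exponential that passes a letter to the left multiplies the
  generating function of that letter by f(1/z).\<close>

lemma raise_op_snoc:
  assumes W: "bra_like W" and N: "N \<ge> nat (- sum_list u - m)"
  shows "raise_op f W (u @ [m]) = (\<Sum>j\<le>N. f $ j * raise_op f (\<lambda>v. W (v @ [m + int j])) u)"
proof -
  define M where "M = max N (nat (- sum_list u))"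
  define T where "T j e = f $ j * twist (- 1) f e (\<lambda>v. W (v @ [m + int j])) u" for j e
  have T0: "T j e = 0" if "int j + int e > - sum_list u - m" for j e
  proof -
    have "twist (- 1) f e (\<lambda>v. W (v @ [m + int j])) u = 0"
      by (rule twist_eq_0, rule bra_like_pos[OF W]) (use that in simp)
    then show ?thesis by (simp add: T_def)
  qed
  have "raise_op f W (u @ [m]) = (\<Sum>d\<le>N + M. \<Sum>j\<le>d. T j (d - j))"
    using N by (subst twist_superset[OF W, where M = "N + M"]) (auto simp: twist_snoc T_def)
  also have "\<dots> = (\<Sum>(j, e)\<in>{(j, e). j + e \<le> N + M}. T j e)"
    unfolding sum.Sigma[OF finite_atMost ballI[OF finite_atMost]]
    by (rule sum.reindex_bij_witness[of _ "\<lambda>(p, i). (p + i, p)" "\<lambda>(k, p). (p, k - p)"]) auto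
  also have "\<dots> = (\<Sum>(j, e)\<in>{..N} \<times> {..M}. T j e)"
  proof (rule sum.mono_neutral_right)
    show "finite {(j, e). j + e \<le> N + M}"
      by (rule finite_subset[of _ "{..N + M} \<times> {..N + M}"]) auto
    show "\<forall>x\<in>{(j, e). j + e \<le> N + M} - {..N} \<times> {..M}. (case x of (j, e) \<Rightarrow> T j e) = 0"
    proof
      fix x assume x: "x \<in> {(j, e). j + e \<le> N + M} - {..N} \<times> {..M}"
      obtain j e where "x = (j, e)" by (cases x)
      moreover from this x have "j > N \<or> e > M" by auto
      then have "int j + int e > - sum_list u - m" using N unfolding M_def by linarith
      ultimately show "(case x of (j, e) \<Rightarrow> T j e) = 0" using T0 by simp
    qed
  qed auto
  also have "\<dots> = (\<Sum>j\<le>N. \<Sum>e\<le>M. T j e)"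
    by (simp add: sum.cartesian_product)
  also have "\<dots> = (\<Sum>j\<le>N. f $ j * raise_op f (\<lambda>v. W (v @ [m + int j])) u)"
  proof (intro sum.cong refl)
    fix j
    show "(\<Sum>e\<le>M. T j e) = f $ j * raise_op f (\<lambda>v. W (v @ [m + int j])) u"
      by (subst twist_superset[OF bra_like_append[OF W], where M = M])
        (auto simp: T_def sum_distrib_left M_def)
  qed
  finally show ?thesis .
qed

lemma raise_op_pow_eq_0:
  assumes "\<And>v. sum_list v > c \<Longrightarrow> W v = 0" "sum_list u > c"
  shows "(raise_op f ^^ a) W u = 0"
  using assms(2)
proof (induction a arbitrary: u)
  case (Suc a)
  then show ?case by (auto simp: raise_op_def intro!: sum.neutral twist_eq_0)
qed (simp add: assms(1))

lemma raise_op_pow_append_eq_0: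
  assumes "bra_like W" "sum_list u + sum_list w > 0"
  shows "(raise_op f ^^ a) (\<lambda>v. W (v @ w)) u = 0"
  by (rule raise_op_pow_eq_0[where c = "- sum_list w"]) (use assms in \<open>auto intro: bra_like_pos\<close>)

lemma raise_op_pow_snoc:
  assumes W: "bra_like W" and f: "f * fps_scale (- 1) f = 1" and N: "N \<ge> nat (- sum_list u - m)"
  shows "(raise_op f ^^ a) W (u @ [m]) = (\<Sum>j\<le>N. (f ^ a) $ j * (raise_op f ^^ a) (\<lambda>v. W (v @ [m + int j])) u)"
  using N
proof (induction a arbitrary: u m N)
  case 0
  have "(\<Sum>j\<le>N. (1 :: 'a fps) $ j * W (u @ [m + int j])) = (\<Sum>j\<le>N. if j = 0 then W (u @ [m]) else 0)"
    by (intro sum.cong) auto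
  then show ?case by simp
next
  case (Suc a)
  define Y where "Y j = (raise_op f ^^ Suc a) (\<lambda>v. W (v @ [m + int j])) u" for j
  have Y0: "Y j = 0" if "int j > - sum_list u - m" for j
    unfolding Y_def by (rule raise_op_pow_append_eq_0[OF W]) (use that in simp)
  have "(raise_op f ^^ Suc a) W (u @ [m]) =
      (\<Sum>j\<le>N. f $ j * raise_op f (\<lambda>v. (raise_op f ^^ a) W (v @ [m + int j])) u)"
    using raise_op_snoc[OF raise_op_pow_bra_like[OF W f] Suc.prems] by simp
  also have "\<dots> = (\<Sum>j\<le>N. f $ j * (\<Sum>l\<le>N. (f ^ a) $ l * Y (j + l)))"
  proof (intro sum.cong refl arg_cong2[where f = times])
    fix j
    have "raise_op f (\<lambda>v. (raise_op f ^^ a) W (v @ [m + int j])) u =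
       raise_op f (\<lambda>v. \<Sum>l\<le>N. (f ^ a) $ l * (raise_op f ^^ a) (\<lambda>v. W (v @ [m + int j + int l])) v) u"
      by (rule raise_op_cong, rule Suc.IH) (use Suc.prems in auto)
    also have "\<dots> = (\<Sum>l\<le>N. (f ^ a) $ l * Y (j + l))"
      by (simp add: raise_op_sum Y_def add.assoc)
    finally show "raise_op f (\<lambda>v. (raise_op f ^^ a) W (v @ [m + int j])) u = (\<Sum>l\<le>N. (f ^ a) $ l * Y (j + l))" .
  qed
  also have "\<dots> = (\<Sum>j\<le>N. f $ j * (\<Sum>l\<le>N - j. (f ^ a) $ l * Y (j + l)))"
  proof (rule sum.cong[OF refl])
    fix j
    have "Y (j + l) = 0" if "l \<notin> {..N - j}" for l
      using that Suc.prems by (intro Y0) auto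
    then have "(\<Sum>l\<le>N. (f ^ a) $ l * Y (j + l)) = (\<Sum>l\<le>N - j. (f ^ a) $ l * Y (j + l))"
      by (intro sum.mono_neutral_right) auto
    then show "f $ j * (\<Sum>l\<le>N. (f ^ a) $ l * Y (j + l)) = f $ j * (\<Sum>l\<le>N - j. (f ^ a) $ l * Y (j + l))"
      by simp
  qed
  also have "\<dots> = (\<Sum>j\<le>N. (f ^ Suc a) $ j * Y j)"
    unfolding fps_conv_sum by simp
  finally show ?case by (simp add: Y_def)
qed

text \<open>For odd \<open>h\<close> the derivation is a combination of the b_(-m), which makes the
  Heisenberg relation applicable to it.\<close>

lemma raise_der_Bos:
  fixes W :: "int list \<Rightarrow> 'a::field_char_0"
  assumes W: "bra_like W" and h: "\<And>n. even n \<Longrightarrow> h $ n = 0" and M: "M \<ge> nat (- sum_list u)"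
  shows "raise_der h W u = (\<Sum>m\<le>M. (- h $ m / 4) * Bos (- int m) W u)"
proof -
  have "raise_der h W u = (\<Sum>m\<le>M. h $ m * shift_der (- 1) m W u)"
    unfolding raise_der_def
  proof (rule sum.mono_neutral_left)
    show "\<forall>i\<in>{..M} - {..nat (- sum_list u)}. h $ i * shift_der (- 1) i W u = 0"
      by (auto intro!: shift_der_eq_0 bra_like_pos[OF W])
  qed (use M in auto)
  also have "\<dots> = (\<Sum>m\<le>M. (- h $ m / 4) * Bos (- int m) W u)"
  proof (intro sum.cong refl)
    fix m
    show "h $ m * shift_der (- 1) m W u = (- h $ m / 4) * Bos (- int m) W u"
      by (cases "odd m") (simp_all add: Bos_neg[OF W] h)
  qed
  finally show ?thesis .
qed

lemma raise_der_bra_like: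
  fixes W :: "int list \<Rightarrow> 'a::field_char_0"
  assumes W: "bra_like W" and h: "\<And>n. even n \<Longrightarrow> h $ n = 0"
  shows "bra_like (raise_der h W)"
proof -
  have "raise_der h W = (\<lambda>u. \<Sum>m\<in>{..nat (- sum_list u)}. (- h $ m / 4) * Bos (- int m) W u)"
    by (rule ext) (rule raise_der_Bos[OF W h], simp_all)
  then show ?thesis using Bos_bra_like[OF W] by (simp only:) (intro bra_like_sum_cong, auto)
qed

lemma raise_der_add: "raise_der h (\<lambda>v. F v + G v) u = raise_der h F u + raise_der h G u"
  by (simp add: raise_der_def shift_der_add sum.distrib distrib_left)

lemma raise_der_scale: "raise_der h (\<lambda>v. c * F v) u = c * raise_der h F u"
  by (simp add: raise_der_def shift_der_scale sum_distrib_left mult_ac)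

lemma raise_der_diff_scale: "raise_der h (\<lambda>v. F v - c * G v) u = raise_der h F u - c * raise_der h G u"
  using raise_der_add[of h F "\<lambda>v. - c * G v" u] raise_der_scale[of h "- c" G u] by simp

text \<open>The central terms: only m = n contributes, with 8 n (- h_n / 4) = -4 Y^n.\<close>

lemma Bos_raise_der:
  fixes W :: "int list \<Rightarrow> 'a::field_char_0"
  assumes W: "bra_like W" and h: "\<And>n. of_nat n * h $ n = (if odd n then 2 * Y ^ n else 0)"
    and h_nth_0: "h $ 0 = 0" and n: "odd n"
  shows "Bos (int n) (raise_der h W) u = raise_der h (Bos (int n) W) u - 4 * Y ^ n * W u"
proof -
  have he: "h $ n = 0" if "even n" for n using h[of n] h_nth_0 that by (cases "n = 0") auto
  define M where "M = nat (- sum_list u + int n) + nat (- sum_list u) + n"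
  have "Bos (int n) (raise_der h W) u = Bos (int n) (\<lambda>v. \<Sum>m\<in>{..M}. (- h $ m / 4) * Bos (- int m) W v) u"
    by (rule Bos_cong, rule raise_der_Bos[OF W he]) (simp_all add: M_def)
  also have "\<dots> = (\<Sum>m\<le>M. (- h $ m / 4) * Bos (int n) (Bos (- int m) W) u)"
    by (rule Bos_sum)
  also have "\<dots> = (\<Sum>m\<le>M. (- h $ m / 4) * Bos (- int m) (Bos (int n) W) u +
      (if m = n then - (2 * (of_nat n * h $ n)) * W u else 0))"
  proof (intro sum.cong refl)
    fix m
    show "(- h $ m / 4) * Bos (int n) (Bos (- int m) W) u = (- h $ m / 4) * Bos (- int m) (Bos (int n) W) u +
      (if m = n then - (2 * (of_nat n * h $ n)) * W u else 0)"
    proof (cases "odd m")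
      case False
      then show ?thesis using n by (auto simp: he)
    next
      case True
      then show ?thesis using Bos_comm[OF W n True, of u] by (simp add: field_simps)
    qed
  qed
  also have "\<dots> = (\<Sum>m\<le>M. (- h $ m / 4) * Bos (- int m) (Bos (int n) W) u) +
      (\<Sum>m\<le>M. if m = n then - (2 * (of_nat n * h $ n)) * W u else 0)"
    by (rule sum.distrib)
  also have "(\<Sum>m\<le>M. (- h $ m / 4) * Bos (- int m) (Bos (int n) W) u) = raise_der h (Bos (int n) W) u"
    by (rule raise_der_Bos[OF Bos_bra_like[OF W] he, symmetric]) (simp_all add: M_def)
  also have "(\<Sum>m\<le>M. if m = n then - (2 * (of_nat n * h $ n)) * W u else 0) = - (4 * Y ^ n * W u)"
    using n by (simp add: M_def h)
  also have "raise_der h (Bos (int n) W) u + - (4 * Y ^ n * W u) = raise_der h (Bos (int n) W) u - 4 * Y ^ n * W u"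
    by simp
  finally show ?thesis .
qed

lemma fact_inv_field: "fact_inv (\<lambda>k. 1 / of_nat (fact k) :: 'a::field_char_0)"
  by (simp add: fact_inv_def)

text \<open>A scalar commutator passes to the exponential: the commutator with D^k is that scalar
  times k D^(k-1), and k / k! = 1 / (k-1)!.\<close>

lemma Bos_raise_op:
  fixes W :: "int list \<Rightarrow> 'a::field_char_0"
  assumes W: "bra_like W" and n: "odd n"
  shows "Bos (int n) (raise_op (qgen Y) W) u = raise_op (qgen Y) (Bos (int n) W) u - 4 * Y ^ n * raise_op (qgen Y) W u"
proof -
  \<comment> \<open>The logarithm of \<open>qgen Y\<close>.\<close>
  define h where "h = Abs_fps (\<lambda>n. if odd n then 2 * Y ^ n / of_nat n else 0)"
  define \<iota> where "\<iota> k = (1 / of_nat (fact k) :: 'a)" for k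
  have \<iota>: "fact_inv \<iota>" unfolding \<iota>_def[abs_def] by (rule fact_inv_field)
  have h: "of_nat n * h $ n = (if odd n then 2 * Y ^ n else 0)" for n
    by (cases "n = 0") (auto simp: h_def)
  have h_nth_0: "h $ 0 = 0" by (simp add: h_def)
  have he: "h $ n = 0" if "even n" for n using that by (simp add: h_def)
  have qgen: "fps_expo \<iota> h = qgen Y"
    using fps_expo_eq_prod_qgen[OF \<iota>, of "{0::nat}" h "\<lambda>_. Y"] h h_nth_0 by simp
  have br: "bra_like ((raise_der h ^^ k) W)" for k
    by (induction k) (simp_all add: W raise_der_bra_like[OF _ he])
  have pw: "Bos (int n) ((raise_der h ^^ k) W) u =
      (raise_der h ^^ k) (Bos (int n) W) u - 4 * Y ^ n * (of_nat k * (raise_der h ^^ (k - 1)) W u)" for k u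
  proof (induction k arbitrary: u)
    case (Suc k)
    have E: "of_nat k * raise_der h ((raise_der h ^^ (k - 1)) W) u = of_nat k * (raise_der h ^^ k) W u"
      by (cases k) simp_all
    have "Bos (int n) ((raise_der h ^^ Suc k) W) u =
        raise_der h (Bos (int n) ((raise_der h ^^ k) W)) u - 4 * Y ^ n * (raise_der h ^^ k) W u"
      using Bos_raise_der[OF br h h_nth_0 n] by simp
    also have "Bos (int n) ((raise_der h ^^ k) W) =
       (\<lambda>u. (raise_der h ^^ k) (Bos (int n) W) u - 4 * Y ^ n * of_nat k * (raise_der h ^^ (k - 1)) W u)"
      by (rule ext) (simp add: Suc.IH mult.assoc)
    also have "raise_der h \<dots> u = (raise_der h ^^ Suc k) (Bos (int n) W) u
        - 4 * Y ^ n * of_nat k * raise_der h ((raise_der h ^^ (k - 1)) W) u"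
      by (simp add: raise_der_diff_scale)
    finally have "Bos (int n) ((raise_der h ^^ Suc k) W) u = (raise_der h ^^ Suc k) (Bos (int n) W) u
        - 4 * Y ^ n * (of_nat k * raise_der h ((raise_der h ^^ (k - 1)) W) u) - 4 * Y ^ n * (raise_der h ^^ k) W u"
      by (simp only: mult.assoc)
    then show ?case
      unfolding E by (simp add: algebra_simps)
  qed simp
  \<comment> \<open>Enough both for \<open>u\<close> and for the words of total lower by
    \<open>n\<close> at which \<open>Bos\<close> evaluates the exponential.\<close>
  define N where "N = nat (- sum_list u + int n) + nat (- sum_list u)"
  have "Bos (int n) (raise_op (qgen Y) W) u = Bos (int n) (\<lambda>v. \<Sum>k\<in>{..Suc N}. \<iota> k * (raise_der h ^^ k) W v) u"
    unfolding qgen[symmetric] by (rule Bos_cong, rule exp_raise_der[OF \<iota> h_nth_0, symmetric]) (simp add: N_def)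
  also have "\<dots> = (\<Sum>k\<le>Suc N. \<iota> k * (raise_der h ^^ k) (Bos (int n) W) u)
      - 4 * Y ^ n * (\<Sum>k\<le>Suc N. \<iota> k * (of_nat k * (raise_der h ^^ (k - 1)) W u))"
    unfolding Bos_sum pw by (simp only: right_diff_distrib sum_subtractf sum_distrib_left mult_ac)
  also have "(\<Sum>k\<le>Suc N. \<iota> k * (of_nat k * (raise_der h ^^ (k - 1)) W u)) =
      (\<Sum>k\<le>N. \<iota> (Suc k) * of_nat (Suc k) * (raise_der h ^^ k) W u)"
    by (subst sum.atMost_Suc_shift) (simp add: mult.assoc)
  also have "\<dots> = raise_op (qgen Y) W u"
    unfolding fact_inv_Suc[OF \<iota>] qgen[symmetric] by (rule exp_raise_der[OF \<iota> h_nth_0]) (simp add: N_def)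
  also have "(\<Sum>k\<le>Suc N. \<iota> k * (raise_der h ^^ k) (Bos (int n) W) u) = raise_op (qgen Y) (Bos (int n) W) u"
    unfolding qgen[symmetric] by (rule exp_raise_der[OF \<iota> h_nth_0]) (simp add: N_def)
  finally show ?thesis .
qed

lemma qgen_involution: "qgen Y * fps_scale (- 1) (qgen Y) = 1"
  by (rule qgen_uminus')

lemma Bos_raise_op_pow:
  fixes W :: "int list \<Rightarrow> 'a::field_char_0"
  assumes W: "bra_like W" and n: "odd n"
  shows "Bos (int n) ((raise_op (qgen Y) ^^ a) W) u =
    (raise_op (qgen Y) ^^ a) (Bos (int n) W) u - 4 * of_nat a * Y ^ n * (raise_op (qgen Y) ^^ a) W u"
proof (induction a arbitrary: u)
  case (Suc a)
  have "Bos (int n) ((raise_op (qgen Y) ^^ Suc a) W) u =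
     raise_op (qgen Y) (Bos (int n) ((raise_op (qgen Y) ^^ a) W)) u - 4 * Y ^ n * (raise_op (qgen Y) ^^ Suc a) W u"
    using Bos_raise_op[OF raise_op_pow_bra_like[OF W qgen_involution] n] by simp
  also have "Bos (int n) ((raise_op (qgen Y) ^^ a) W) =
     (\<lambda>u. (raise_op (qgen Y) ^^ a) (Bos (int n) W) u - 4 * of_nat a * Y ^ n * (raise_op (qgen Y) ^^ a) W u)"
    by (rule ext) (simp add: Suc.IH)
  finally show ?case
    unfolding raise_op_diff_scale by (simp add: algebra_simps)
qed simp

section \<open>Products of fermions\<close>

text \<open>A combination of the fermions phi_m with m \<ge> 0, the only ones in the kets of the
  theorem. A larger m makes the total positive, where \<open>bra_like\<close> functionals
  vanish.\<close>

definition letter_op :: "'a::comm_ring_1 fps \<Rightarrow> (int list \<Rightarrow> 'a) \<Rightarrow> int list \<Rightarrow> 'a" where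
  "letter_op C W u = (\<Sum>m\<le>nat (- sum_list u). C $ m * W (u @ [int m]))"

fun word_sum :: "nat \<Rightarrow> 'a::comm_ring_1 fps list \<Rightarrow> (int list \<Rightarrow> 'a) \<Rightarrow> 'a" where
  "word_sum N [] \<Phi> = \<Phi> []"
| "word_sum N (C # Cs) \<Phi> = (\<Sum>m\<le>N. C $ m * word_sum N Cs (\<lambda>w. \<Phi> (int m # w)))"

text \<open>On their way to the left, the exponential of a letter and those of all later letters
  pass it, each leaving a factor \<open>f\<close>.\<close>

fun twisted_letters :: "'a::comm_ring_1 fps \<Rightarrow> 'a fps list \<Rightarrow> 'a fps list" where
  "twisted_letters f [] = []"
| "twisted_letters f (C # Cs) = (C * f ^ Suc (length Cs)) # twisted_letters f Cs"

lemma word_sum_sum: "word_sum N Cs (\<lambda>w. \<Sum>i\<in>I. F i w) = (\<Sum>i\<in>I. word_sum N Cs (F i))"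
proof (induction Cs arbitrary: F)
  case (Cons C Cs)
  show ?case by (simp add: Cons.IH sum_distrib_left sum.swap[of _ I])
qed simp

lemma word_sum_scale: "word_sum N Cs (\<lambda>w. c * F w) = c * word_sum N Cs F"
  by (induction Cs arbitrary: F) (simp_all add: sum_distrib_left mult_ac)

lemma word_sum_cong:
  assumes "\<And>w. length w = length Cs \<Longrightarrow> (\<forall>m\<in>set w. m \<ge> 0) \<Longrightarrow> \<Phi> w = \<Psi> w"
  shows "word_sum N Cs \<Phi> = word_sum N Cs \<Psi>"
  using assms
proof (induction Cs arbitrary: \<Phi> \<Psi>)
  case (Cons C Cs)
  show ?case unfolding word_sum.simps
    by (intro sum.cong refl arg_cong2[where f = times] Cons.IH Cons.prems) auto
qed simp

lemma word_sum_Cons: "word_sum N (C # Cs) \<Phi> = word_sum N Cs (\<lambda>w. \<Sum>m\<le>N. C $ m * \<Phi> (int m # w))"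
  by (simp add: word_sum_sum word_sum_scale)

lemma raise_op_word_sum:
  "raise_op f (\<lambda>v. word_sum N Cs (\<lambda>w. F w v)) u = word_sum N Cs (\<lambda>w. raise_op f (F w) u)"
  by (induction Cs arbitrary: F) (simp_all add: raise_op_sum)

lemma length_twisted_letters [simp]: "length (twisted_letters f Cs) = length Cs"
  by (induction f Cs rule: twisted_letters.induct) simp_all

definition chain :: "'a::comm_ring_1 fps \<Rightarrow> 'a fps list \<Rightarrow> (int list \<Rightarrow> 'a) \<Rightarrow> int list \<Rightarrow> 'a" where
  "chain f Cs V = foldr (\<lambda>C W. letter_op C (raise_op f W)) Cs V"

text \<open>All exponentials are moved to the left.\<close>

lemma chain_eq_word_sum:
  assumes V: "bra_like V" and f: "f * fps_scale (- 1) f = 1" and N: "N \<ge> nat (- sum_list u)"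
  shows "chain f Cs V u =
    word_sum N (twisted_letters f Cs) (\<lambda>w. (raise_op f ^^ length Cs) (\<lambda>v. V (v @ w)) u)"
  using N
proof (induction Cs arbitrary: u)
  case (Cons C Cs)
  define r where "r = length Cs"
  define \<Phi> where "\<Phi> w = (raise_op f ^^ Suc r) (\<lambda>v. V (v @ w)) u" for w
  have \<Phi>0: "\<Phi> (int k # w) = 0" if "k > nat (- sum_list u)" "\<forall>m\<in>set w. m \<ge> 0" for k w
    unfolding \<Phi>_def using that sum_list_nonneg[of w] by (intro raise_op_pow_append_eq_0[OF V]) auto
  have S: "raise_op f (chain f Cs V) (u @ [int m]) =
      word_sum N (twisted_letters f Cs) (\<lambda>w. \<Sum>j\<le>N. (f ^ Suc r) $ j * \<Phi> (int (m + j) # w))" for m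
  proof -
    have "raise_op f (chain f Cs V) (u @ [int m]) =
        raise_op f (\<lambda>u. word_sum N (twisted_letters f Cs) (\<lambda>w. (raise_op f ^^ r) (\<lambda>v. V (v @ w)) u)) (u @ [int m])"
      unfolding r_def by (rule raise_op_cong, rule Cons.IH) (use Cons.prems in auto)
    also have "\<dots> = word_sum N (twisted_letters f Cs) (\<lambda>w. (raise_op f ^^ Suc r) (\<lambda>v. V (v @ w)) (u @ [int m]))"
      by (simp add: raise_op_word_sum)
    also have "\<dots> = word_sum N (twisted_letters f Cs) (\<lambda>w. \<Sum>j\<le>N. (f ^ Suc r) $ j * \<Phi> (int (m + j) # w))"
    proof (rule word_sum_cong)
      fix w
      show "(raise_op f ^^ Suc r) (\<lambda>v. V (v @ w)) (u @ [int m]) = (\<Sum>j\<le>N. (f ^ Suc r) $ j * \<Phi> (int (m + j) # w))"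
        using raise_op_pow_snoc[OF bra_like_append[OF V] f, of u "int m" N "Suc r" w] Cons.prems
        by (simp add: \<Phi>_def)
    qed
    finally show ?thesis .
  qed
  have "chain f (C # Cs) V u = (\<Sum>m\<le>nat (- sum_list u). C $ m * raise_op f (chain f Cs V) (u @ [int m]))"
    by (simp add: chain_def letter_op_def)
  also have "\<dots> = word_sum N (twisted_letters f Cs) (\<lambda>w. \<Sum>m\<le>nat (- sum_list u). C $ m *
      (\<Sum>j\<le>N. (f ^ Suc r) $ j * \<Phi> (int (m + j) # w)))"
    unfolding S by (simp add: word_sum_sum word_sum_scale)
  also have "\<dots> = word_sum N (twisted_letters f Cs) (\<lambda>w. \<Sum>k\<le>N. (C * f ^ Suc r) $ k * \<Phi> (int k # w))"
  proof (rule word_sum_cong)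
    fix w :: "int list" assume "\<forall>m\<in>set w. m \<ge> 0"
    note 0 = \<Phi>0[OF _ this]
    have "(\<Sum>m\<le>nat (- sum_list u). C $ m * (\<Sum>j\<le>N. (f ^ Suc r) $ j * \<Phi> (int (m + j) # w))) =
      (\<Sum>m\<le>N. C $ m * (\<Sum>j\<le>N. (f ^ Suc r) $ j * \<Phi> (int (m + j) # w)))"
      using Cons.prems 0[of "_ + _"] by (intro sum.mono_neutral_left) (auto intro!: sum.neutral)
    also have "\<dots> = (\<Sum>m\<le>N. C $ m * (\<Sum>j\<le>N - m. (f ^ Suc r) $ j * \<Phi> (int (m + j) # w)))"
    proof (rule sum.cong[OF refl])
      fix m
      have "\<Phi> (int (m + j) # w) = 0" if "j \<notin> {..N - m}" for j
        using that Cons.prems by (intro 0) auto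
      then have "(\<Sum>j\<le>N. (f ^ Suc r) $ j * \<Phi> (int (m + j) # w)) = (\<Sum>j\<le>N - m. (f ^ Suc r) $ j * \<Phi> (int (m + j) # w))"
        by (intro sum.mono_neutral_right) auto
      then show "C $ m * (\<Sum>j\<le>N. (f ^ Suc r) $ j * \<Phi> (int (m + j) # w)) =
          C $ m * (\<Sum>j\<le>N - m. (f ^ Suc r) $ j * \<Phi> (int (m + j) # w))"
        by simp
    qed
    also have "\<dots> = (\<Sum>k\<le>N. (C * f ^ Suc r) $ k * \<Phi> (int k # w))"
      by (rule fps_conv_sum)
    finally show "(\<Sum>m\<le>nat (- sum_list u). C $ m * (\<Sum>j\<le>N. (f ^ Suc r) $ j * \<Phi> (int (m + j) # w))) =
      (\<Sum>k\<le>N. (C * f ^ Suc r) $ k * \<Phi> (int k # w))" .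
  qed
  also have "\<dots> = word_sum N (twisted_letters f (C # Cs)) \<Phi>"
    unfolding twisted_letters.simps word_sum_Cons r_def ..
  finally show ?case by (simp add: \<Phi>_def[abs_def] r_def)
qed (simp add: chain_def)

section \<open>Uniqueness of the vacuum expectation value\<close>

text \<open>Contracted words are shorter by two, so by induction letters simply anticommute: a
  positive one is moved to the front, a negative one to the end, and among zeros phi_0 phi_0 = 1
  applies. For odd length the value at a single zero letter would remain undetermined.\<close>

lemma clifford_even_eq_0:
  fixes Z :: "int list \<Rightarrow> 'a::{idom,ring_char_0}"
  assumes Z: "clifford Z" and left: "\<And>m w. m > 0 \<Longrightarrow> Z (m # w) = 0"
    and right: "\<And>m w. m < 0 \<Longrightarrow> Z (w @ [m]) = 0" and Nil: "Z [] = 0"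
  shows "even (length w) \<Longrightarrow> Z w = 0"
proof (induction "length w" arbitrary: w rule: less_induct)
  case less
  have swap: "Z (a @ p # q # b) = - Z (a @ q # p # b)"
    if "length (a @ p # q # b) = length w" for a p q b
  proof -
    have "length w = length (a @ b) + 2" using that by simp
    with less.prems have "even (length (a @ b))" by simp
    then have "Z (a @ b) = 0" using that by (intro less.hyps) auto
    then show ?thesis using cliffordD[OF Z, of a p q b] by (auto simp: eq_neg_iff_add_eq_0)
  qed
  have pos: "Z (a @ p # b) = 0" if "p > 0" "length (a @ p # b) = length w" for a p b
    using that(2)
  proof (induction a arbitrary: b rule: rev_induct)
    case Nil
    then show ?case using left[OF that(1)] by simp
  next
    case (snoc x a)
    then show ?case using swap[of a x p b] snoc.IH[of "x # b"] by simp
  qed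
  have neg: "Z (a @ p # b) = 0" if "p < 0" "length (a @ p # b) = length w" for a p b
    using that(2)
  proof (induction b arbitrary: a)
    case Nil
    then show ?case using right[OF that(1)] by simp
  next
    case (Cons x b)
    then show ?case using swap[of a p x b] Cons.IH[of "a @ [x]"] by simp
  qed
  consider "w = []" | x where "x \<in> set w" "x > 0" | x where "x \<in> set w" "x < 0" | "w \<noteq> []" "\<forall>x\<in>set w. x = 0"
    by (metis linorder_neqE)
  then show ?case
  proof cases
    case 1
    with Nil show ?thesis by simp
  next
    case 2
    then show ?thesis using pos by (metis split_list)
  next
    case 3
    then show ?thesis using neg by (metis split_list)
  next
    case 4
    with less.prems obtain v where w: "w = 0 # 0 # v"
      by (cases w; cases "tl w") auto
    have "Z v = 0" using less.prems by (intro less.hyps) (auto simp: w)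
    then show ?thesis using cliffordD[OF Z, of "[]" 0 0 v] by (simp add: w sg_def)
  qed
qed

lemma vacuum_unique:
  fixes V :: "int list \<Rightarrow> 'a::{idom,ring_char_0}"
  assumes V: "bra_like V" and kill: "\<And>w m. m < 0 \<Longrightarrow> V (w @ [m]) = 0" and "V [] = 1" "even (length w)"
  shows "V w = vev w"
proof -
  have "clifford (\<lambda>w. V w - vev w)"
  proof (rule cliffordI)
    fix a b :: "int list" and p q :: int
    have "V (a @ p # q # b) - vev (a @ p # q # b) + (V (a @ q # p # b) - vev (a @ q # p # b)) =
        (V (a @ p # q # b) + V (a @ q # p # b)) - (vev (a @ p # q # b) + vev (a @ q # p # b))"
      by simp
    then show "V (a @ p # q # b) - vev (a @ p # q # b) + (V (a @ q # p # b) - vev (a @ q # p # b)) =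
        (if p + q = 0 then 2 * sg p * (V (a @ b) - vev (a @ b)) else 0)"
      unfolding cliffordD[OF bra_like_clifford[OF V]] cliffordD[OF vev_clifford]
      by (cases "p + q = 0") (simp_all add: right_diff_distrib)
  qed
  then have "V w - vev w = 0"
    by (rule clifford_even_eq_0) (use assms in \<open>auto simp: bra_like_def vev_pos vev_snoc_neg\<close>)
  then show ?thesis by simp
qed

instance fps :: (ring_char_0) ring_char_0 ..

lemma fps_const_sg: "fps_const (sg p) = sg p"
  by (auto simp: sg_def simp flip: fps_const_neg)

text \<open>\<open>vev\<close> is defined over every ring, and the amplitudes take values in power
  series. Uniqueness shows that the two versions agree.\<close>

lemma fps_const_vev:
  assumes "even (length w)"
  shows "fps_const (vev w :: 'a::{idom,ring_char_0}) = vev w"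
proof (rule vacuum_unique[where V = "\<lambda>w. fps_const (vev w :: 'a)"])
  show "bra_like (\<lambda>w. fps_const (vev w :: 'a))"
    unfolding bra_like_def
  proof (intro conjI allI impI cliffordI)
    fix a b :: "int list" and p q :: int
    have "fps_const (vev (a @ p # q # b) + vev (a @ q # p # b)) =
        fps_const (if p + q = 0 then 2 * sg p * vev (a @ b) else (0 :: 'a))"
      by (simp only: cliffordD[OF vev_clifford])
    then show "fps_const (vev (a @ p # q # b)) + fps_const (vev (a @ q # p # b)) =
        (if p + q = 0 then 2 * sg p * fps_const (vev (a @ b)) else (0 :: 'a fps))"
      by (auto simp: numeral_fps_const fps_const_sg[symmetric] split: if_splits)
  qed (simp add: vev_pos)
qed (use assms in \<open>simp_all add: vev_snoc_neg\<close>)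

section \<open>Infinite sums of power series of increasing order\<close>

text \<open>An explicit order bound in place of a limit: coefficient \<open>d\<close> of the sum
  sees only the terms up to \<open>d\<close>, so rearrangements become identities between finite
  sums.\<close>

definition tame :: "(nat \<Rightarrow> 'a::comm_ring_1 fps) \<Rightarrow> bool" where
  "tame x \<longleftrightarrow> (\<forall>n d. d < n \<longrightarrow> x n $ d = 0)"

definition isum :: "(nat \<Rightarrow> 'a::comm_ring_1 fps) \<Rightarrow> 'a fps" where
  "isum x = Abs_fps (\<lambda>d. \<Sum>n\<le>d. x n $ d)"

lemma isum_nth: "isum x $ d = (\<Sum>n\<le>d. x n $ d)"
  by (simp add: isum_def)

lemma tameD: "tame x \<Longrightarrow> d < n \<Longrightarrow> x n $ d = 0"
  by (simp add: tame_def)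

lemma isum_nth_superset: "tame x \<Longrightarrow> N \<ge> d \<Longrightarrow> isum x $ d = (\<Sum>n\<le>N. x n $ d)"
  unfolding isum_nth by (rule sum.mono_neutral_left) (auto simp: tameD)

lemma tame_mult: "tame x \<Longrightarrow> tame (\<lambda>n. x n * y n)"
  unfolding tame_def fps_mult_nth by (auto intro!: sum.neutral)

lemma tame_mult_left: "tame x \<Longrightarrow> tame (\<lambda>n. y n * x n)"
  using tame_mult[of x y] by (simp add: mult.commute)

lemma tame_power: "X $ 0 = 0 \<Longrightarrow> tame (\<lambda>n. X ^ n)"
  by (simp add: tame_def fps_pow_nth_eq_0)

lemma isum_add: "isum (\<lambda>n. x n + y n) = isum x + isum y"
  by (rule fps_ext) (simp add: isum_nth sum.distrib)

lemma isum_sum: "isum (\<lambda>n. \<Sum>i\<in>I. x i n) = (\<Sum>i\<in>I. isum (x i))"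
  by (rule fps_ext) (simp add: isum_nth fps_sum_nth sum.swap[of _ I])

lemma isum_finite:
  assumes "tame x" "\<And>n. n > N \<Longrightarrow> x n = 0"
  shows "isum x = (\<Sum>n\<le>N. x n)"
proof (rule fps_ext)
  fix d
  have "isum x $ d = (\<Sum>n\<le>d + N. x n $ d)" by (rule isum_nth_superset[OF assms(1)]) simp
  also have "\<dots> = (\<Sum>n\<le>N. x n $ d)"
    by (rule sum.mono_neutral_right) (auto simp: assms(2))
  finally show "isum x $ d = (\<Sum>n\<le>N. x n) $ d" by (simp add: fps_sum_nth)
qed

lemma isum_cauchy:
  assumes x: "tame x" and y: "tame y"
  shows "isum (\<lambda>k. \<Sum>p\<le>k. x p * y (k - p)) = isum x * isum y"
proof (rule fps_ext)
  fix d
  have 0: "(x i * y j) $ d = 0" if "i + j > d" for i j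
    unfolding fps_mult_nth
  proof (intro sum.neutral ballI)
    fix e assume "e \<in> {0..d}"
    then have "e < i \<or> d - e < j" using that by auto
    then show "x i $ e * y j $ (d - e) = 0" using tameD[OF x] tameD[OF y] by auto
  qed
  have "isum (\<lambda>k. \<Sum>p\<le>k. x p * y (k - p)) $ d = (\<Sum>(i, j)\<in>{(i, j). i + j \<le> d}. (x i * y j) $ d)"
    unfolding isum_nth fps_sum_nth sum.Sigma[OF finite_atMost ballI[OF finite_atMost]]
    by (rule sum.reindex_bij_witness[of _ "\<lambda>(p, i). (p + i, p)" "\<lambda>(k, p). (p, k - p)"]) auto
  also have "\<dots> = (\<Sum>(i, j)\<in>{..d} \<times> {..d}. (x i * y j) $ d)"
    by (rule sum.mono_neutral_left) (auto intro: 0)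
  also have "\<dots> = (\<Sum>i\<le>d. \<Sum>j\<le>d. \<Sum>e\<le>d. x i $ e * y j $ (d - e))"
    by (subst sum.cartesian_product[symmetric]) (simp add: fps_mult_nth atLeast0AtMost)
  also have "\<dots> = (\<Sum>i\<le>d. \<Sum>e\<le>d. \<Sum>j\<le>d. x i $ e * y j $ (d - e))"
    by (intro sum.cong refl sum.swap)
  also have "\<dots> = (\<Sum>e\<le>d. \<Sum>i\<le>d. \<Sum>j\<le>d. x i $ e * y j $ (d - e))"
    by (rule sum.swap)
  also have "\<dots> = (\<Sum>e\<le>d. (\<Sum>i\<le>d. x i $ e) * (\<Sum>j\<le>d. y j $ (d - e)))"
    by (simp add: sum_product)
  also have "\<dots> = (\<Sum>e\<le>d. isum x $ e * isum y $ (d - e))"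
    by (intro sum.cong refl arg_cong2[where f = times] isum_nth_superset[symmetric] x y) auto
  finally show "isum (\<lambda>k. \<Sum>p\<le>k. x p * y (k - p)) $ d = (isum x * isum y) $ d"
    by (simp add: fps_mult_nth atLeast0AtMost)
qed

lemma isum_mult:
  assumes x: "tame x"
  shows "isum (\<lambda>n. x n * c) = isum x * c"
proof -
  define y where "y n = (if n = 0 then c else 0)" for n :: nat
  have y: "tame y" by (simp add: tame_def y_def)
  have "x n * c = (\<Sum>p\<le>n. x p * y (n - p))" for n
  proof -
    have "(\<Sum>p\<le>n. x p * y (n - p)) = (\<Sum>p\<in>{n}. x p * y (n - p))"
      by (rule sum.mono_neutral_right) (auto simp: y_def)
    then show ?thesis by (simp add: y_def)
  qed
  then have "isum (\<lambda>n. x n * c) = isum x * isum y" using isum_cauchy[OF x y] by simp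
  also have "isum y = c" using isum_finite[OF y, of 0] by (simp add: y_def)
  finally show ?thesis .
qed

lemma isum_mult_left: "tame x \<Longrightarrow> isum (\<lambda>n. c * x n) = c * isum x"
  using isum_mult[of x c] by (simp add: mult.commute)

lemma isum_compose: "isum (\<lambda>m. fps_const (C $ m) * X ^ m) = fps_compose C X"
  by (rule fps_ext) (simp add: isum_nth fps_compose_nth atLeast0AtMost)

section \<open>Evaluation of power series at a constant\<close>

text \<open>The outer variable is the letter variable z, the inner one is t. Substituting
  \<open>y\<close> for z makes sense when the coefficient of z^n is divisible by t^n.\<close>

definition ev_at :: "'a::comm_ring_1 \<Rightarrow> 'a fps fps \<Rightarrow> 'a fps" where
  "ev_at y F = isum (\<lambda>n. F $ n * fps_const (y ^ n))"

lemma ev_at_mult: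
  assumes F: "tame (fps_nth F)" and G: "tame (fps_nth G)"
  shows "ev_at y (F * G) = ev_at y F * ev_at y G"
proof -
  have "(F * G) $ n * fps_const (y ^ n) =
     (\<Sum>p\<le>n. (F $ p * fps_const (y ^ p)) * (G $ (n - p) * fps_const (y ^ (n - p))))" for n
  proof -
    have "a * b * fps_const (y ^ n) = (a * fps_const (y ^ p)) * (b * fps_const (y ^ (n - p)))" if "p \<le> n" for a b p
    proof -
      have "fps_const (y ^ n) = fps_const (y ^ p) * fps_const (y ^ (n - p))"
        using that by (simp flip: power_add)
      then show ?thesis by (simp add: mult_ac)
    qed
    then show ?thesis by (simp add: fps_mult_nth atLeast0AtMost sum_distrib_right)
  qed
  then show ?thesis
    unfolding ev_at_def
    using isum_cauchy[OF tame_mult[OF F, of "\<lambda>n. fps_const (y ^ n)"] tame_mult[OF G, of "\<lambda>n. fps_const (y ^ n)"]]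
    by simp
qed

lemma tame_fps_mult:
  assumes F: "tame (fps_nth F)" and G: "tame (fps_nth G)"
  shows "tame (fps_nth (F * G))"
  unfolding tame_def
proof (intro allI impI)
  fix n d :: nat assume d: "d < n"
  have "(F $ i * G $ (n - i)) $ d = 0" if "i \<le> n" for i
    unfolding fps_mult_nth
  proof (intro sum.neutral ballI)
    fix e assume "e \<in> {0..d}"
    then have "e < i \<or> d - e < n - i" using that d by auto
    then show "F $ i $ e * G $ (n - i) $ (d - e) = 0" using tameD[OF F] tameD[OF G] by auto
  qed
  then show "(F * G) $ n $ d = 0" by (simp add: fps_mult_nth[of F G] fps_sum_nth)
qed

lemma tame_one: "tame (fps_nth (1 :: 'a::comm_ring_1 fps fps))"
  by (simp add: tame_def)

lemma ev_at_one: "ev_at y 1 = 1"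
  unfolding ev_at_def
  by (subst isum_finite[where N = 0]) (auto simp: tame_def)

lemma tame_fps_power: "tame (fps_nth F) \<Longrightarrow> tame (fps_nth (F ^ n))"
  by (induction n) (simp_all add: tame_one tame_fps_mult)

lemma ev_at_power: "tame (fps_nth F) \<Longrightarrow> ev_at y (F ^ n) = ev_at y F ^ n"
  by (induction n) (simp_all add: ev_at_one ev_at_mult tame_fps_power)

lemma tame_fps_prod: "(\<And>i. i \<in> I \<Longrightarrow> tame (fps_nth (F i))) \<Longrightarrow> tame (fps_nth (\<Prod>i\<in>I. F i))"
  by (induction I rule: infinite_finite_induct) (simp_all add: tame_one tame_fps_mult)

lemma ev_at_prod: "(\<And>i. i \<in> I \<Longrightarrow> tame (fps_nth (F i))) \<Longrightarrow> ev_at y (\<Prod>i\<in>I. F i) = (\<Prod>i\<in>I. ev_at y (F i))"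
  by (induction I rule: infinite_finite_induct) (simp_all add: ev_at_one ev_at_mult tame_fps_prod)

lemma tame_qgen: "X $ 0 = 0 \<Longrightarrow> tame (fps_nth (qgen X))"
  by (auto simp: tame_def qgen_nth fps_pow_nth_eq_0 numeral_fps_const)

lemma ev_at_qgen:
  assumes "X $ 0 = 0"
  shows "(1 - fps_const y * X) * ev_at y (qgen X) = 1 + fps_const y * X"
proof -
  have F: "tame (fps_nth (1 - fps_const X * fps_X))" "tame (fps_nth (1 + fps_const X * fps_X))"
    using assms by (auto simp: tame_def fps_X_def)
  have e: "ev_at y (1 - fps_const X * fps_X) = 1 - fps_const y * X" "ev_at y (1 + fps_const X * fps_X) = 1 + fps_const y * X"
    unfolding ev_at_def by (subst isum_finite[where N = 1, OF tame_mult[OF F(1)]] isum_finite[where N = 1, OF tame_mult[OF F(2)]];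
      simp add: fps_X_def mult.commute)+
  have "ev_at y ((1 - fps_const X * fps_X) * qgen X) = ev_at y (1 + fps_const X * fps_X)"
    by (simp only: qgen_mult)
  then show ?thesis unfolding ev_at_mult[OF F(1) tame_qgen[OF assms]] e .
qed

definition expi :: "'a::field_char_0 fps \<Rightarrow> 'a fps" where
  "expi c = isum (\<lambda>p. fps_const (1 / of_nat (fact p)) * c ^ p)"

lemma expi_exp: "expi c = fps_compose (fps_exp 1) c"
  using isum_compose[of "fps_exp 1" c] by (simp add: expi_def)

lemma expi_of_nat:
  assumes "c $ 0 = 0"
  shows "expi (of_nat r * c) = expi c ^ r"
proof -
  have "expi (of_nat r * c) = fps_compose (fps_exp (of_nat r)) c"
    unfolding expi_exp
    by (rule fps_ext) (simp add: fps_compose_nth power_mult_distrib fps_of_nat[symmetric])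
  also have "fps_exp (of_nat r) = (fps_exp 1 :: 'a fps) ^ r"
    by (simp add: fps_exp_power_mult)
  also have "fps_compose ((fps_exp 1 :: 'a fps) ^ r) c = expi c ^ r"
    using assms by (simp add: expi_exp fps_compose_power)
  finally show ?thesis .
qed

lemma fact_inv_fps: "fact_inv (\<lambda>k. fps_const (1 / of_nat (fact k)) :: 'a::field_char_0 fps)"
  by (simp add: fact_inv_def fps_of_nat[symmetric] del: of_nat_fact)

text \<open>Evaluation is multiplicative on tame series and therefore commutes with the
  exponential.\<close>

lemma expi_ev_at:
  fixes h :: "'a::field_char_0 fps fps"
  assumes h: "tame (fps_nth h)" "h $ 0 = 0"
  shows "expi (ev_at y h) = ev_at y (fps_expo (\<lambda>k. fps_const (1 / of_nat (fact k))) h)"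
proof (rule fps_ext)
  fix d
  have pw: "(ev_at y h ^ p) $ d = (\<Sum>n\<le>d. (h ^ p) $ n $ d * y ^ n)" for p
    by (subst ev_at_power[OF h(1), symmetric]) (simp add: ev_at_def isum_nth)
  have "expi (ev_at y h) $ d = (\<Sum>p\<le>d. \<Sum>n\<le>d. 1 / of_nat (fact p) * ((h ^ p) $ n $ d * y ^ n))"
    by (simp add: expi_def isum_nth pw sum_distrib_left sum_divide_distrib)
  also have "\<dots> = (\<Sum>n\<le>d. \<Sum>p\<le>d. 1 / of_nat (fact p) * ((h ^ p) $ n $ d * y ^ n))"
    by (rule sum.swap)
  also have "\<dots> = (\<Sum>n\<le>d. \<Sum>p\<le>n. 1 / of_nat (fact p) * ((h ^ p) $ n $ d * y ^ n))"
    by (intro sum.cong refl sum.mono_neutral_right) (auto simp: fps_pow_nth_eq_0[OF h(2)])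
  also have "\<dots> = ev_at y (fps_expo (\<lambda>k. fps_const (1 / of_nat (fact k))) h) $ d"
    by (simp add: ev_at_def isum_nth fps_expo_def fps_sum_nth sum_distrib_right mult.assoc)
  finally show "expi (ev_at y h) $ d = ev_at y (fps_expo (\<lambda>k. fps_const (1 / of_nat (fact k))) h) $ d" .
qed

section \<open>The Hamiltonian\<close>

lemma Bos_sum_plain: "Bos n (\<lambda>u. \<Sum>i\<in>I. F i u) u = (\<Sum>i\<in>I. Bos n (F i) u)"
  using Bos_sum[where c = "\<lambda>_. 1"] by simp

text \<open>\<open>ham h k d W u\<close> is the coefficient of \<open>t\<^sup>d\<close> in \<open>(H\<^sup>k W)(u)\<close>, where \<open>H = \<Sum>\<^sub>n h\<^sub>n b\<^sub>n\<close> and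
  \<open>h\<^sub>n\<close> is a power series in \<open>t\<close>.\<close>

fun ham :: "'a::field_char_0 fps fps \<Rightarrow> nat \<Rightarrow> nat \<Rightarrow> (int list \<Rightarrow> 'a) \<Rightarrow> int list \<Rightarrow> 'a" where
  "ham h 0 d W u = (if d = 0 then W u else 0)"
| "ham h (Suc k) d W u = (\<Sum>e\<le>d. \<Sum>n\<le>e. h $ n $ e / 4 * Bos (int n) (ham h k (d - e) W) u)"

lemma ham_add: "ham h k d (\<lambda>u. F u + G u) = (\<lambda>u. ham h k d F u + ham h k d G u)"
proof (induction k arbitrary: d)
  case (Suc k)
  show ?case by (rule ext) (simp add: Suc.IH Bos_add distrib_left sum.distrib)
qed auto

lemma ham_scale: "ham h k d (\<lambda>u. c * F u) = (\<lambda>u. c * ham h k d F u)"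
proof (induction k arbitrary: d)
  case (Suc k)
  show ?case by (rule ext) (simp add: Suc.IH Bos_scale sum_distrib_left mult_ac)
qed auto

lemma ham_zero: "ham h k d (\<lambda>u. 0) u = 0"
  using ham_scale[of h k d 0 "\<lambda>_. 0"] by (simp add: fun_eq_iff)

lemma ham_sum: "ham h k d (\<lambda>u. \<Sum>i\<in>I. F i u) u = (\<Sum>i\<in>I. ham h k d (F i) u)"
  by (induction I rule: infinite_finite_induct) (simp_all add: ham_zero ham_add)

lemma ham_shift_der: "ham h k d (\<lambda>u. shift_der s n (\<lambda>w. F w u) w) u = shift_der s n (\<lambda>w. ham h k d (F w) u) w"
  by (induction w arbitrary: F) (simp_all add: ham_zero ham_add)

lemma ham_word_sum: "ham h k d (\<lambda>u. word_sum N Cs (\<lambda>w. F w u)) u = word_sum N Cs (\<lambda>w. ham h k d (F w) u)"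
  by (induction Cs arbitrary: F) (simp_all add: ham_sum ham_scale)

text \<open>The part of a power of H with coefficient t^d lowers the total of a word by at most
  \<open>d\<close>.\<close>

lemma ham_cong:
  assumes "\<And>v. sum_list v \<ge> sum_list u - int d \<Longrightarrow> W v = W' v"
  shows "ham h k d W u = ham h k d W' u"
  using assms
proof (induction k arbitrary: d u)
  case (Suc k)
  show ?case unfolding ham.simps
  proof (intro sum.cong refl arg_cong2[where f = times] Bos_cong)
    fix e n and v :: "int list"
    assume en: "e \<in> {..d}" "n \<in> {..e}" "sum_list v = sum_list u - int n"
    show "ham h k (d - e) W v = ham h k (d - e) W' v"
      by (rule Suc.IH, rule Suc.prems) (use en in auto)
  qed
qed auto

text \<open>The factor H nearest to the functional is peeled off instead of the outermost one,
  because the action of the bosons is known explicitly there.\<close>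

lemma ham_Suc_inner:
  "ham h (Suc k) d W u = (\<Sum>e\<le>d. \<Sum>n\<le>e. h $ n $ e / 4 * ham h k (d - e) (Bos (int n) W) u)"
proof (induction k arbitrary: d u)
  case 0
  have "Bos (int n) (ham h 0 d W) u = ham h 0 d (Bos (int n) W) u" for n d
    by (cases "d = 0") (simp_all add: Bos_def)
  then show ?case by (simp only: ham.simps(2))
next
  case (Suc k)
  define g where "g e e' = (\<Sum>n\<le>e. \<Sum>n'\<le>e'. h $ n $ e / 4 * (h $ n' $ e' / 4 *
      Bos (int n) (ham h k (d - e - e') (Bos (int n') W)) u))" for e e'
  have IH: "ham h (Suc k) d W = (\<lambda>u. \<Sum>e\<le>d. \<Sum>n\<le>e. h $ n $ e / 4 * ham h k (d - e) (Bos (int n) W) u)" for d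
    by (rule ext) (rule Suc.IH)
  have "ham h (Suc (Suc k)) d W u = (\<Sum>e\<le>d. \<Sum>n\<le>e. h $ n $ e / 4 * (\<Sum>e'\<le>d - e. \<Sum>n'\<le>e'. h $ n' $ e' / 4 *
      Bos (int n) (ham h k (d - e - e') (Bos (int n') W)) u))"
    unfolding ham.simps(2)[of h "Suc k"] IH
    by (simp only: Bos_sum_plain Bos_scale)
  also have "\<dots> = (\<Sum>e\<le>d. \<Sum>e'\<le>d - e. g e e')"
  proof (rule sum.cong[OF refl])
    fix e
    have "(\<Sum>n\<le>e. h $ n $ e / 4 * (\<Sum>e'\<le>d - e. \<Sum>n'\<le>e'. h $ n' $ e' / 4 *
      Bos (int n) (ham h k (d - e - e') (Bos (int n') W)) u)) =
      (\<Sum>n\<le>e. \<Sum>e'\<le>d - e. \<Sum>n'\<le>e'. h $ n $ e / 4 * (h $ n' $ e' / 4 *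
      Bos (int n) (ham h k (d - e - e') (Bos (int n') W)) u))"
      by (simp only: sum_distrib_left)
    also have "\<dots> = (\<Sum>e'\<le>d - e. g e e')"
      unfolding g_def by (rule sum.swap)
    finally show "(\<Sum>n\<le>e. h $ n $ e / 4 * (\<Sum>e'\<le>d - e. \<Sum>n'\<le>e'. h $ n' $ e' / 4 *
      Bos (int n) (ham h k (d - e - e') (Bos (int n') W)) u)) = (\<Sum>e'\<le>d - e. g e e')" .
  qed
  also have "\<dots> = (\<Sum>e'\<le>d. \<Sum>e\<le>d - e'. g e e')"
    unfolding sum.Sigma[OF finite_atMost ballI[OF finite_atMost]]
    by (rule sum.reindex_bij_witness[of _ "\<lambda>(i, j). (j, i)" "\<lambda>(i, j). (j, i)"]) auto
  also have "\<dots> = (\<Sum>e'\<le>d. \<Sum>n'\<le>e'. h $ n' $ e' / 4 * ham h (Suc k) (d - e') (Bos (int n') W) u)"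
  proof (rule sum.cong[OF refl])
    fix e'
    have "(\<Sum>e\<le>d - e'. g e e') = (\<Sum>e\<le>d - e'. \<Sum>n'\<le>e'. \<Sum>n\<le>e. h $ n' $ e' / 4 * (h $ n $ e / 4 *
      Bos (int n) (ham h k (d - e' - e) (Bos (int n') W)) u))"
      unfolding g_def by (subst sum.swap) (simp only: mult.left_commute diff_commute)
    also have "\<dots> = (\<Sum>n'\<le>e'. \<Sum>e\<le>d - e'. \<Sum>n\<le>e. h $ n' $ e' / 4 * (h $ n $ e / 4 *
      Bos (int n) (ham h k (d - e' - e) (Bos (int n') W)) u))"
      by (rule sum.swap)
    also have "\<dots> = (\<Sum>n'\<le>e'. h $ n' $ e' / 4 * ham h (Suc k) (d - e') (Bos (int n') W) u)"
      by (simp only: ham.simps sum_distrib_left)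
    finally show "(\<Sum>e\<le>d - e'. g e e') = (\<Sum>n'\<le>e'. h $ n' $ e' / 4 * ham h (Suc k) (d - e') (Bos (int n') W) u)" .
  qed
  finally show ?case .
qed

text \<open>Schur's Q-function of a word, as a function of the generating series \<open>G\<close> of the \<open>q\<^sub>n\<close>.\<close>

definition schurQ :: "'a::comm_ring_1 fps \<Rightarrow> int list \<Rightarrow> 'a" where
  "schurQ G w = (if sum_list w < 0 then 0 else twist 1 G (nat (sum_list w)) vev w)"

lemma shift_der_nth: "shift_der s n F w $ d = shift_der s n (\<lambda>w. F w $ d) w"
  by (induction w arbitrary: F) simp_all

lemma shift_pow_tame:
  assumes h: "tame (fps_nth h)"
  shows "e < d \<Longrightarrow> shift_pow s h k d W w $ e = 0"
proof (induction k arbitrary: d e w)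
  case (Suc k)
  have "(h $ n * shift_der s n (shift_pow s h k (d - n) W) w) $ e = 0" if n: "n \<le> d" for n
    unfolding fps_mult_nth
  proof (intro sum.neutral ballI)
    fix i assume "i \<in> {0..e}"
    then have "i < n \<or> e - i < d - n" using Suc.prems n by auto
    then show "h $ n $ i * shift_der s n (shift_pow s h k (d - n) W) w $ (e - i) = 0"
      using tameD[OF h] Suc.IH[of "e - i" "d - n"] by (auto simp: shift_der_nth)
  qed
  then show ?case by (simp add: fps_sum_nth)
qed simp

lemma raise_op_pow_Nil: "(raise_op f ^^ a) W [] = W []"
  by (induction a) (simp_all add: raise_op_def)

section \<open>Expectation values of exp(H) on a single word\<close>

context
  fixes V :: "int list \<Rightarrow> 'a::field_char_0" and h :: "'a fps fps" and Y :: 'a and r :: nat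
  assumes V: "bra_like V" and kill: "\<And>w m. m < 0 \<Longrightarrow> V (w @ [m]) = 0" and V1: "V [] = 1"
    and h: "tame (fps_nth h)" and heven: "\<And>n. even n \<Longrightarrow> h $ n = 0"
begin

text \<open>The ket of \<open>r\<close> raising exponentials followed by phi_w |vac>, as a
  functional of the word to its left.\<close>

definition state :: "int list \<Rightarrow> int list \<Rightarrow> 'a" where
  "state w = (raise_op (qgen Y) ^^ r) (\<lambda>v. V (v @ w))"

definition amp :: "nat \<Rightarrow> int list \<Rightarrow> 'a fps" where
  "amp k w = Abs_fps (\<lambda>d. ham h k d (state w) [])"

text \<open>The amplitude without raising exponentials. As \<open>vev\<close> vanishes unless the
  total is zero, the k derivations must lower the total of \<open>w\<close> to zero, so a single
  shift contributes.\<close>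

definition hom_amp :: "nat \<Rightarrow> int list \<Rightarrow> 'a fps" where
  "hom_amp k w = (if sum_list w < 0 then 0 else shift_pow 1 h k (nat (sum_list w)) vev w)"

lemma h_nth_0: "h $ 0 = 0"
  by (rule heven) simp

text \<open>b_n collects a scalar from each of the \<open>r\<close> exponentials and then acts on
  \<open>w\<close> as a derivation. For odd n the sign is absorbed in (-Y)^n, so that the scalars
  sum up to the value of \<open>h\<close> at -Y.\<close>

lemma Bos_state:
  assumes "odd n"
  shows "Bos (int n) (state w) = (\<lambda>u. 4 * (shift_der 1 n (\<lambda>w. state w u) w + of_nat r * (- Y) ^ n * state w u))"
proof
  fix u
  have "Bos (int n) (\<lambda>v. V (v @ w)) = (\<lambda>u. 4 * shift_der 1 n (\<lambda>w. V (u @ w)) w)"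
    by (rule ext) (rule Bos_pos_word[OF V kill assms])
  then show "Bos (int n) (state w) u = 4 * (shift_der 1 n (\<lambda>w. state w u) w + of_nat r * (- Y) ^ n * state w u)"
    unfolding state_def Bos_raise_op_pow[OF bra_like_append[OF V] assms]
    using assms by (simp add: raise_op_pow_scale raise_op_pow_shift_der algebra_simps)
qed

lemma amp_Suc:
  "amp (Suc k) w = isum (\<lambda>n. h $ n * shift_der 1 n (amp k) w) + of_nat r * ev_at (- Y) h * amp k w"
proof -
  define D where "D n = shift_der 1 n (amp k) w + fps_const (of_nat r * (- Y) ^ n) * amp k w" for n
  have "amp (Suc k) w = isum (\<lambda>n. h $ n * D n)"
  proof (rule fps_ext)
    fix d
    have "amp (Suc k) w $ d = (\<Sum>e\<le>d. \<Sum>n\<le>e. h $ n $ e * D n $ (d - e))"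
      unfolding amp_def fps_nth_Abs_fps ham_Suc_inner
    proof (intro sum.cong refl)
      fix e n
      show "h $ n $ e / 4 * ham h k (d - e) (Bos (int n) (state w)) [] = h $ n $ e * D n $ (d - e)"
      proof (cases "odd n")
        case True
        have "ham h k (d - e) (Bos (int n) (state w)) [] = 4 * D n $ (d - e)"
          unfolding Bos_state[OF True] ham_scale ham_add ham_shift_der
          by (simp add: D_def amp_def shift_der_nth mult.assoc)
        then show ?thesis by simp
      qed (simp add: heven)
    qed
    also have "\<dots> = (\<Sum>e\<le>d. \<Sum>n\<le>d. h $ n $ e * D n $ (d - e))"
      by (intro sum.cong refl sum.mono_neutral_left) (auto simp: tameD[OF h])
    also have "\<dots> = (\<Sum>n\<le>d. \<Sum>e\<le>d. h $ n $ e * D n $ (d - e))"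
      by (rule sum.swap)
    finally show "amp (Suc k) w $ d = isum (\<lambda>n. h $ n * D n) $ d"
      by (simp add: isum_nth fps_mult_nth atLeast0AtMost)
  qed
  also have "\<dots> = isum (\<lambda>n. h $ n * shift_der 1 n (amp k) w) +
     isum (\<lambda>n. (h $ n * fps_const ((- Y) ^ n)) * (of_nat r * amp k w))"
    unfolding isum_add[symmetric] D_def
    by (simp add: algebra_simps flip: fps_const_mult fps_of_nat)
  also have "isum (\<lambda>n. (h $ n * fps_const ((- Y) ^ n)) * (of_nat r * amp k w)) = ev_at (- Y) h * (of_nat r * amp k w)"
    unfolding ev_at_def by (rule isum_mult[OF tame_mult[OF h]])
  finally show ?thesis by (simp add: mult_ac)
qed

lemma hom_amp_Suc: "hom_amp (Suc k) w = isum (\<lambda>n. h $ n * shift_der 1 n (hom_amp k) w)"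
proof -
  have 0: "shift_der 1 n (hom_amp k) w = 0" if "int n > sum_list w" for n
    by (rule shift_der_eq_0) (use that in \<open>simp add: hom_amp_def\<close>)
  show ?thesis
  proof (cases "sum_list w < 0")
    case True
    then have "shift_der 1 n (hom_amp k) w = 0" for n by (intro 0) simp
    with True show ?thesis by (simp add: hom_amp_def[of "Suc k"]) (simp add: isum_def fps_eq_iff)
  next
    case False
    have "isum (\<lambda>n. h $ n * shift_der 1 n (hom_amp k) w) = (\<Sum>n\<le>nat (sum_list w). h $ n * shift_der 1 n (hom_amp k) w)"
      by (rule isum_finite[OF tame_mult[OF h]]) (simp add: 0)
    also have "\<dots> = (\<Sum>n\<le>nat (sum_list w). h $ n * shift_der 1 n (shift_pow 1 h k (nat (sum_list w) - n) vev) w)"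
    proof (intro sum.cong refl arg_cong2[where f = times] shift_der_cong)
      fix n and u :: "int list"
      assume "n \<in> {..nat (sum_list w)}" "sum_list u = sum_list w - 1 * int n"
      then have "\<not> sum_list u < 0" "nat (sum_list u) = nat (sum_list w) - n" using False by auto
      then show "hom_amp k u = shift_pow 1 h k (nat (sum_list w) - n) vev u" by (simp add: hom_amp_def)
    qed
    finally show ?thesis using False by (simp add: hom_amp_def)
  qed
qed

text \<open>The derivation and the scalar commute, hence the binomial formula. Even length is used
  at k = 0, to identify the vacuum value; derivations preserve it.\<close>

lemma amp_eq:
  "even (length w) \<Longrightarrow> amp k w = (\<Sum>p\<le>k. of_nat (k choose p) * ((of_nat r * ev_at (- Y) h) ^ p * hom_amp (k - p) w))"
proof (induction k arbitrary: w)
  case 0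
  have "V w = vev w" by (rule vacuum_unique[OF V kill V1 0])
  then have "amp 0 w = fps_const (vev w)"
    by (simp add: amp_def state_def raise_op_pow_Nil fps_eq_iff)
  then show ?case using fps_const_vev[OF 0, where ?'a = 'a]
    by (auto simp: hom_amp_def vev_sum_nonzero)
next
  case (Suc k)
  define c where "c = of_nat r * ev_at (- Y) h"
  have "isum (\<lambda>n. h $ n * shift_der 1 n (amp k) w) =
      isum (\<lambda>n. \<Sum>p\<le>k. of_nat (k choose p) * c ^ p * (h $ n * shift_der 1 n (hom_amp (k - p)) w))"
  proof (intro arg_cong[where f = isum] ext)
    fix n
    have "shift_der 1 n (amp k) w = shift_der 1 n (\<lambda>w. \<Sum>p\<le>k. of_nat (k choose p) * (c ^ p * hom_amp (k - p) w)) w"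
      by (rule shift_der_cong) (simp add: Suc.IH Suc.prems c_def)
    then show "h $ n * shift_der 1 n (amp k) w = (\<Sum>p\<le>k. of_nat (k choose p) * c ^ p * (h $ n * shift_der 1 n (hom_amp (k - p)) w))"
      by (simp add: shift_der_sum shift_der_scale sum_distrib_left mult_ac)
  qed
  also have "\<dots> = (\<Sum>p\<le>k. of_nat (k choose p) * c ^ p * hom_amp (Suc (k - p)) w)"
    unfolding isum_sum hom_amp_Suc by (intro sum.cong refl isum_mult_left tame_mult h)
  finally have "amp (Suc k) w = (\<Sum>p\<le>k. of_nat (k choose p) * c ^ p * hom_amp (Suc (k - p)) w) +
      c * (\<Sum>p\<le>k. of_nat (k choose p) * (c ^ p * hom_amp (k - p) w))"
    unfolding amp_Suc Suc.IH[OF Suc.prems] c_def by simp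
  also have "\<dots> = (\<Sum>p\<le>k. of_nat (k choose p) *
      (c ^ Suc p * hom_amp (Suc k - Suc p) w + c ^ p * hom_amp (Suc k - p) w))"
    by (simp add: sum_distrib_left sum.distrib algebra_simps Suc_diff_le)
  also have "\<dots> = (\<Sum>p\<le>Suc k. of_nat (Suc k choose p) * (c ^ p * hom_amp (Suc k - p) w))"
    by (rule binomial_step)
  finally show ?case by (simp only: c_def)
qed

text \<open>The binomial formula splits the exponential into that of the scalar, which is an r-th
  power, and that of the derivation, which multiplies every letter by exp(h).\<close>

lemma exp_ham_state:
  assumes "even (length w)"
  shows "Abs_fps (\<lambda>d. \<Sum>k\<le>d. 1 / of_nat (fact k) * ham h k d (state w) []) =
    expi (ev_at (- Y) h) ^ r * schurQ (fps_expo (\<lambda>k. fps_const (1 / of_nat (fact k))) h) w"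
proof -
  define \<iota> where "\<iota> k = (fps_const (1 / of_nat (fact k)) :: 'a fps)" for k
  have \<iota>: "fact_inv \<iota>" unfolding \<iota>_def[abs_def] by (rule fact_inv_fps)
  define c where "c = of_nat r * ev_at (- Y) h"
  have c0: "ev_at (- Y) h $ 0 = 0" by (simp add: ev_at_def isum_nth h_nth_0)
  have tc: "tame (\<lambda>p. \<iota> p * c ^ p)"
    by (intro tame_mult_left tame_power) (simp add: c_def c0)
  have tQ: "tame (\<lambda>i. \<iota> i * hom_amp i w)"
  proof (rule tame_mult_left)
    show "tame (\<lambda>i. hom_amp i w)"
      unfolding tame_def
    proof (intro allI impI)
      fix n d :: nat assume "d < n"
      then show "hom_amp n w $ d = 0"
        using shift_pow_tame[OF h, of d "nat (sum_list w)"] shift_pow_eq_0[OF h_nth_0, of "nat (sum_list w)" n]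
        by (cases "d < nat (sum_list w)") (auto simp: hom_amp_def)
    qed
  qed
  have "Abs_fps (\<lambda>d. \<Sum>k\<le>d. 1 / of_nat (fact k) * ham h k d (state w) []) = isum (\<lambda>k. \<iota> k * amp k w)"
    by (simp add: fps_eq_iff isum_nth \<iota>_def amp_def)
  also have "\<dots> = isum (\<lambda>k. \<Sum>p\<le>k. \<iota> p * c ^ p * (\<iota> (k - p) * hom_amp (k - p) w))"
  proof (intro arg_cong[where f = isum] ext)
    fix k
    have "\<iota> k * amp k w = (\<Sum>p\<le>k. \<iota> k * of_nat (k choose p) * (c ^ p * hom_amp (k - p) w))"
      unfolding amp_eq[OF assms] c_def[symmetric] by (simp add: sum_distrib_left mult.assoc)
    also have "\<dots> = (\<Sum>p\<le>k. \<iota> p * c ^ p * (\<iota> (k - p) * hom_amp (k - p) w))"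
      by (intro sum.cong refl) (simp add: fact_inv_binomial[OF \<iota>])
    finally show "\<iota> k * amp k w = (\<Sum>p\<le>k. \<iota> p * c ^ p * (\<iota> (k - p) * hom_amp (k - p) w))" .
  qed
  also have "\<dots> = isum (\<lambda>p. \<iota> p * c ^ p) * isum (\<lambda>i. \<iota> i * hom_amp i w)"
    by (rule isum_cauchy[OF tc tQ])
  also have "isum (\<lambda>p. \<iota> p * c ^ p) = expi (ev_at (- Y) h) ^ r"
    using expi_of_nat[OF c0, of r] by (simp add: expi_def \<iota>_def c_def)
  also have "isum (\<lambda>i. \<iota> i * hom_amp i w) = schurQ (fps_expo \<iota> h) w"
  proof (cases "sum_list w < 0")
    case True
    then show ?thesis by (simp add: hom_amp_def schurQ_def isum_def fps_eq_iff)
  next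
    case False
    have "isum (\<lambda>i. \<iota> i * hom_amp i w) = (\<Sum>i\<le>nat (sum_list w). \<iota> i * hom_amp i w)"
      by (rule isum_finite[OF tQ]) (use shift_pow_eq_0[OF h_nth_0, of "nat (sum_list w)"] False in \<open>simp add: hom_amp_def\<close>)
    then show ?thesis
      using exp_shift_pow[OF \<iota> h_nth_0, of "nat (sum_list w)" "nat (sum_list w)" 1 vev w] False
      by (simp add: hom_amp_def schurQ_def)
  qed
  finally show ?thesis by (simp only: \<iota>_def[abs_def])
qed

lemma exp_ham_chain:
  assumes "even (length Cs)" and "length Cs = r"
  shows "Abs_fps (\<lambda>d. \<Sum>k\<le>d. 1 / of_nat (fact k) * ham h k d (chain (qgen Y) Cs V) []) =
    Abs_fps (\<lambda>d. word_sum d (twisted_letters (qgen Y) Cs) (\<lambda>w.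
      (expi (ev_at (- Y) h) ^ r * schurQ (fps_expo (\<lambda>k. fps_const (1 / of_nat (fact k))) h) w) $ d))"
proof (rule fps_ext)
  fix d
  let ?T = "twisted_letters (qgen Y) Cs"
  have "ham h k d (chain (qgen Y) Cs V) [] = word_sum d ?T (\<lambda>w. ham h k d (state w) [])" for k
  proof -
    have "ham h k d (chain (qgen Y) Cs V) [] = ham h k d (\<lambda>u. word_sum d ?T (\<lambda>w. state w u)) []"
      by (rule ham_cong) (use chain_eq_word_sum[OF V qgen_involution, where N = d and Cs = Cs] in \<open>simp add: state_def assms(2)\<close>)
    then show ?thesis by (simp add: ham_word_sum)
  qed
  then have "(\<Sum>k\<le>d. 1 / of_nat (fact k) * ham h k d (chain (qgen Y) Cs V) []) =
      word_sum d ?T (\<lambda>w. \<Sum>k\<le>d. 1 / of_nat (fact k) * ham h k d (state w) [])"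
    unfolding word_sum_sum word_sum_scale by simp
  also have "\<dots> = word_sum d ?T (\<lambda>w.
      (expi (ev_at (- Y) h) ^ r * schurQ (fps_expo (\<lambda>k. fps_const (1 / of_nat (fact k))) h) w) $ d)"
  proof (rule word_sum_cong)
    fix w :: "int list" assume "length w = length ?T"
    then have "even (length w)" using assms(1) by simp
    from arg_cong[OF exp_ham_state[OF this], of "\<lambda>f. f $ d"]
    show "(\<Sum>k\<le>d. 1 / of_nat (fact k) * ham h k d (state w) []) =
      (expi (ev_at (- Y) h) ^ r * schurQ (fps_expo (\<lambda>k. fps_const (1 / of_nat (fact k))) h) w) $ d"
      by simp
  qed
  finally show "Abs_fps (\<lambda>d. \<Sum>k\<le>d. 1 / of_nat (fact k) * ham h k d (chain (qgen Y) Cs V) []) $ d =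
    Abs_fps (\<lambda>d. word_sum d ?T (\<lambda>w.
      (expi (ev_at (- Y) h) ^ r * schurQ (fps_expo (\<lambda>k. fps_const (1 / of_nat (fact k))) h) w) $ d)) $ d"
    by simp
qed

end

section \<open>Partial fractions\<close>

lemma prod_qgen_fps_poly:
  fixes X :: "'i \<Rightarrow> 'a::field"
  assumes "finite A"
  shows "fps_of_poly (\<Prod>k\<in>A. [:1, - X k:]) * (\<Prod>k\<in>A. qgen (X k)) = fps_of_poly (\<Prod>k\<in>A. [:1, X k:])"
proof -
  have "fps_of_poly [:1, - X k:] * qgen (X k) = fps_of_poly [:1, X k:]" for k
    using qgen_mult[of "X k"] by (simp add: fps_of_poly_pCons mult.commute flip: fps_const_neg)
  then show ?thesis
    by (simp add: fps_of_poly_prod flip: prod.distrib)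
qed

definition geo :: "'a::comm_ring_1 \<Rightarrow> 'a fps" where
  "geo X = Abs_fps (\<lambda>n. X ^ n)"

lemma geo_mult: "(1 - fps_const X * fps_X) * geo X = 1"
proof (rule fps_ext)
  fix n
  show "((1 - fps_const X * fps_X) * geo X) $ n = 1 $ n"
    by (cases n) (auto simp: left_diff_distrib geo_def mult.assoc)
qed

lemma degree_prod_linear:
  fixes X :: "'i \<Rightarrow> 'a::field"
  assumes "finite A"
  shows "degree (\<Prod>k\<in>A. [:1, X k:]) \<le> card A" "coeff (\<Prod>k\<in>A. [:1, X k:]) (card A) = (\<Prod>k\<in>A. X k)"
  using assms
proof (induction A rule: finite_induct)
  case (insert a A)
  {
    case 1
    show ?case using insert degree_mult_le[of "[:1, X a:]" "\<Prod>k\<in>A. [:1, X k:]"]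
      by (auto intro: order.trans)
  next
    case 2
    have "coeff (\<Prod>k\<in>A. [:1, X k:]) (Suc (card A)) = 0"
      using insert.IH(1) by (intro coeff_eq_0) simp
    then show ?case using insert by (simp add: coeff_pCons)
  }
qed simp_all

text \<open>After multiplication by the common denominator, the difference of both sides of the
  decomposition has degree below the cardinality of \<open>A\<close>, but a root at each of the
  distinct points 1 / X_k.\<close>

lemma prod_qgen_partial_fractions_field:
  fixes X :: "'i \<Rightarrow> 'a::field"
  assumes A: "finite A" and X0: "\<And>k. k \<in> A \<Longrightarrow> X k \<noteq> 0" and inj: "inj_on X A" and "m \<ge> 1"
  shows "(\<Prod>k\<in>A. qgen (X k)) $ m = (\<Sum>k\<in>A. 2 * (\<Prod>l\<in>A - {k}. (X k + X l) / (X k - X l)) * X k ^ m)"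
proof -
  \<comment> \<open>The coefficient of 1 / (1 - X_k z); the 2 is the value of 1 + X_k z at the
    pole.\<close>
  define R where "R k = 2 * (\<Prod>l\<in>A - {k}. (X k + X l) / (X k - X l))" for k
  \<comment> \<open>The value of the product of all (1 + X_k z) / (1 - X_k z) at infinity; it makes
    the leading coefficients agree.\<close>
  define s where "s = (- 1 :: 'a) ^ card A"
  define p where "p = (\<Prod>k\<in>A. [:1, X k:])"
  define q where "q B = (\<Prod>k\<in>B. [:1, - X k:])" for B
  have "p = smult s (q A) + (\<Sum>k\<in>A. smult (R k) (q (A - {k})))" (is "p = ?q")
  proof (rule ccontr)
    assume ne: "p \<noteq> ?q"
    have cA: "coeff (q A) (card A) = s * (\<Prod>k\<in>A. X k)"
      using degree_prod_linear(2)[OF A, of "\<lambda>k. - X k"] by (simp add: q_def s_def prod_uminus)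
    have dk: "degree (q (A - {k})) < card A" if "k \<in> A" for k
    proof (rule le_less_trans[OF _ card_Diff1_less[OF A that]])
      show "degree (q (A - {k})) \<le> card (A - {k})"
        unfolding q_def by (rule degree_prod_linear(1)) (use A in simp)
    qed
    have ss: "s * s = 1" by (simp add: s_def flip: power_add mult_2)
    have "coeff (p - ?q) (card A) = 0"
      using degree_prod_linear(2)[OF A, of X] cA dk ss
      by (simp add: p_def coeff_sum coeff_eq_0 mult.assoc[symmetric])
    moreover have "degree (p - ?q) \<le> card A"
    proof (intro degree_diff_le degree_add_le degree_sum_le)
      show "degree p \<le> card A" unfolding p_def by (rule degree_prod_linear(1)[OF A])
      show "degree (smult s (q A)) \<le> card A"
        using degree_prod_linear(1)[OF A, of "\<lambda>k. - X k"] by (simp add: q_def)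
      fix k assume "k \<in> A"
      then show "degree (smult (R k) (q (A - {k}))) \<le> card A"
        using dk[of k] degree_smult_le[of "R k" "q (A - {k})"] by linarith
    qed (use A in simp)
    moreover have "p - ?q \<noteq> 0" using ne by simp
    ultimately have deg: "degree (p - ?q) < card A"
      using eq_zero_or_degree_less by blast
    have "poly (p - ?q) (1 / X k) = 0" if k: "k \<in> A" for k
    proof -
      have qA: "poly (q B) (1 / X k) = 0" if "k \<in> B" "B \<subseteq> A" for B
        using that A X0[OF k] finite_subset[OF that(2) A] by (auto simp: q_def poly_prod)
      have "poly ?q (1 / X k) = (\<Sum>j\<in>A. R j * poly (q (A - {j})) (1 / X k))"
        using qA[of A] k by (simp add: poly_sum)
      also have "\<dots> = (\<Sum>j\<in>{k}. R j * poly (q (A - {j})) (1 / X k))"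
        using k A by (intro sum.mono_neutral_right) (auto intro!: qA)
      also have "\<dots> = 2 * (\<Prod>l\<in>A - {k}. (X k + X l) / (X k - X l) * (1 - X l / X k))"
        by (simp add: R_def q_def poly_prod mult.assoc flip: prod.distrib)
      also have "(\<Prod>l\<in>A - {k}. (X k + X l) / (X k - X l) * (1 - X l / X k)) = (\<Prod>l\<in>A - {k}. 1 + X l / X k)"
      proof (rule prod.cong[OF refl])
        fix l assume "l \<in> A - {k}"
        then have "X k - X l \<noteq> 0" using inj k by (auto simp: inj_on_def)
        then show "(X k + X l) / (X k - X l) * (1 - X l / X k) = 1 + X l / X k"
          using X0[OF k] by (simp add: field_simps)
      qed
      also have "2 * (\<Prod>l\<in>A - {k}. 1 + X l / X k) = poly p (1 / X k)"
        using X0[OF k] by (simp add: p_def poly_prod prod.remove[OF A k])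
      finally show ?thesis by simp
    qed
    then have "(\<lambda>k. 1 / X k) ` A \<subseteq> {x. poly (p - ?q) x = 0}" by auto
    then have "card ((\<lambda>k. 1 / X k) ` A) \<le> card {x. poly (p - ?q) x = 0}"
      using \<open>p - ?q \<noteq> 0\<close> by (intro card_mono poly_roots_finite)
    also have "\<dots> \<le> degree (p - ?q)"
      using \<open>p - ?q \<noteq> 0\<close> by (rule card_poly_roots_bound)
    also have "card ((\<lambda>k. 1 / X k) ` A) = card A"
      by (rule card_image) (use inj X0 in \<open>auto simp: inj_on_def\<close>)
    finally show False using deg by simp
  qed
  moreover have "fps_of_poly (q A) * geo (X k) = fps_of_poly (q (A - {k}))" if "k \<in> A" for k
  proof -
    have "fps_of_poly (q A) = (1 - fps_const (X k) * fps_X) * fps_of_poly (q (A - {k}))"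
      by (simp add: q_def prod.remove[OF A that] fps_of_poly_mult fps_of_poly_pCons mult.commute flip: fps_const_neg)
    then have "fps_of_poly (q A) * geo (X k) = ((1 - fps_const (X k) * fps_X) * geo (X k)) * fps_of_poly (q (A - {k}))"
      by (simp only: mult_ac)
    then show ?thesis by (simp add: geo_mult)
  qed
  ultimately have "fps_of_poly p = fps_of_poly (q A) * (fps_const s + (\<Sum>k\<in>A. fps_const (R k) * geo (X k)))"
    by (simp add: fps_of_poly_add fps_of_poly_smult fps_of_poly_sum distrib_left sum_distrib_left mult_ac)
  then have "fps_of_poly (q A) * (\<Prod>k\<in>A. qgen (X k)) = fps_of_poly (q A) * (fps_const s + (\<Sum>k\<in>A. fps_const (R k) * geo (X k)))"
    using prod_qgen_fps_poly[OF A, of X] by (simp add: p_def q_def)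
  moreover have "q A \<noteq> 0" using A by (simp add: q_def)
  ultimately have "(\<Prod>k\<in>A. qgen (X k)) = fps_const s + (\<Sum>k\<in>A. fps_const (R k) * geo (X k))"
    by simp
  then show ?thesis using \<open>m \<ge> 1\<close> by (simp add: fps_sum_nth geo_def R_def)
qed

lemma fps_to_fls_prod: "fps_to_fls (\<Prod>k\<in>A. f k) = (\<Prod>k\<in>A. fps_to_fls (f k :: 'a::comm_ring_1 fps))"
  by (induction A rule: infinite_finite_induct) (simp_all add: fls_times_fps_to_fls)

lemma fps_to_fls_sum: "fps_to_fls (\<Sum>k\<in>A. f k) = (\<Sum>k\<in>A. fps_to_fls (f k :: 'a::comm_ring_1 fps))"
  by (induction A rule: infinite_finite_induct) simp_all

lemma fps_to_fls_prod_qgen: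
  fixes X :: "'i \<Rightarrow> 'a::comm_ring_1 fps"
  shows "fps_to_fls ((\<Prod>k\<in>A. qgen (X k)) $ m) = (\<Prod>k\<in>A. qgen (fps_to_fls (X k))) $ m"
proof (induction A arbitrary: m rule: infinite_finite_induct)
  case (insert a A)
  have g: "fps_to_fls (qgen (X a) $ i) = qgen (fps_to_fls (X a)) $ i" for i
    by (simp add: qgen_nth fls_times_fps_to_fls fps_to_fls_power)
  show ?case using insert.hyps
    by (simp add: fps_mult_nth fps_to_fls_sum fls_times_fps_to_fls g insert.IH)
qed auto

text \<open>Power series are not a field, so the decomposition is made over Laurent series. It comes
  back because the quotients are given as power series \<open>\<rho>\<close>. At m = 0 the constant
  of the decomposition would enter.\<close>

lemma prod_qgen_partial_fractions:
  fixes X :: "'i \<Rightarrow> 'a::field fps"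
  assumes A: "finite A" and X0: "\<And>k. k \<in> A \<Longrightarrow> X k \<noteq> 0" and inj: "inj_on X A" and "m \<ge> 1"
    and \<rho>: "\<And>k l. k \<in> A \<Longrightarrow> l \<in> A \<Longrightarrow> k \<noteq> l \<Longrightarrow> \<rho> k l * (X k - X l) = X k + X l"
  shows "(\<Prod>k\<in>A. qgen (X k)) $ m = (\<Sum>k\<in>A. 2 * (\<Prod>l\<in>A - {k}. \<rho> k l) * X k ^ m)"
proof -
  let ?\<phi> = "fps_to_fls :: 'a fps \<Rightarrow> 'a fls"
  have "?\<phi> ((\<Prod>k\<in>A. qgen (X k)) $ m) = (\<Prod>k\<in>A. qgen (?\<phi> (X k))) $ m"
    by (rule fps_to_fls_prod_qgen)
  also have "\<dots> = (\<Sum>k\<in>A. 2 * (\<Prod>l\<in>A - {k}. (?\<phi> (X k) + ?\<phi> (X l)) / (?\<phi> (X k) - ?\<phi> (X l))) * ?\<phi> (X k) ^ m)"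
    by (rule prod_qgen_partial_fractions_field) (use assms in \<open>auto simp: inj_on_def\<close>)
  also have "\<dots> = (\<Sum>k\<in>A. 2 * (\<Prod>l\<in>A - {k}. ?\<phi> (\<rho> k l)) * ?\<phi> (X k) ^ m)"
  proof (intro sum.cong refl arg_cong2[where f = times] prod.cong)
    fix k l assume kl: "k \<in> A" "l \<in> A - {k}"
    have "?\<phi> (X k) - ?\<phi> (X l) \<noteq> 0" using inj kl by (auto simp: inj_on_def)
    moreover have "?\<phi> (\<rho> k l) * (?\<phi> (X k) - ?\<phi> (X l)) = ?\<phi> (X k) + ?\<phi> (X l)"
      using arg_cong[OF \<rho>[of k l], of ?\<phi>] kl by (auto simp: fls_times_fps_to_fls)
    ultimately show "(?\<phi> (X k) + ?\<phi> (X l)) / (?\<phi> (X k) - ?\<phi> (X l)) = ?\<phi> (\<rho> k l)"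
      by (simp add: field_simps)
  qed
  also have "\<dots> = ?\<phi> (\<Sum>k\<in>A. 2 * (\<Prod>l\<in>A - {k}. \<rho> k l) * X k ^ m)"
    by (simp add: fps_to_fls_sum fps_to_fls_prod fls_times_fps_to_fls fps_to_fls_power)
  finally show ?thesis by simp
qed

section \<open>Recursion on the number of letters\<close>

text \<open>In degree \<open>d\<close> the letters beyond \<open>d\<close> are dropped. This is
  harmless for functionals whose order is at least the total of the word, as for
  \<open>schurQ\<close> of a tame series.\<close>

definition word_series :: "'a::comm_ring_1 fps list \<Rightarrow> (int list \<Rightarrow> 'a fps) \<Rightarrow> 'a fps" where
  "word_series Cs \<Phi> = Abs_fps (\<lambda>d. word_sum d Cs (\<lambda>w. \<Phi> w $ d))"

lemma word_series_Nil [simp]: "word_series [] \<Phi> = \<Phi> []"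
  by (simp add: word_series_def fps_eq_iff)

lemma word_series_Cons:
  "word_series (C # Cs) \<Phi> = word_series Cs (\<lambda>w. isum (\<lambda>m. fps_const (C $ m) * \<Phi> (int m # w)))"
  by (simp only: word_series_def word_sum_Cons isum_nth fps_mult_left_const_nth)

lemma word_series_sum: "word_series Cs (\<lambda>w. \<Sum>i\<in>I. F i w) = (\<Sum>i\<in>I. word_series Cs (F i))"
  by (rule fps_ext) (simp add: word_series_def fps_sum_nth word_sum_sum)

lemma word_series_cong:
  assumes "\<And>w. length w = length Cs \<Longrightarrow> (\<forall>m\<in>set w. m \<ge> 0) \<Longrightarrow> \<Phi> w = \<Psi> w"
  shows "word_series Cs \<Phi> = word_series Cs \<Psi>"
  unfolding word_series_def by (intro arg_cong[where f = Abs_fps] ext word_sum_cong) (simp add: assms)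

text \<open>The cut-off varies with the degree; the order condition guarantees that a factor taken
  out sees the same words in every degree.\<close>

lemma word_series_mult:
  assumes "\<And>w d. (\<forall>m\<in>set w. m \<ge> 0) \<Longrightarrow> int d < sum_list w \<Longrightarrow> \<Phi> w $ d = 0"
  shows "word_series Cs (\<lambda>w. c * \<Phi> w) = c * word_series Cs \<Phi>"
  using assms
proof (induction Cs arbitrary: \<Phi>)
  case (Cons C Cs)
  let ?\<Psi> = "\<lambda>w. isum (\<lambda>m. fps_const (C $ m) * \<Phi> (int m # w))"
  have "word_series (C # Cs) (\<lambda>w. c * \<Phi> w) = word_series Cs (\<lambda>w. c * ?\<Psi> w)"
    unfolding word_series_Cons
  proof (rule word_series_cong)
    fix w :: "int list" assume w: "\<forall>m\<in>set w. m \<ge> 0"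
    have "tame (\<lambda>m. \<Phi> (int m # w))"
      unfolding tame_def using w sum_list_nonneg[of w] by (auto intro!: Cons.prems)
    from isum_mult_left[OF tame_mult_left[OF this], of c "\<lambda>m. fps_const (C $ m)"]
    show "isum (\<lambda>m. fps_const (C $ m) * (c * \<Phi> (int m # w))) = c * ?\<Psi> w"
      by (simp add: mult_ac)
  qed
  also have "\<dots> = c * word_series Cs ?\<Psi>"
  proof (rule Cons.IH)
    fix w d assume w: "\<forall>m\<in>set w. m \<ge> 0" "int d < sum_list w"
    have "\<Phi> (int m # w) $ d = 0" for m
      using w by (intro Cons.prems) auto
    then show "?\<Psi> w $ d = 0" by (simp add: isum_nth)
  qed
  finally show ?case by (simp add: word_series_Cons)
qed simp

lemma twist_tame:
  assumes "tame (fps_nth G)"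
  shows "e < d \<Longrightarrow> twist s G d W w $ e = 0"
proof (induction w arbitrary: d e W)
  case (Cons m w)
  have "(G $ j * twist s G (d - j) (\<lambda>u. W ((m - s * int j) # u)) w) $ e = 0" if j: "j \<le> d" for j
    unfolding fps_mult_nth
  proof (intro sum.neutral ballI)
    fix i assume "i \<in> {0..e}"
    then have "i < j \<or> e - i < d - j" using Cons.prems j by auto
    then show "G $ j $ i * twist s G (d - j) (\<lambda>u. W ((m - s * int j) # u)) w $ (e - i) = 0"
      using tameD[OF assms] Cons.IH by auto
  qed
  then show ?case by (simp add: fps_sum_nth)
qed simp

lemma schurQ_tame:
  assumes "tame (fps_nth G)" "int d < sum_list w"
  shows "schurQ G w $ d = 0"
  using twist_tame[OF assms(1), of d "nat (sum_list w)"] assms(2) by (simp add: schurQ_def)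

text \<open>A shift of the first letter by less than m leaves it positive, where \<open>vev\<close>
  vanishes. A shift by m + l leaves -l, which the rest has to compensate.\<close>

lemma schurQ_Cons:
  assumes "\<forall>m\<in>set w. m \<ge> 0"
  shows "schurQ G (int m # w) = (\<Sum>l\<le>nat (sum_list w). G $ (m + l) *
    twist 1 G (nat (sum_list w) - l) (twist 1 (qgen (- 1)) l vev) w)"
proof -
  define s where "s = nat (sum_list w)"
  have s: "sum_list w = int s" using assms by (simp add: s_def sum_list_nonneg)
  have "schurQ G (int m # w) = (\<Sum>j\<le>m + s. G $ j * twist 1 G (m + s - j) (\<lambda>u. vev ((int m - int j) # u)) w)"
    by (simp add: schurQ_def s nat_add_distrib add.commute)
  also have "\<dots> = (\<Sum>j\<in>{m..m + s}. G $ j * twist 1 G (m + s - j) (\<lambda>u. vev ((int m - int j) # u)) w)"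
  proof (rule sum.mono_neutral_right)
    show "\<forall>i\<in>{..m + s} - {m..m + s}. G $ i * twist 1 G (m + s - i) (\<lambda>u. vev ((int m - int i) # u)) w = 0"
      by (auto simp: vev_pos)
  qed auto
  also have "\<dots> = (\<Sum>l\<le>s. G $ (m + l) * twist 1 G (s - l) (\<lambda>u. vev ((- int l) # u)) w)"
    by (rule sum.reindex_bij_witness[of _ "\<lambda>l. m + l" "\<lambda>j. j - m"]) (auto simp: add.commute[of s])
  also have "\<dots> = (\<Sum>l\<le>s. G $ (m + l) * twist 1 G (s - l) (twist 1 (qgen (- 1)) l vev) w)"
  proof (intro sum.cong refl arg_cong2[where f = times] twist_cong)
    fix l and u :: "int list" assume "l \<in> {..s}" "sum_list u = sum_list w - 1 * int (s - l)"
    then have "sum_list u = int l" using s by auto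
    then show "vev ((- int l) # u) = twist 1 (qgen (- 1)) l vev u" by (simp add: vev_Cons)
  qed
  finally show ?thesis by (simp add: s_def)
qed

lemma schurQ_Cons_prod:
  fixes X :: "'i \<Rightarrow> 'a::field fps"
  assumes A: "finite A" and X0: "\<And>k. k \<in> A \<Longrightarrow> X k \<noteq> 0" and inj: "inj_on X A" and m: "m \<ge> 1"
    and \<rho>: "\<And>k l. k \<in> A \<Longrightarrow> l \<in> A \<Longrightarrow> k \<noteq> l \<Longrightarrow> \<rho> k l * (X k - X l) = X k + X l"
    and w: "\<forall>m\<in>set w. m \<ge> 0"
  shows "schurQ (\<Prod>k\<in>A. qgen (X k)) (int m # w) =
    (\<Sum>k\<in>A. 2 * (\<Prod>l\<in>A - {k}. \<rho> k l) * X k ^ m * schurQ (\<Prod>k\<in>A - {k}. qgen (X k)) w)"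
proof -
  define G where "G B = (\<Prod>k\<in>B. qgen (X k))" for B
  define s where "s = nat (sum_list w)"
  define R where "R k = 2 * (\<Prod>l\<in>A - {k}. \<rho> k l)" for k
  have sw: "\<not> sum_list w < 0" using sum_list_nonneg[of w] w by force
  have G: "G A $ (m + l) = (\<Sum>k\<in>A. R k * X k ^ (m + l))" for l
    unfolding G_def R_def using assms by (intro prod_qgen_partial_fractions) auto
  have "schurQ (G A) (int m # w) = (\<Sum>l\<le>s. \<Sum>k\<in>A. R k * X k ^ m *
      (X k ^ l * twist 1 (G A) (s - l) (twist 1 (qgen (- 1)) l vev) w))"
    unfolding schurQ_Cons[OF w] G by (simp add: s_def sum_distrib_right power_add mult_ac)
  also have "\<dots> = (\<Sum>k\<in>A. R k * X k ^ m *
      (\<Sum>l\<le>s. X k ^ l * twist 1 (G A) (s - l) (twist 1 (qgen (- 1)) l vev) w))"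
    by (subst sum.swap) (simp only: sum_distrib_left)
  also have "\<dots> = (\<Sum>k\<in>A. R k * X k ^ m * schurQ (G (A - {k})) w)"
  proof (intro sum.cong refl arg_cong2[where f = times])
    fix k assume k: "k \<in> A"
    \<comment> \<open>The powers of X_k scale (1 - z) / (1 + z) to \<open>qgen (- X k)\<close>, the
      inverse of the contribution of X_k to the remaining letters.\<close>
    have "(\<Sum>l\<le>s. X k ^ l * twist 1 (G A) (s - l) (twist 1 (qgen (- 1)) l vev) w) =
       (\<Sum>l\<le>s. twist 1 (G A) (s - l) (twist 1 (fps_scale (X k) (qgen (- 1))) l vev) w)"
      by (simp only: twist_scale_fps' twist_scale)
    also have "\<dots> = (\<Sum>u\<le>s. twist 1 (G A) u (twist 1 (fps_scale (X k) (qgen (- 1))) (s - u) vev) w)"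
      by (rule sum.reindex_bij_witness[of _ "\<lambda>v. s - v" "\<lambda>v. s - v"]) auto
    also have "\<dots> = twist 1 (G A * qgen (- X k)) s vev w"
      by (simp add: twist_comp fps_scale_qgen)
    also have "G A * qgen (- X k) = G (A - {k}) * (qgen (X k) * qgen (- X k))"
      by (simp add: G_def prod.remove[OF A k] mult_ac)
    finally show "(\<Sum>l\<le>s. X k ^ l * twist 1 (G A) (s - l) (twist 1 (qgen (- 1)) l vev) w) = schurQ (G (A - {k})) w"
      using sw by (simp add: qgen_uminus schurQ_def s_def)
  qed
  finally show ?thesis by (simp only: G_def R_def)
qed

text \<open>Summing over the first letter turns the powers X_k^m into the value of \<open>C\<close>
  at X_k. The condition \<open>C $ 0 = 0\<close> excludes the letter 0, at which the partial
  fraction formula fails.\<close>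

lemma word_series_recursion:
  fixes X :: "'i \<Rightarrow> 'a::field fps"
  assumes A: "finite A" and X0: "\<And>k. k \<in> A \<Longrightarrow> X k \<noteq> 0" and inj: "inj_on X A"
    and X: "\<And>k. k \<in> A \<Longrightarrow> X k $ 0 = 0"
    and \<rho>: "\<And>k l. k \<in> A \<Longrightarrow> l \<in> A \<Longrightarrow> k \<noteq> l \<Longrightarrow> \<rho> k l * (X k - X l) = X k + X l"
    and C: "C $ 0 = 0"
  shows "word_series (C # Cs) (schurQ (\<Prod>k\<in>A. qgen (X k))) =
    (\<Sum>k\<in>A. 2 * (\<Prod>l\<in>A - {k}. \<rho> k l) * fps_compose C (X k) * word_series Cs (schurQ (\<Prod>k\<in>A - {k}. qgen (X k))))"
proof -
  define R where "R k = 2 * (\<Prod>l\<in>A - {k}. \<rho> k l) * fps_compose C (X k)" for k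
  have "word_series (C # Cs) (schurQ (\<Prod>k\<in>A. qgen (X k))) =
      word_series Cs (\<lambda>w. \<Sum>k\<in>A. R k * schurQ (\<Prod>k\<in>A - {k}. qgen (X k)) w)"
    unfolding word_series_Cons
  proof (rule word_series_cong)
    fix w :: "int list" assume w: "\<forall>m\<in>set w. m \<ge> 0"
    let ?S = "\<lambda>k. 2 * (\<Prod>l\<in>A - {k}. \<rho> k l) * schurQ (\<Prod>k\<in>A - {k}. qgen (X k)) w"
    have "isum (\<lambda>m. fps_const (C $ m) * schurQ (\<Prod>k\<in>A. qgen (X k)) (int m # w)) =
        isum (\<lambda>m. \<Sum>k\<in>A. fps_const (C $ m) * X k ^ m * ?S k)"
    proof (intro arg_cong[where f = isum] ext)
      fix m :: nat
      show "fps_const (C $ m) * schurQ (\<Prod>k\<in>A. qgen (X k)) (int m # w) = (\<Sum>k\<in>A. fps_const (C $ m) * X k ^ m * ?S k)"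
      proof (cases "m = 0")
        case False
        then show ?thesis
          using schurQ_Cons_prod[where m = m, OF A X0 inj _ \<rho> w] by (simp add: sum_distrib_left mult_ac)
      qed (simp add: C)
    qed
    also have "\<dots> = (\<Sum>k\<in>A. fps_compose C (X k) * ?S k)"
      unfolding isum_sum isum_compose[symmetric]
      by (intro sum.cong refl isum_mult tame_mult_left tame_power X)
    finally show "isum (\<lambda>m. fps_const (C $ m) * schurQ (\<Prod>k\<in>A. qgen (X k)) (int m # w)) =
        (\<Sum>k\<in>A. R k * schurQ (\<Prod>k\<in>A - {k}. qgen (X k)) w)"
      by (simp add: R_def mult_ac)
  qed
  also have "\<dots> = (\<Sum>k\<in>A. word_series Cs (\<lambda>w. R k * schurQ (\<Prod>k\<in>A - {k}. qgen (X k)) w))"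
    by (rule word_series_sum)
  also have "\<dots> = (\<Sum>k\<in>A. R k * word_series Cs (schurQ (\<Prod>k\<in>A - {k}. qgen (X k))))"
    by (intro sum.cong refl word_series_mult schurQ_tame tame_fps_prod tame_qgen X) auto
  finally show ?thesis by (simp only: R_def)
qed

text \<open>For the additional fermion of odd length, whose coefficient series is geometric.\<close>

lemma word_series_zero_letter:
  "word_series [Abs_fps (\<lambda>m. y ^ m)] (schurQ G) = ev_at y G"
proof -
  have "schurQ G [int m] = G $ m" for m
    using schurQ_Cons[of "[]" G m] by simp
  then show ?thesis by (simp add: word_series_Cons ev_at_def mult.commute)
qed

section \<open>Symmetrization by removing one variable at a time\<close>

text \<open>The symmetrization freed from its factorial: variables are chosen for the parts of
  \<open>l\<close> only.\<close>

primrec symrec :: "('i \<Rightarrow> nat \<Rightarrow> 'a::comm_ring_1) \<Rightarrow> ('i \<Rightarrow> 'i \<Rightarrow> 'a) \<Rightarrow> 'i set \<Rightarrow> nat list \<Rightarrow> 'a" where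
  "symrec g \<rho> A [] = 1"
| "symrec g \<rho> A (k # l) = (\<Sum>a\<in>A. g a k * (\<Prod>b\<in>A - {a}. \<rho> a b) * symrec g \<rho> (A - {a}) l)"

primrec arrangement :: "('i \<Rightarrow> nat \<Rightarrow> 'a::comm_ring_1) \<Rightarrow> ('i \<Rightarrow> 'i \<Rightarrow> 'a) \<Rightarrow> nat list \<Rightarrow> 'i list \<Rightarrow> 'a" where
  "arrangement g \<rho> [] xs = 1"
| "arrangement g \<rho> (k # l) xs =
    g (hd xs) k * (\<Prod>b\<in>set (tl xs). \<rho> (hd xs) b) * arrangement g \<rho> l (tl xs)"

text \<open>A summand does not depend on the order of the variables that are left over after the
  parts of \<open>l\<close>; this is the factorial.\<close>

lemma sum_arrangement:
  "finite A \<Longrightarrow> length l \<le> card A \<Longrightarrow>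
    (\<Sum>xs\<in>permutations_of_set A. arrangement g \<rho> l xs) = of_nat (fact (card A - length l)) * symrec g \<rho> A l"
proof (induction l arbitrary: A)
  case (Cons k l)
  then have "A \<noteq> {}" by auto
  have "(\<Sum>xs\<in>permutations_of_set A. arrangement g \<rho> (k # l) xs) =
      (\<Sum>a\<in>A. \<Sum>xs\<in>(#) a ` permutations_of_set (A - {a}). arrangement g \<rho> (k # l) xs)"
    unfolding permutations_of_set_nonempty[OF \<open>A \<noteq> {}\<close>]
    using Cons.prems by (intro sum.UNION_disjoint) auto
  also have "\<dots> = (\<Sum>a\<in>A. \<Sum>xs\<in>permutations_of_set (A - {a}). g a k * (\<Prod>b\<in>A - {a}. \<rho> a b) * arrangement g \<rho> l xs)"
  proof (rule sum.cong[OF refl])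
    fix a
    have "(\<Sum>xs\<in>(#) a ` permutations_of_set (A - {a}). arrangement g \<rho> (k # l) xs) =
        (\<Sum>xs\<in>permutations_of_set (A - {a}). arrangement g \<rho> (k # l) (a # xs))"
      by (simp add: sum.reindex)
    also have "\<dots> = (\<Sum>xs\<in>permutations_of_set (A - {a}). g a k * (\<Prod>b\<in>A - {a}. \<rho> a b) * arrangement g \<rho> l xs)"
      by (rule sum.cong[OF refl]) (simp add: permutations_of_setD(1))
    finally show "(\<Sum>xs\<in>(#) a ` permutations_of_set (A - {a}). arrangement g \<rho> (k # l) xs) =
        (\<Sum>xs\<in>permutations_of_set (A - {a}). g a k * (\<Prod>b\<in>A - {a}. \<rho> a b) * arrangement g \<rho> l xs)" .
  qed
  also have "\<dots> = (\<Sum>a\<in>A. g a k * (\<Prod>b\<in>A - {a}. \<rho> a b) * (of_nat (fact (card A - length (k # l))) * symrec g \<rho> (A - {a}) l))"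
  proof (rule sum.cong[OF refl])
    fix a assume "a \<in> A"
    then have "(\<Sum>xs\<in>permutations_of_set (A - {a}). arrangement g \<rho> l xs) =
        of_nat (fact (card A - length (k # l))) * symrec g \<rho> (A - {a}) l"
      using Cons.IH[of "A - {a}"] Cons.prems by simp
    then show "(\<Sum>xs\<in>permutations_of_set (A - {a}). g a k * (\<Prod>b\<in>A - {a}. \<rho> a b) * arrangement g \<rho> l xs) =
        g a k * (\<Prod>b\<in>A - {a}. \<rho> a b) * (of_nat (fact (card A - length (k # l))) * symrec g \<rho> (A - {a}) l)"
      by (simp only: sum_distrib_left[symmetric])
  qed
  also have "\<dots> = of_nat (fact (card A - length (k # l))) * symrec g \<rho> A (k # l)"
    by (simp add: sum_distrib_left mult_ac)
  finally show ?case .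
qed simp

lemma arrangement_nth:
  "distinct xs \<Longrightarrow> length l \<le> length xs \<Longrightarrow> arrangement g \<rho> l xs =
    (\<Prod>i<length l. g (xs ! i) (l ! i)) * (\<Prod>i<length l. \<Prod>j\<in>{i<..<length xs}. \<rho> (xs ! i) (xs ! j))"
proof (induction l arbitrary: xs)
  case (Cons k l ys)
  then obtain a xs where ys: "ys = a # xs" by (cases ys) auto
  have "(\<Prod>j\<in>{0<..<length (a # xs)}. \<rho> a ((a # xs) ! j)) = (\<Prod>j<length xs. \<rho> a (xs ! j))"
    by (rule prod.reindex_bij_witness[of _ Suc "\<lambda>j. j - 1"]) auto
  also have "\<dots> = (\<Prod>b\<in>set xs. \<rho> a b)"
    using Cons.prems(1) by (intro prod.reindex_bij_betw) (simp add: ys bij_betw_nth)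
  finally have 0: "(\<Prod>j\<in>{0<..<Suc (length xs)}. \<rho> a (xs ! (j - Suc 0))) = (\<Prod>b\<in>set xs. \<rho> a b)" by simp
  have S: "(\<Prod>j\<in>{Suc i<..<Suc (length xs)}. \<rho> (xs ! i) (xs ! (j - Suc 0))) = (\<Prod>j\<in>{i<..<length xs}. \<rho> (xs ! i) (xs ! j))" for i
    by (rule prod.reindex_bij_witness[of _ Suc "\<lambda>j. j - 1"]) auto
  show ?case using Cons.IH[of xs] Cons.prems
    by (simp add: ys prod.lessThan_Suc_shift 0 S mult_ac del: prod.lessThan_Suc)
qed simp

lemma bij_betw_permutes_list:
  "bij_betw (\<lambda>w. map w [0..<n]) {w. w permutes {..<n}} (permutations_of_set {..<n})"
proof -
  let ?f = "\<lambda>w :: nat \<Rightarrow> nat. map w [0..<n]"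
  have inj: "inj_on ?f {w. w permutes {..<n}}"
  proof (rule inj_onI, rule ext)
    fix v w i
    assume vw: "v \<in> {w. w permutes {..<n}}" "w \<in> {w. w permutes {..<n}}" "?f v = ?f w"
    show "v i = w i"
    proof (cases "i < n")
      case True
      then show ?thesis using arg_cong[OF vw(3), of "\<lambda>xs. xs ! i"] by simp
    next
      case False
      then show ?thesis using vw permutes_not_in[of v "{..<n}" i] permutes_not_in[of w "{..<n}" i] by auto
    qed
  qed
  have "?f ` {w. w permutes {..<n}} \<subseteq> permutations_of_set {..<n}"
  proof
    fix xs assume "xs \<in> ?f ` {w. w permutes {..<n}}"
    then obtain w where w: "w permutes {..<n}" "xs = ?f w" by auto
    then show "xs \<in> permutations_of_set {..<n}"
      using permutes_image[OF w(1)] permutes_inj_on[OF w(1)]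
      by (auto simp: permutations_of_set_def distinct_map atLeast0LessThan)
  qed
  moreover have "card (?f ` {w. w permutes {..<n}}) = card (permutations_of_set {..<n})"
    using card_permutations[of "{..<n}" n] by (simp add: card_image[OF inj])
  ultimately have "?f ` {w. w permutes {..<n}} = permutations_of_set {..<n}"
    by (intro card_subset_eq) auto
  with inj show ?thesis by (simp add: bij_betw_def)
qed

lemma symmetrization_eq_symrec:
  fixes \<beta> :: "'a::field_char_0"
  assumes "length l \<le> n"
  shows "symmetrization \<beta> g l n x =
    symrec (\<lambda>i. g (x i)) (\<lambda>i j. oplus \<beta> (x i) (x j) / ominus \<beta> (x i) (x j)) {..<n} l"
proof -
  let ?g = "\<lambda>i. g (x i)" and ?\<rho> = "\<lambda>i j. oplus \<beta> (x i) (x j) / ominus \<beta> (x i) (x j)"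
  have "(\<Sum>w | w permutes {..<n}. (\<Prod>i<length l. g (x (w i)) (l ! i)) *
        (\<Prod>i<length l. \<Prod>j\<in>{i<..<n}. oplus \<beta> (x (w i)) (x (w j)) / ominus \<beta> (x (w i)) (x (w j)))) =
      (\<Sum>w | w permutes {..<n}. arrangement ?g ?\<rho> l (map w [0..<n]))"
  proof (rule sum.cong[OF refl])
    fix w assume "w \<in> {w. w permutes {..<n}}"
    then have "distinct (map w [0..<n])"
      using permutes_inj_on[of w "{..<n}" "{..<n}"] by (auto simp: distinct_map atLeast0LessThan)
    from arrangement_nth[OF this, of l ?g ?\<rho>] assms
    show "(\<Prod>i<length l. g (x (w i)) (l ! i)) *
        (\<Prod>i<length l. \<Prod>j\<in>{i<..<n}. oplus \<beta> (x (w i)) (x (w j)) / ominus \<beta> (x (w i)) (x (w j))) =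
        arrangement ?g ?\<rho> l (map w [0..<n])"
      by simp
  qed
  also have "\<dots> = (\<Sum>xs\<in>permutations_of_set {..<n}. arrangement ?g ?\<rho> l xs)"
    by (rule sum.reindex_bij_betw[OF bij_betw_permutes_list])
  also have "\<dots> = of_nat (fact (n - length l)) * symrec ?g ?\<rho> {..<n} l"
    using sum_arrangement[of "{..<n}" l ?g ?\<rho>] assms by simp
  finally show ?thesis by (simp add: symmetrization_def)
qed

section \<open>The generating series at the variables\<close>

text \<open>Power series have no value at t = 1, so evaluation is a relation. It is compatible with
  sums and products, hence with \<open>symrec\<close>.\<close>

definition poly_value :: "'a::comm_ring_1 fps \<Rightarrow> 'a \<Rightarrow> bool" where
  "poly_value F v \<longleftrightarrow> (\<exists>p. F = fps_of_poly p \<and> poly p 1 = v)"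

lemma poly_value_const: "poly_value (fps_const c) c"
  unfolding poly_value_def by (intro exI[of _ "[:c:]"]) simp

lemma poly_value_X: "poly_value fps_X 1"
  unfolding poly_value_def by (intro exI[of _ "[:0, 1:]"]) simp

lemma poly_value_one: "poly_value 1 1"
  using poly_value_const[of 1] by simp

lemma poly_value_numeral: "poly_value (numeral n) (numeral n)"
  using poly_value_const[of "numeral n"] by (simp add: numeral_fps_const)

lemma poly_value_add: "poly_value F v \<Longrightarrow> poly_value G w \<Longrightarrow> poly_value (F + G) (v + w)"
  unfolding poly_value_def by (metis fps_of_poly_add poly_add)

lemma poly_value_diff: "poly_value F v \<Longrightarrow> poly_value G w \<Longrightarrow> poly_value (F - G) (v - w)"
  unfolding poly_value_def by (metis fps_of_poly_diff poly_diff)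

lemma poly_value_mult: "poly_value F v \<Longrightarrow> poly_value G w \<Longrightarrow> poly_value (F * G) (v * w)"
  unfolding poly_value_def by (metis fps_of_poly_mult poly_mult)

lemma poly_value_sum: "(\<And>i. i \<in> I \<Longrightarrow> poly_value (F i) (v i)) \<Longrightarrow> poly_value (\<Sum>i\<in>I. F i) (\<Sum>i\<in>I. v i)"
  using poly_value_const[of 0]
  by (induction I rule: infinite_finite_induct) (auto intro: poly_value_add)

lemma poly_value_prod: "(\<And>i. i \<in> I \<Longrightarrow> poly_value (F i) (v i)) \<Longrightarrow> poly_value (\<Prod>i\<in>I. F i) (\<Prod>i\<in>I. v i)"
  using poly_value_one
  by (induction I rule: infinite_finite_induct) (auto intro: poly_value_mult)

lemma symrec_poly_value:
  assumes "\<And>a k. k \<in> set l \<Longrightarrow> a \<in> A \<Longrightarrow> poly_value (g a k) (g' a k)"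
    and "\<And>a b. a \<in> A \<Longrightarrow> b \<in> A \<Longrightarrow> a \<noteq> b \<Longrightarrow> poly_value (\<rho> a b) (\<rho>' a b)"
  shows "poly_value (symrec g \<rho> A l) (symrec g' \<rho>' A l)"
  using assms
proof (induction l arbitrary: A)
  case (Cons k l)
  show ?case unfolding symrec.simps
    by (intro poly_value_sum poly_value_mult poly_value_prod Cons.IH Cons.prems) auto
qed (simp add: poly_value_one)

lemma fps_const_sum: "fps_const (\<Sum>i\<in>I. f i) = (\<Sum>i\<in>I. fps_const (f i))"
  by (rule fps_ext) (simp add: fps_sum_nth)

lemma isum_shift: "tame x \<Longrightarrow> isum x = x 0 + isum (\<lambda>n. x (Suc n))"
proof (rule fps_ext)
  fix d assume x: "tame x"
  have "isum x $ d = (\<Sum>n\<le>Suc d. x n $ d)" by (rule isum_nth_superset[OF x]) simp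
  then show "isum x $ d = (x 0 + isum (\<lambda>n. x (Suc n))) $ d"
    by (simp only: sum.atMost_Suc_shift fps_add_nth isum_nth)
qed

text \<open>This is T^n P(1/T) for P = prod_j a_j (1 - c_j z): the coefficients are read in reverse
  order.\<close>

lemma sum_coeff_prod_linear:
  fixes T :: "'a::field fps"
  shows "(\<Sum>s\<le>n. fps_const (coeff (\<Prod>j<n. Polynomial.smult (a j) [:1, - c j:]) s) * T ^ (n - s)) =
    (\<Prod>j<n. fps_const (a j) * (T - fps_const (c j)))"
proof (induction n)
  case (Suc n)
  define P where "P = (\<Prod>j<n. Polynomial.smult (a j) [:1, - c j:])"
  have "degree P \<le> sum (degree \<circ> (\<lambda>j. Polynomial.smult (a j) [:1, - c j:])) {..<n}"
    unfolding P_def by (rule degree_prod_sum_le) simp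
  also have "\<dots> \<le> (\<Sum>j<n. 1)" by (intro sum_mono) auto
  finally have P: "coeff P (Suc n) = 0" by (intro coeff_eq_0) simp
  have co: "coeff (P * Polynomial.smult (a n) [:1, - c n:]) s =
      a n * coeff P s - a n * c n * (if s = 0 then 0 else coeff P (s - 1))" for s
    by (cases s) (simp_all add: mult.commute[of P] algebra_simps)
  have "(\<Sum>s\<le>Suc n. fps_const (coeff (P * Polynomial.smult (a n) [:1, - c n:]) s) * T ^ (Suc n - s)) =
    fps_const (a n) * (\<Sum>s\<le>Suc n. fps_const (coeff P s) * T ^ (Suc n - s)) -
    fps_const (a n * c n) * (\<Sum>s\<le>Suc n. fps_const (if s = 0 then 0 else coeff P (s - 1)) * T ^ (Suc n - s))"
    unfolding co sum_distrib_left sum_subtractf[symmetric]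
    by (intro sum.cong refl) (simp add: algebra_simps flip: fps_const_mult fps_const_sub)
  also have "(\<Sum>s\<le>Suc n. fps_const (coeff P s) * T ^ (Suc n - s)) = T * (\<Sum>s\<le>n. fps_const (coeff P s) * T ^ (n - s))"
    using P by (simp add: sum_distrib_left Suc_diff_le mult_ac)
  also have "(\<Sum>s\<le>Suc n. fps_const (if s = 0 then 0 else coeff P (s - 1)) * T ^ (Suc n - s)) =
      (\<Sum>s\<le>n. fps_const (coeff P s) * T ^ (n - s))"
    by (subst sum.atMost_Suc_shift) simp
  finally show ?case
    using Suc.IH by (simp add: P_def algebra_simps flip: fps_const_mult)
qed simp

section \<open>Values of the coefficient series at the variables\<close>

context
  fixes b :: "'a::field_char_0" and c :: "nat \<Rightarrow> 'a" and x :: "nat \<Rightarrow> 'a"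
begin

definition xt :: "nat \<Rightarrow> 'a fps" where
  "xt k = fps_const (x k) * fps_X"

definition xden :: "nat \<Rightarrow> 'a fps" where
  "xden k = 1 + fps_const (b / 2) * xt k"

definition xbar :: "nat \<Rightarrow> 'a fps" where
  "xbar k = xt k * inverse (xden k)"

definition dcoef :: "nat \<Rightarrow> nat \<Rightarrow> 'a" where
  "dcoef k s = coeff (\<Prod>j<k - 1. Polynomial.smult (1 / (1 + b * c j)) [:1, - c j:]) s"

definition phi_coef :: "nat \<Rightarrow> nat \<Rightarrow> 'a" where
  "phi_coef m i = coeff ([:b / 2, 1:] ^ m) i"

text \<open>The coefficient of z^m is the coefficient of phi_m in the dressed fermion with both
  indices k. The dressing polynomial has degree at most k - 1, so only the modes k - s \<ge> 1
  occur.\<close>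

definition letterQ :: "nat \<Rightarrow> 'a fps" where
  "letterQ k = Abs_fps (\<lambda>m. \<Sum>s<k. dcoef k s * phi_coef m (k - s))"

text \<open>The inner sum expands the factor 1 / (2 + beta/z); it stops at m because (z + beta/2)^m
  has degree m.\<close>

definition letterP :: "nat \<Rightarrow> 'a fps" where
  "letterP k = Abs_fps (\<lambda>m. \<Sum>s<k. dcoef k s * (1 / 2 * (\<Sum>i\<le>m. (- b / 2) ^ i * phi_coef m (k - s + i))))"

definition letter0 :: "'a fps" where
  "letter0 = Abs_fps (\<lambda>m. (b / 2) ^ m)"

lemma xden_inverse: "xden k * inverse (xden k) = 1"
  by (rule inverse_mult_eq_1') (simp add: xden_def xt_def)

lemma xden_nonzero: "xden k \<noteq> 0"
  using xden_inverse[of k] by auto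

lemma xbar_xden: "xbar k * xden k = xt k"
  using xden_inverse[of k] by (simp add: xbar_def mult.assoc mult.commute[of "inverse _"])

lemma xbar_0: "xbar k $ 0 = 0"
  by (simp add: xbar_def xt_def)

lemma xden_1: "xden k * (1 - fps_const (b / 2) * xbar k) = 1"
  using xbar_xden[of k] by (simp add: algebra_simps) (simp add: xden_def)

lemma xden_2: "xden k * (1 + fps_const (b / 2) * xbar k) = 1 + fps_const b * xt k"
proof -
  have "xden k * (1 + fps_const (b / 2) * xbar k) = xden k + fps_const (b / 2) * xt k"
    using xbar_xden[of k] by (simp add: algebra_simps)
  also have "\<dots> = 1 + (fps_const (b / 2) + fps_const (b / 2)) * xt k"
    by (simp add: xden_def algebra_simps)
  finally show ?thesis by (simp only: fps_const_add) simp
qed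

lemma phi_coef_0: "phi_coef 0 i = (if i = 0 then 1 else 0)"
  by (simp add: phi_coef_def)

lemma phi_coef_Suc: "phi_coef (Suc m) i = b / 2 * phi_coef m i + (if i = 0 then 0 else phi_coef m (i - 1))"
  by (cases i) (simp_all add: phi_coef_def)

lemma fps_const_phi_coef_Suc:
  "fps_const (phi_coef (Suc m) 0) = fps_const (b / 2) * fps_const (phi_coef m 0)"
  "fps_const (phi_coef (Suc m) (Suc i)) =
    fps_const (b / 2) * fps_const (phi_coef m (Suc i)) + fps_const (phi_coef m i)"
  by (simp_all add: phi_coef_Suc)

lemma phi_coef_eq_0: "i > m \<Longrightarrow> phi_coef m i = 0"
  unfolding phi_coef_def by (rule coeff_eq_0) (simp add: degree_power_eq)

lemma phi_coef_const: "phi_coef m 0 = (b / 2) ^ m"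
  by (simp add: phi_coef_def coeff_0_power)

text \<open>The sum of (z + beta/2)^m X^m is 1 / (1 - X (z + beta/2)). For X = x / (1 + beta x/2)
  this equals (1 + beta x/2) / (1 - x z), which explains the choice of X.\<close>

lemma isum_phi_coef: "isum (\<lambda>m. fps_const (phi_coef m i) * xbar k ^ m) = xden k * xt k ^ i"
proof (induction i)
  case 0
  let ?F = "isum (\<lambda>m. fps_const (phi_coef m 0) * xbar k ^ m)"
  have "?F = 1 + isum (\<lambda>m. (fps_const (b / 2) * xbar k) * (fps_const (phi_coef m 0) * xbar k ^ m))"
    by (subst isum_shift[OF tame_mult_left[OF tame_power[OF xbar_0]]])
      (simp only: phi_coef_0 fps_const_phi_coef_Suc power_0 power_Suc simp_thms if_True fps_const_1_eq_1 mult_1 mult_ac)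
  also have "\<dots> = 1 + fps_const (b / 2) * xbar k * ?F"
    by (simp only: isum_mult_left[OF tame_mult_left[OF tame_power[OF xbar_0]]])
  finally have "?F * (1 - fps_const (b / 2) * xbar k) = 1" by (simp add: algebra_simps)
  then have "xden k * (?F * (1 - fps_const (b / 2) * xbar k)) = xden k" by simp
  then have "?F * (xden k * (1 - fps_const (b / 2) * xbar k)) = xden k" by (simp only: mult.left_commute)
  then show ?case by (simp add: xden_1)
next
  case (Suc i)
  let ?F = "\<lambda>i. isum (\<lambda>m. fps_const (phi_coef m i) * xbar k ^ m)"
  have "?F (Suc i) = isum (\<lambda>m. (fps_const (b / 2) * xbar k) * (fps_const (phi_coef m (Suc i)) * xbar k ^ m)
      + xbar k * (fps_const (phi_coef m i) * xbar k ^ m))"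
    by (subst isum_shift[OF tame_mult_left[OF tame_power[OF xbar_0]]])
      (simp add: phi_coef_0 fps_const_phi_coef_Suc algebra_simps del: fps_const_mult fps_const_add)
  also have "\<dots> = fps_const (b / 2) * xbar k * ?F (Suc i) + xbar k * ?F i"
    by (simp only: isum_add isum_mult_left[OF tame_mult_left[OF tame_power[OF xbar_0]]])
  finally have "?F (Suc i) * (1 - fps_const (b / 2) * xbar k) = xbar k * ?F i" by (simp add: algebra_simps)
  then have "xden k * (?F (Suc i) * (1 - fps_const (b / 2) * xbar k)) = xden k * (xbar k * ?F i)" by simp
  then have "?F (Suc i) * (xden k * (1 - fps_const (b / 2) * xbar k)) = (xbar k * xden k) * ?F i" by (simp only: mult_ac)
  then show ?case unfolding xden_1 xbar_xden Suc.IH by (simp add: mult_ac)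
qed

lemma compose_Abs_fps: "fps_compose (Abs_fps f) X = isum (\<lambda>m. fps_const (f m) * X ^ m)"
  using isum_compose[of "Abs_fps f" X] by simp

lemma sum_dcoef:
  assumes "k \<ge> 1"
  shows "(\<Sum>s<k. fps_const (dcoef k s) * xt a ^ (k - s)) =
    xt a * (\<Prod>j<k - 1. fps_const (1 / (1 + b * c j)) * (xt a - fps_const (c j)))"
proof -
  obtain n where k: "k = Suc n" using assms by (cases k) auto
  have "(\<Sum>s<k. fps_const (dcoef k s) * xt a ^ (k - s)) = xt a * (\<Sum>s\<le>n. fps_const (dcoef k s) * xt a ^ (n - s))"
    by (simp add: k lessThan_Suc_atMost sum_distrib_left Suc_diff_le mult_ac)
  then show ?thesis
    using sum_coeff_prod_linear[where n = n and a = "\<lambda>j. 1 / (1 + b * c j)" and c = c and T = "xt a"] by (simp add: dcoef_def k)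
qed

lemma letterQ_compose:
  assumes "k \<ge> 1"
  shows "fps_compose (letterQ k) (xbar a) =
    xden a * xt a * (\<Prod>j<k - 1. fps_const (1 / (1 + b * c j)) * (xt a - fps_const (c j)))"
proof -
  have "fps_compose (letterQ k) (xbar a) =
      isum (\<lambda>m. \<Sum>s<k. fps_const (dcoef k s) * (fps_const (phi_coef m (k - s)) * xbar a ^ m))"
    unfolding letterQ_def compose_Abs_fps
    by (simp only: fps_const_sum sum_distrib_right mult.assoc fps_const_mult[symmetric])
  also have "\<dots> = (\<Sum>s<k. fps_const (dcoef k s) * (xden a * xt a ^ (k - s)))"
    by (simp only: isum_sum isum_mult_left[OF tame_mult_left[OF tame_power[OF xbar_0]]] isum_phi_coef)
  also have "\<dots> = xden a * (\<Sum>s<k. fps_const (dcoef k s) * xt a ^ (k - s))"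
    by (simp add: sum_distrib_left mult_ac)
  finally show ?thesis by (simp add: sum_dcoef[OF assms] mult.assoc)
qed

text \<open>The geometric series in -beta x/2 cancels the factor 1 + beta x/2. So GP gets x where GQ
  gets x \<oplus> x.\<close>

lemma isum_letterP:
  "isum (\<lambda>m. fps_const (\<Sum>i\<le>m. (- b / 2) ^ i * phi_coef m (n + i)) * xbar a ^ m) = xt a ^ n"
proof -
  have "isum (\<lambda>m. fps_const (\<Sum>i\<le>m. (- b / 2) ^ i * phi_coef m (n + i)) * xbar a ^ m) =
    isum (\<lambda>i. fps_const ((- b / 2) ^ i) * isum (\<lambda>m. fps_const (phi_coef m (n + i)) * xbar a ^ m))"
  proof (rule fps_ext)
    fix d
    have "isum (\<lambda>m. fps_const (\<Sum>i\<le>m. (- b / 2) ^ i * phi_coef m (n + i)) * xbar a ^ m) $ d =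
      (\<Sum>m\<le>d. \<Sum>i\<le>m. (- b / 2) ^ i * (phi_coef m (n + i) * (xbar a ^ m) $ d))"
      by (simp add: isum_nth sum_distrib_right mult.assoc)
    also have "\<dots> = (\<Sum>m\<le>d. \<Sum>i\<le>d. (- b / 2) ^ i * (phi_coef m (n + i) * (xbar a ^ m) $ d))"
      by (intro sum.cong refl sum.mono_neutral_left) (auto simp: phi_coef_eq_0)
    also have "\<dots> = (\<Sum>i\<le>d. (- b / 2) ^ i * (\<Sum>m\<le>d. phi_coef m (n + i) * (xbar a ^ m) $ d))"
      by (subst sum.swap) (simp add: sum_distrib_left)
    finally show "isum (\<lambda>m. fps_const (\<Sum>i\<le>m. (- b / 2) ^ i * phi_coef m (n + i)) * xbar a ^ m) $ d =
      isum (\<lambda>i. fps_const ((- b / 2) ^ i) * isum (\<lambda>m. fps_const (phi_coef m (n + i)) * xbar a ^ m)) $ d"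
      by (simp add: isum_nth)
  qed
  also have "\<dots> = isum (\<lambda>i. (fps_const ((- b / 2) ^ i) * xt a ^ i) * (xden a * xt a ^ n))"
    unfolding isum_phi_coef by (simp only: power_add mult_ac)
  also have "\<dots> = isum (\<lambda>i. fps_const ((- b / 2) ^ i) * xt a ^ i) * (xden a * xt a ^ n)"
    by (rule isum_mult) (rule tame_mult_left, rule tame_power, simp add: xt_def)
  also have "isum (\<lambda>i. fps_const ((- b / 2) ^ i) * xt a ^ i) * xden a = 1"
  proof -
    let ?g = "\<lambda>i. fps_const ((- b / 2) ^ i) * xt a ^ i"
    have aux: "S * (1 + h * T) = 1" if "S - c * T * S = 1" "c = - h" for S T c h :: "'a fps"
      using that by (simp add: algebra_simps)
    have t: "tame ?g" by (rule tame_mult_left, rule tame_power) (simp add: xt_def)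
    have "?g (Suc i) = (fps_const (- b / 2) * xt a) * ?g i" for i
      unfolding power_Suc fps_const_mult[symmetric] by (simp only: mult_ac)
    then have "isum ?g = ?g 0 + isum (\<lambda>i. (fps_const (- b / 2) * xt a) * ?g i)"
      using isum_shift[OF t] by (simp only:)
    also have "?g 0 = 1" by simp
    also have "isum (\<lambda>i. (fps_const (- b / 2) * xt a) * ?g i) = fps_const (- b / 2) * xt a * isum ?g"
      by (rule isum_mult_left[OF t])
    finally have "isum ?g = 1 + fps_const (- b / 2) * xt a * isum ?g" .
    then have "isum ?g - fps_const (- b / 2) * xt a * isum ?g = 1"
      by (rule iffD2[OF diff_eq_eq])
    moreover have "fps_const (- b / 2) = - fps_const (b / 2)" by simp
    ultimately have "isum ?g * (1 + fps_const (b / 2) * xt a) = 1" by (rule aux)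
    then show ?thesis by (simp only: xden_def)
  qed
  then have "isum (\<lambda>i. fps_const ((- b / 2) ^ i) * xt a ^ i) * (xden a * xt a ^ n) = xt a ^ n"
    by (simp flip: mult.assoc)
  finally show ?thesis .
qed

lemma letterP_compose:
  assumes "k \<ge> 1"
  shows "2 * fps_compose (letterP k) (xbar a) =
    xt a * (\<Prod>j<k - 1. fps_const (1 / (1 + b * c j)) * (xt a - fps_const (c j)))"
proof -
  have "fps_compose (letterP k) (xbar a) = isum (\<lambda>m. \<Sum>s<k. fps_const (dcoef k s * (1 / 2)) *
      (fps_const (\<Sum>i\<le>m. (- b / 2) ^ i * phi_coef m (k - s + i)) * xbar a ^ m))"
    unfolding letterP_def compose_Abs_fps
    by (intro arg_cong[where f = isum] ext)
      (simp only: fps_const_sum[where I = "{..<k}"] sum_distrib_right mult.assoc fps_const_mult[symmetric])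
  also have "\<dots> = (\<Sum>s<k. fps_const (dcoef k s * (1 / 2)) * xt a ^ (k - s))"
    by (simp only: isum_sum isum_mult_left[OF tame_mult_left[OF tame_power[OF xbar_0]]] isum_letterP)
  also have "\<dots> = fps_const (1 / 2) * (\<Sum>s<k. fps_const (dcoef k s) * xt a ^ (k - s))"
    unfolding fps_const_mult[symmetric] by (simp only: sum_distrib_left mult_ac)
  finally have "2 * fps_compose (letterP k) (xbar a) =
      (2 * fps_const (1 / 2)) * (\<Sum>s<k. fps_const (dcoef k s) * xt a ^ (k - s))"
    by (simp only: mult.assoc)
  also have "2 * fps_const (1 / 2) = (1 :: 'a fps)" by (simp add: numeral_fps_const)
  finally show ?thesis by (simp add: sum_dcoef[OF assms])
qed

text \<open>What one raising exponential contributes to a letter at X_k: (1 - beta X/2) / (1 + beta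
  X/2) = 1 / (1 + beta x).\<close>

lemma qgen_compose: "fps_compose (qgen (- b / 2)) (xbar k) * (1 + fps_const b * xt k) = 1"
proof -
  have "fps_compose ((1 - fps_const (- b / 2) * fps_X) * qgen (- b / 2)) (xbar k) =
      fps_compose (1 + fps_const (- b / 2) * fps_X) (xbar k)"
    by (simp only: qgen_mult)
  then have "(1 + fps_const (b / 2) * xbar k) * fps_compose (qgen (- b / 2)) (xbar k) = 1 - fps_const (b / 2) * xbar k"
    using xbar_0[of k]
    by (simp add: fps_compose_mult_distrib fps_compose_add_distrib fps_compose_sub_distrib flip: fps_const_neg)
  then have "xden k * ((1 + fps_const (b / 2) * xbar k) * fps_compose (qgen (- b / 2)) (xbar k)) = 1"
    using xden_1 by simp
  then show ?thesis by (simp only: mult.assoc[symmetric] xden_2) (simp add: mult.commute)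
qed

text \<open>What exp(H) yields on passing one raising exponential; the same computation with the
  inverse quotient.\<close>

lemma ev_at_plus: "ev_at (b / 2) (qgen (xbar k)) = 1 + fps_const b * xt k"
proof -
  have "xden k * ((1 - fps_const (b / 2) * xbar k) * ev_at (b / 2) (qgen (xbar k))) = xden k * (1 + fps_const (b / 2) * xbar k)"
    by (simp only: ev_at_qgen[OF xbar_0])
  then show ?thesis by (simp only: mult.assoc[symmetric] xden_1 xden_2) simp
qed

lemma ev_at_minus: "ev_at (- b / 2) (qgen (xbar k)) * (1 + fps_const b * xt k) = 1"
proof -
  have "xden k * ((1 - fps_const (- b / 2) * xbar k) * ev_at (- b / 2) (qgen (xbar k))) = xden k * (1 + fps_const (- b / 2) * xbar k)"
    by (simp only: ev_at_qgen[OF xbar_0])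
  moreover have "fps_const (- b / 2) = - fps_const (b / 2)" by simp
  ultimately have "xden k * (1 + fps_const (b / 2) * xbar k) * ev_at (- b / 2) (qgen (xbar k)) = xden k * (1 - fps_const (b / 2) * xbar k)"
    by (simp only: mult.assoc mult_minus_left diff_minus_eq_add add_uminus_conv_diff)
  then show ?thesis unfolding xden_1 xden_2 by (simp only: mult.commute)
qed

text \<open>1 / (1 - beta z/2) times (1 - beta z/2) / (1 + beta z/2).\<close>

lemma letter0_twisted: "letter0 * qgen (- b / 2) = Abs_fps (\<lambda>m. (- b / 2) ^ m)"
proof -
  have "(1 - fps_const (- b / 2) * fps_X) * (letter0 * qgen (- b / 2)) =
      letter0 * (1 + fps_const (- b / 2) * fps_X)"
    by (simp only: qgen_mult mult.left_commute)
  also have "\<dots> = (1 - fps_const (b / 2) * fps_X) * geo (b / 2)"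
    by (simp add: letter0_def geo_def mult.commute flip: fps_const_neg)
  also have "\<dots> = (1 - fps_const (- b / 2) * fps_X) * geo (- b / 2)"
    by (simp only: geo_mult)
  finally have "letter0 * qgen (- b / 2) = geo (- b / 2)" by (rule one_minus_cancel)
  then show ?thesis by (simp only: geo_def)
qed

definition ham_series :: "nat \<Rightarrow> 'a fps fps" where
  "ham_series n = Abs_fps (\<lambda>m. if odd m then fps_const (2 / of_nat m) * (\<Sum>k<n. xbar k ^ m) else 0)"

lemma ham_series_tame: "tame (fps_nth (ham_series n))"
  unfolding tame_def ham_series_def by (auto simp: fps_sum_nth fps_pow_nth_eq_0 xbar_0)

lemma ham_series_expo:
  "fps_expo (\<lambda>k. fps_const (1 / of_nat (fact k))) (ham_series n) = (\<Prod>k<n. qgen (xbar k))"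
proof (rule fps_expo_eq_prod_qgen[OF fact_inv_fps])
  fix m
  have "of_nat m * (fps_const (2 / of_nat m) * z) = 2 * z" if "odd m" for z :: "'a fps"
  proof -
    have "of_nat m * fps_const (2 / of_nat m :: 'a) = 2"
      using that by (cases "m = 0") (simp_all add: fps_of_nat[symmetric] numeral_fps_const)
    then show ?thesis by (simp add: mult.assoc[symmetric])
  qed
  then show "of_nat m * ham_series n $ m = (if odd m then 2 * (\<Sum>k<n. xbar k ^ m) else 0)"
    by (simp add: ham_series_def)
qed (simp_all add: ham_series_def)

lemma ham_series_0: "ham_series n $ 0 = 0"
  by (simp add: ham_series_def)

lemma ham_series_exp_ev_at: "expi (ev_at (b / 2) (ham_series n)) = (\<Prod>k<n. 1 + fps_const b * xt k)"
  unfolding expi_ev_at[OF ham_series_tame ham_series_0] ham_series_expo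
  by (subst ev_at_prod) (simp_all add: tame_qgen xbar_0 ev_at_plus)

text \<open>The quotient (X_k + X_l) / (X_k - X_l) at x_k t and x_l t. One factor t cancels, so it
  is a polynomial in t.\<close>

definition ratio :: "nat \<Rightarrow> nat \<Rightarrow> 'a fps" where
  "ratio k l = fps_const (1 / (x k - x l)) * (fps_const (x k + x l) + fps_const (b * x k * x l) * fps_X)"

lemma ratio_eq:
  assumes "x k \<noteq> x l"
  shows "ratio k l * (xbar k - xbar l) = xbar k + xbar l"
proof -
  have X: "fps_X * ratio k l * fps_const (x k - x l) = xt k + xt l + fps_const b * xt k * xt l"
  proof -
    have 1: "fps_const (1 / (x k - x l)) * fps_const (x k - x l) = 1" using assms by simp
    have "fps_X * ratio k l * fps_const (x k - x l) = (fps_const (1 / (x k - x l)) * fps_const (x k - x l)) *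
        (fps_X * (fps_const (x k + x l) + fps_const (b * x k * x l) * fps_X))"
      unfolding ratio_def by (simp only: mult_ac)
    also have "\<dots> = fps_X * (fps_const (x k + x l) + fps_const (b * x k * x l) * fps_X)"
      unfolding 1 by simp
    also have "\<dots> = xt k + xt l + fps_const b * xt k * xt l"
      by (simp add: xt_def algebra_simps flip: fps_const_mult fps_const_add)
    finally show ?thesis .
  qed
  have "xden k * xden l * (ratio k l * (xbar k - xbar l)) = ratio k l * (xbar k * xden k * xden l - xbar l * xden l * xden k)"
    by (simp add: algebra_simps)
  also have "\<dots> = ratio k l * (xt k - xt l)"
    unfolding xbar_xden by (simp add: xden_def algebra_simps)
  also have "\<dots> = fps_X * ratio k l * fps_const (x k - x l)"
    by (simp add: xt_def algebra_simps flip: fps_const_sub)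
  also have "\<dots> = xt k + xt l + (fps_const (b / 2) + fps_const (b / 2)) * xt k * xt l"
    unfolding X by (simp only: fps_const_add) simp
  also have "\<dots> = xt k * xden l + xt l * xden k"
    by (simp add: xden_def algebra_simps)
  also have "\<dots> = xden k * xden l * (xbar k + xbar l)"
    unfolding xbar_xden[symmetric] by (simp add: algebra_simps)
  finally show ?thesis using xden_nonzero by simp
qed

lemma xbar_nonzero: "x k \<noteq> 0 \<Longrightarrow> xbar k \<noteq> 0"
  using xbar_xden[of k] by (auto simp: xt_def)

lemma xbar_inj:
  assumes "x k \<noteq> x l" shows "xbar k \<noteq> xbar l"
proof
  assume eq: "xbar k = xbar l"
  have "xt k * xden l = xt l * xden k" unfolding xbar_xden[symmetric] eq by (simp add: mult_ac)
  then have "xt k = xt l" by (simp add: xden_def algebra_simps)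
  then have "fps_X * fps_const (x k) = fps_X * fps_const (x l)" by (simp add: xt_def mult.commute)
  with assms show False by simp
qed

section \<open>The normalized amplitude and its recursion\<close>

definition end_letters :: "nat list \<Rightarrow> 'a fps list" where
  "end_letters l = (if even (length l) then [] else [letter0])"

text \<open>The word series with a factor prod_k (1 + beta x_k) for each raising exponential. The
  variables are a parameter because the recursion removes them; the end letters \<open>E\<close> are
  a parameter because they stay while \<open>l\<close> becomes shorter.\<close>

definition amplitude :: "nat set \<Rightarrow> (nat \<Rightarrow> 'a fps) \<Rightarrow> 'a fps list \<Rightarrow> nat list \<Rightarrow> 'a fps" where
  "amplitude A L E l = (\<Prod>k\<in>A. 1 + fps_const b * xt k) ^ length (map L l @ E) *
     word_series (twisted_letters (qgen (- b / 2)) (map L l @ E)) (schurQ (\<Prod>k\<in>A. qgen (xbar k)))"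

text \<open>The fermion phi_0 contributes prod_k 1 / (1 + beta x_k), which its own normalizing
  factor cancels. So the recursion ends in 1 for both parities.\<close>

lemma amplitude_Nil:
  assumes "E = [] \<or> E = [letter0]" "finite A"
  shows "amplitude A L E [] = 1"
  using assms(1)
proof
  assume "E = []"
  then show ?thesis by (simp add: amplitude_def schurQ_def)
next
  assume E: "E = [letter0]"
  have "amplitude A L E [] = (\<Prod>k\<in>A. 1 + fps_const b * xt k) * ev_at (- b / 2) (\<Prod>k\<in>A. qgen (xbar k))"
  proof -
    have "twisted_letters (qgen (- b / 2)) (map L [] @ [letter0]) = [Abs_fps (\<lambda>m. (- b / 2) ^ m)]"
      using letter0_twisted by simp
    then show ?thesis unfolding amplitude_def E by (simp only: word_series_zero_letter) simp
  qed
  also have "\<dots> = (\<Prod>k\<in>A. ev_at (- b / 2) (qgen (xbar k)) * (1 + fps_const b * xt k))"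
    by (subst ev_at_prod) (simp_all add: tame_qgen xbar_0 prod.distrib mult.commute)
  also have "\<dots> = 1" by (simp only: ev_at_minus prod.neutral_const)
  finally show ?thesis .
qed

text \<open>At the pole of x_k the first letter has \<open>Suc N\<close> factors 1 / (1 + beta x_k),
  which remove x_k from the normalization. Of the \<open>Suc N\<close> products over
  \<open>A - {k}\<close> that are left, \<open>N\<close> normalize the shorter amplitude and one
  joins the ratios.\<close>

lemma amplitude_Cons:
  assumes A: "finite A" and x0: "\<And>k. k \<in> A \<Longrightarrow> x k \<noteq> 0" and inj: "inj_on x A" and L: "L p $ 0 = 0"
  shows "amplitude A L E (p # l) = (\<Sum>k\<in>A. 2 * fps_compose (L p) (xbar k) *
     (\<Prod>j\<in>A - {k}. ratio k j * (1 + fps_const b * xt j)) * amplitude (A - {k}) L E l)"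
proof -
  define f where "f = qgen (- b / 2)"
  define N where "N = length (map L l @ E)"
  define M where "M B = (\<Prod>k\<in>B. 1 + fps_const b * xt k)" for B
  define W where "W B = word_series (twisted_letters f (map L l @ E)) (schurQ (\<Prod>k\<in>B. qgen (xbar k)))" for B
  have x: "x k \<noteq> x j" if "k \<in> A" "j \<in> A" "k \<noteq> j" for k j
    using inj that by (auto simp: inj_on_def)
  have "amplitude A L E (p # l) = M A ^ Suc N * word_series (L p * f ^ Suc N # twisted_letters f (map L l @ E))
      (schurQ (\<Prod>k\<in>A. qgen (xbar k)))"
    by (simp add: amplitude_def M_def N_def f_def)
  also have "word_series (L p * f ^ Suc N # twisted_letters f (map L l @ E)) (schurQ (\<Prod>k\<in>A. qgen (xbar k))) =
      (\<Sum>k\<in>A. 2 * (\<Prod>j\<in>A - {k}. ratio k j) * fps_compose (L p * f ^ Suc N) (xbar k) * W (A - {k}))"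
    unfolding W_def
  proof (rule word_series_recursion[OF A])
    show "inj_on xbar A" using x xbar_inj unfolding inj_on_def by metis
    show "(L p * f ^ Suc N) $ 0 = 0" by (simp add: L fps_mult_nth_0)
  qed (use x0 x in \<open>auto simp: xbar_nonzero xbar_0 ratio_eq\<close>)
  also have "M A ^ Suc N * \<dots> = (\<Sum>k\<in>A. 2 * fps_compose (L p) (xbar k) *
     (\<Prod>j\<in>A - {k}. ratio k j * (1 + fps_const b * xt j)) * amplitude (A - {k}) L E l)"
    unfolding sum_distrib_left
  proof (rule sum.cong[OF refl])
    fix k assume k: "k \<in> A"
    have MA: "M A = (1 + fps_const b * xt k) * M (A - {k})"
      unfolding M_def by (rule prod.remove[OF A k])
    have "fps_compose (L p * f ^ Suc N) (xbar k) = fps_compose (L p) (xbar k) * fps_compose f (xbar k) ^ Suc N"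
      using xbar_0[of k] by (simp add: fps_compose_mult_distrib fps_compose_power)
    then have "M A ^ Suc N * fps_compose (L p * f ^ Suc N) (xbar k) =
        fps_compose (L p) (xbar k) * (fps_compose f (xbar k) * (1 + fps_const b * xt k)) ^ Suc N * M (A - {k}) ^ Suc N"
      unfolding MA power_mult_distrib by (simp only: mult_ac)
    then have 1: "M A ^ Suc N * fps_compose (L p * f ^ Suc N) (xbar k) =
        fps_compose (L p) (xbar k) * M (A - {k}) * M (A - {k}) ^ N"
      unfolding f_def qgen_compose by (simp add: mult.assoc)
    have "M A ^ Suc N * (2 * (\<Prod>j\<in>A - {k}. ratio k j) * fps_compose (L p * f ^ Suc N) (xbar k) * W (A - {k})) =
       2 * (\<Prod>j\<in>A - {k}. ratio k j) * (M A ^ Suc N * fps_compose (L p * f ^ Suc N) (xbar k)) * W (A - {k})"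
      by (simp only: mult_ac)
    also have "\<dots> = 2 * fps_compose (L p) (xbar k) * ((\<Prod>j\<in>A - {k}. ratio k j) * M (A - {k})) * (M (A - {k}) ^ N * W (A - {k}))"
      unfolding 1 by (simp only: mult_ac)
    also have "(\<Prod>j\<in>A - {k}. ratio k j) * M (A - {k}) = (\<Prod>j\<in>A - {k}. ratio k j * (1 + fps_const b * xt j))"
      by (simp add: M_def prod.distrib)
    also have "M (A - {k}) ^ N * W (A - {k}) = amplitude (A - {k}) L E l"
      by (simp add: amplitude_def M_def N_def W_def f_def)
    finally show "M A ^ Suc N * (2 * (\<Prod>j\<in>A - {k}. ratio k j) * fps_compose (L p * f ^ Suc N) (xbar k) * W (A - {k})) =
        2 * fps_compose (L p) (xbar k) * (\<Prod>j\<in>A - {k}. ratio k j * (1 + fps_const b * xt j)) * amplitude (A - {k}) L E l" .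
  qed
  finally show ?thesis .
qed

lemma amplitude_eq_symrec:
  assumes "finite A" "\<And>k. k \<in> A \<Longrightarrow> x k \<noteq> 0" "inj_on x A" "\<And>p. p \<in> set l \<Longrightarrow> L p $ 0 = 0"
    "E = [] \<or> E = [letter0]"
  shows "amplitude A L E l = symrec (\<lambda>k p. 2 * fps_compose (L p) (xbar k)) (\<lambda>k j. ratio k j * (1 + fps_const b * xt j)) A l"
  using assms(1-4)
proof (induction l arbitrary: A)
  case (Cons p l)
  have "amplitude (A - {k}) L E l = symrec (\<lambda>k p. 2 * fps_compose (L p) (xbar k)) (\<lambda>k j. ratio k j * (1 + fps_const b * xt j)) (A - {k}) l"
    for k using Cons.prems by (intro Cons.IH) (auto simp: inj_on_def)
  then show ?case
    unfolding symrec.simps using amplitude_Cons[where L = L and p = p and l = l and E = E and A = A] Cons.prems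
    by simp
qed (use assms(5) in \<open>simp add: amplitude_Nil\<close>)

section \<open>Specialization at t = 1\<close>

lemma poly_value_xt: "poly_value (xt k) (x k)"
  using poly_value_mult[OF poly_value_const poly_value_X, of "x k"] by (simp add: xt_def)

lemma poly_value_bracket:
  "poly_value (\<Prod>j<n. fps_const (1 / (1 + b * c j)) * (xt k - fps_const (c j))) (\<Prod>j<n. ominus b (x k) (c j))"
proof (rule poly_value_prod)
  fix j
  show "poly_value (fps_const (1 / (1 + b * c j)) * (xt k - fps_const (c j))) (ominus b (x k) (c j))"
    using poly_value_mult[OF poly_value_const[of "1 / (1 + b * c j)"] poly_value_diff[OF poly_value_xt[of k] poly_value_const[of "c j"]]]
    by (simp add: ominus_def)
qed

text \<open>The 2 of the partial fractions completes (1 + beta x/2) x to x \<oplus> x.\<close>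

lemma poly_value_letterQ:
  assumes "p \<ge> 1"
  shows "poly_value (2 * fps_compose (letterQ p) (xbar k)) (dbracket b c (x k) p)"
proof -
  have "poly_value (2 * (xden k * xt k * (\<Prod>j<p - 1. fps_const (1 / (1 + b * c j)) * (xt k - fps_const (c j)))))
      (2 * ((1 + b / 2 * x k) * x k * (\<Prod>j<p - 1. ominus b (x k) (c j))))"
    unfolding xden_def
    by (intro poly_value_mult poly_value_add poly_value_numeral poly_value_one poly_value_const poly_value_xt poly_value_bracket)
  also have "2 * ((1 + b / 2 * x k) * x k * (\<Prod>j<p - 1. ominus b (x k) (c j))) = dbracket b c (x k) p"
    by (simp add: dbracket_def oplus_def algebra_simps)
  finally show ?thesis by (simp only: letterQ_compose[OF assms])
qed

lemma poly_value_letterP: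
  assumes "p \<ge> 1"
  shows "poly_value (2 * fps_compose (letterP p) (xbar k)) (x k * bracket b c (x k) (p - 1))"
  unfolding letterP_compose[OF assms] bracket_def
  by (intro poly_value_mult poly_value_xt poly_value_bracket)

lemma poly_value_ratio:
  "poly_value (ratio k j * (1 + fps_const b * xt j)) (oplus b (x k) (x j) / ominus b (x k) (x j))"
proof -
  have "poly_value (ratio k j * (1 + fps_const b * xt j))
      (1 / (x k - x j) * ((x k + x j) + b * x k * x j * 1) * (1 + b * x j))"
    unfolding ratio_def
    by (intro poly_value_mult poly_value_add poly_value_one poly_value_const poly_value_xt poly_value_X)
  then show ?thesis by (simp add: oplus_def ominus_def)
qed

lemma letterQ_0: "letterQ p $ 0 = 0"
  by (simp add: letterQ_def phi_coef_0)

lemma letterP_0: "letterP p $ 0 = 0"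
  by (simp add: letterP_def phi_coef_0)

lemma amplitude_GQ:
  assumes x0: "\<And>k. k < n \<Longrightarrow> x k \<noteq> 0" and inj: "inj_on x {..<n}" and l: "length l \<le> n" "0 \<notin> set l"
  shows "poly_value (amplitude {..<n} letterQ (end_letters l) l) (GQ_finite b c l n x)"
proof -
  have "amplitude {..<n} letterQ (end_letters l) l =
      symrec (\<lambda>k p. 2 * fps_compose (letterQ p) (xbar k)) (\<lambda>k j. ratio k j * (1 + fps_const b * xt j)) {..<n} l"
    by (rule amplitude_eq_symrec) (use x0 inj in \<open>auto simp: end_letters_def letterQ_0\<close>)
  moreover have "GQ_finite b c l n x =
      symrec (\<lambda>i. dbracket b c (x i)) (\<lambda>i j. oplus b (x i) (x j) / ominus b (x i) (x j)) {..<n} l"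
    unfolding GQ_finite_def by (rule symmetrization_eq_symrec[OF l(1)])
  moreover have "p \<ge> 1" if "p \<in> set l" for p using l(2) that by (cases p) auto
  ultimately show ?thesis
    by (simp only:) (intro symrec_poly_value poly_value_letterQ poly_value_ratio, auto)
qed

lemma amplitude_GP:
  assumes x0: "\<And>k. k < n \<Longrightarrow> x k \<noteq> 0" and inj: "inj_on x {..<n}" and l: "length l \<le> n" "0 \<notin> set l"
  shows "poly_value (amplitude {..<n} letterP (end_letters l) l) (GP_finite b c l n x)"
proof -
  have "amplitude {..<n} letterP (end_letters l) l =
      symrec (\<lambda>k p. 2 * fps_compose (letterP p) (xbar k)) (\<lambda>k j. ratio k j * (1 + fps_const b * xt j)) {..<n} l"
    by (rule amplitude_eq_symrec) (use x0 inj in \<open>auto simp: end_letters_def letterP_0\<close>)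
  moreover have "GP_finite b c l n x =
      symrec (\<lambda>i k. x i * bracket b c (x i) (k - 1)) (\<lambda>i j. oplus b (x i) (x j) / ominus b (x i) (x j)) {..<n} l"
    unfolding GP_finite_def by (rule symmetrization_eq_symrec[OF l(1)])
  moreover have "p \<ge> 1" if "p \<in> set l" for p using l(2) that by (cases p) auto
  ultimately show ?thesis
    by (simp only:) (intro symrec_poly_value poly_value_letterP poly_value_ratio, auto)
qed

text \<open>The raising exponentials belong to Y = -beta/2, so the scalar exponential is taken at
  beta/2, where it is the normalizing factor of \<open>amplitude\<close>.\<close>

lemma ham_chain_eq_amplitude:
  assumes V: "bra_like V" and kill: "\<And>w m. m < 0 \<Longrightarrow> V (w @ [m]) = 0" and V1: "V [] = (1 :: 'a)"
  shows "Abs_fps (\<lambda>d. \<Sum>k\<le>d. 1 / of_nat (fact k) *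
      ham (ham_series n) k d (chain (qgen (- b / 2)) (map L l @ end_letters l) V) []) =
    amplitude {..<n} L (end_letters l) l"
proof -
  let ?Cs = "map L l @ end_letters l" and ?G = "\<Prod>k<n. qgen (xbar k)"
  have ev_at: "even (length ?Cs)" by (simp add: end_letters_def)
  have he: "ham_series n $ m = 0" if "even m" for m using that by (simp add: ham_series_def)
  have "Abs_fps (\<lambda>d. \<Sum>k\<le>d. 1 / of_nat (fact k) * ham (ham_series n) k d (chain (qgen (- b / 2)) ?Cs V) []) =
     word_series (twisted_letters (qgen (- b / 2)) ?Cs)
      (\<lambda>w. expi (ev_at (- (- b / 2)) (ham_series n)) ^ length ?Cs * schurQ ?G w)"
    using exp_ham_chain[OF V kill V1 ham_series_tame he ev_at refl] unfolding ham_series_expo word_series_def .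
  also have "\<dots> = expi (ev_at (- (- b / 2)) (ham_series n)) ^ length ?Cs *
      word_series (twisted_letters (qgen (- b / 2)) ?Cs) (schurQ ?G)"
    by (rule word_series_mult) (intro schurQ_tame tame_fps_prod tame_qgen xbar_0)
  also have "ev_at (- (- b / 2)) (ham_series n) = ev_at (b / 2) (ham_series n)" by simp
  finally show ?thesis by (simp only: ham_series_exp_ev_at amplitude_def)
qed

end

section \<open>The scalars\<close>

instance fract :: ("{idom,ring_char_0}") field_char_0
proof
  have "of_nat n = Fraction_Field.Fract (of_nat n) (1 :: 'a)" for n
    by (induction n) (simp_all add: Zero_fract_def One_fract_def add.commute)
  then show "inj (of_nat :: nat \<Rightarrow> 'a fract)"
    by (auto intro!: injI simp: eq_fract)
qed

lemma const_fract_add: "const_fract (a + b) = const_fract a + const_fract b"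
  by (simp add: const_fract_def single_add)

lemma const_fract_mult: "const_fract (a * b) = const_fract a * const_fract b"
  by (simp add: const_fract_def mult_single)

lemma const_fract_0 [simp]: "const_fract 0 = 0"
  by (simp add: const_fract_def Zero_fract_def)

lemma const_fract_1 [simp]: "const_fract 1 = 1"
  by (simp add: const_fract_def One_fract_def)

lemma const_fract_eq_iff [simp]: "const_fract a = const_fract b \<longleftrightarrow> a = b"
proof
  assume "const_fract a = const_fract b"
  then have "Poly_Mapping.single (0 :: nat \<Rightarrow>\<^sub>0 nat) a = Poly_Mapping.single 0 b"
    by (simp add: const_fract_def eq_fract)
  from arg_cong[OF this, of "\<lambda>p. Poly_Mapping.lookup p 0"] show "a = b"
    by (simp only: lookup_single_eq)
qed simp

lemma const_fract_eq_0_iff [simp]: "const_fract a = 0 \<longleftrightarrow> a = 0"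
  using const_fract_eq_iff[of a 0] by simp

lemma const_fract_uminus: "const_fract (- a) = - const_fract a"
  using const_fract_add[of a "- a"] by (simp add: eq_neg_iff_add_eq_0 add.commute)

lemma const_fract_divide: "const_fract (a / b) = const_fract a / const_fract (b :: 'a::field)"
proof (cases "b = 0")
  case False
  then have "const_fract (a / b) * const_fract b = const_fract a"
    by (simp flip: const_fract_mult)
  with False show ?thesis by (simp add: field_simps)
qed simp

lemma const_fract_power: "const_fract (a ^ n) = const_fract a ^ n"
  by (induction n) (simp_all add: const_fract_mult)

lemma const_fract_sum: "const_fract (\<Sum>i\<in>I. f i) = (\<Sum>i\<in>I. const_fract (f i))"
  by (induction I rule: infinite_finite_induct) (simp_all add: const_fract_add)

lemma const_fract_of_nat: "const_fract (of_nat n) = of_nat n"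
  by (induction n) (simp_all add: const_fract_add)

lemma const_fract_numeral: "const_fract (numeral n) = numeral n"
  using const_fract_of_nat[of "numeral n"] by simp

lemma const_fract_sg: "const_fract (sg p) = sg p"
  by (simp add: sg_def const_fract_uminus)

lemma Sum_any_const_fract: "const_fract (Sum_any f) = Sum_any (\<lambda>i. const_fract (f i))"
  by (simp add: Sum_any.expand_set const_fract_sum)

lemma Sum_any_superset:
  assumes "finite A" "\<And>i. i \<notin> A \<Longrightarrow> f i = 0"
  shows "Sum_any f = sum f A"
  by (rule Sum_any.expand_superset) (use assms in auto)

lemma powi_minus_one: "(- 1 :: 'a::field) powi i = sg i"
  by (cases i rule: int_cases2) (simp_all add: power_int_minus sg_nat flip: power_inverse)

section \<open>Bra words\<close>

lemma right_act_mult: "u \<lhd> (a * c) = u \<lhd> a \<lhd> c"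
  by (induction u rule: fock_dual.abs_induct) (simp add: right_act.abs_eq mult.assoc)

lemma right_act_add_right: "u \<lhd> (a + c) = u \<lhd> a + u \<lhd> c"
  by (induction u rule: fock_dual.abs_induct) (simp add: right_act.abs_eq plus_fock_dual.abs_eq distrib_left)

lemma right_act_add_left: "(u + v) \<lhd> a = u \<lhd> a + v \<lhd> a"
  by (induction u rule: fock_dual.abs_induct, induction v rule: fock_dual.abs_induct)
    (simp add: right_act.abs_eq plus_fock_dual.abs_eq distrib_right)

lemma right_act_zero_left: "0 \<lhd> a = 0"
  using right_act_add_left[of 0 0 a] by simp

lemma phi_anticommute:
  "phi m * phi n + phi n * phi m = cliff_scalar (if m + n = 0 then 2 * sg m else 0)"
proof -
  have "cliff_rel m n \<in> cliff_ideal"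
    using cliff_ideal.add[OF cliff_ideal.zero, of 1 m n 1] by simp
  then have "free_gen m * free_gen n + free_gen n * free_gen m -
      Poly_Mapping.single 0 (if m + n = 0 then 2 * sg m else 0) \<in> cliff_ideal"
    by (simp add: cliff_rel_def powi_minus_one cong: if_cong)
  then show ?thesis
    using Quotient3_rel_abs[OF Quotient3_cliff]
    by (simp add: phi.abs_eq times_cliff.abs_eq plus_cliff.abs_eq cliff_scalar_def)
qed

lemma bra_vac_phi: "m > 0 \<Longrightarrow> bra_vac \<lhd> phi m = 0"
  using right_ideal.add[OF right_ideal.zero, of m 1] Quotient3_rel_abs[OF Quotient3_fock_dual]
  by (simp add: bra_vac.abs_eq right_act.abs_eq zero_fock_dual.abs_eq)

lemma phi_ket_vac: "m < 0 \<Longrightarrow> phi m \<rhd> ket_vac = 0"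
  using left_ideal.add[OF left_ideal.zero, of m 1] Quotient3_rel_abs[OF Quotient3_fock]
  by (simp add: ket_vac.abs_eq left_act.abs_eq zero_fock.abs_eq)

definition act_word :: "fock_dual \<Rightarrow> int list \<Rightarrow> fock_dual" where
  "act_word u w = foldl (\<lambda>u m. u \<lhd> phi m) u w"

definition bra :: "int list \<Rightarrow> fock_dual" where
  "bra w = act_word bra_vac w"

lemma act_word_simps [simp]:
  "act_word u [] = u" "act_word u (m # w) = act_word (u \<lhd> phi m) w"
  "act_word u (w @ v) = act_word (act_word u w) v"
  by (simp_all add: act_word_def)

lemma act_word_add: "act_word (u + v) w = act_word u w + act_word v w"
  by (induction w arbitrary: u v) (simp_all add: right_act_add_left)

lemma act_word_scalar: "act_word (u \<lhd> cliff_scalar c) w = act_word u w \<lhd> cliff_scalar c"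
proof (induction w arbitrary: u)
  case (Cons m w)
  have "u \<lhd> cliff_scalar c \<lhd> phi m = u \<lhd> phi m \<lhd> cliff_scalar c"
    by (simp add: cliff_scalar_commute flip: right_act_mult)
  then show ?case by (simp add: Cons.IH)
qed simp

lemma act_word_zero: "act_word 0 w = 0"
  by (induction w) (simp_all add: right_act_zero_left)

lemma bra_Nil [simp]: "bra [] = bra_vac"
  by (simp add: bra_def)

lemma bra_snoc: "bra w \<lhd> phi m = bra (w @ [m])"
  by (simp add: bra_def)

lemma bra_clifford:
  "bra (a @ p # q # b) + bra (a @ q # p # b) = bra (a @ b) \<lhd> cliff_scalar (if p + q = 0 then 2 * sg p else 0)"
proof -
  have "bra (a @ p # q # b) + bra (a @ q # p # b) = act_word (bra a \<lhd> (phi p * phi q + phi q * phi p)) b"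
    by (simp add: bra_def act_word_add right_act_mult right_act_add_right)
  then show ?thesis by (simp add: phi_anticommute act_word_scalar bra_def)
qed

definition vac_word :: "(fock_dual \<Rightarrow> fock \<Rightarrow> qbeta) \<Rightarrow> int list \<Rightarrow> qbeta" where
  "vac_word B w = B (bra w) ket_vac"

context
  fixes B :: "fock_dual \<Rightarrow> fock \<Rightarrow> qbeta"
  assumes B: "fock_pairing B"
begin

lemma B_zero: "B 0 v = 0" "B u 0 = 0"
proof -
  have "B (0 + 0) v = B 0 v + B 0 v" "B u (0 + 0) = B u 0 + B u 0"
    using B unfolding fock_pairing_def by blast+
  then show "B 0 v = 0" "B u 0 = 0" by simp_all
qed

lemma vac_word_bra_like: "bra_like (vac_word B)"
  unfolding bra_like_def
proof (intro conjI allI impI cliffordI)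
  fix a b :: "int list" and p q :: int
  have "vac_word B (a @ p # q # b) + vac_word B (a @ q # p # b) = B (bra (a @ p # q # b) + bra (a @ q # p # b)) ket_vac"
    using B by (simp add: fock_pairing_def vac_word_def)
  also have "\<dots> = (if p + q = 0 then 2 * sg p else 0) * vac_word B (a @ b)"
    using B unfolding bra_clifford by (simp add: fock_pairing_def vac_word_def)
  finally show "vac_word B (a @ p # q # b) + vac_word B (a @ q # p # b) = (if p + q = 0 then 2 * sg p * vac_word B (a @ b) else 0)"
    by simp
next
  fix m :: int and w assume "m > 0"
  then show "vac_word B (m # w) = 0"
    by (simp add: vac_word_def bra_def bra_vac_phi act_word_zero B_zero)
qed

lemma vac_word_kill: "m < 0 \<Longrightarrow> vac_word B (w @ [m]) = 0"
proof -
  assume "m < 0"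
  have "B (bra w \<lhd> phi m) ket_vac = B (bra w) (phi m \<rhd> ket_vac)"
    using B unfolding fock_pairing_def by blast
  then show ?thesis using \<open>m < 0\<close> by (simp add: vac_word_def phi_ket_vac B_zero bra_snoc[symmetric])
qed

lemma vac_word_Nil: "vac_word B [] = 1"
  using B by (simp add: fock_pairing_def vac_word_def)

end

lemma bra_like_const_fract:
  assumes "bra_like W"
  shows "bra_like (\<lambda>w. const_fract (W w))"
  unfolding bra_like_def
proof (intro conjI allI impI cliffordI)
  fix a b :: "int list" and p q :: int
  have "const_fract (W (a @ p # q # b) + W (a @ q # p # b)) = const_fract (if p + q = 0 then 2 * sg p * W (a @ b) else 0)"
    by (simp only: cliffordD[OF bra_like_clifford[OF assms]])
  then show "const_fract (W (a @ p # q # b)) + const_fract (W (a @ q # p # b)) =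
      (if p + q = 0 then 2 * sg p * const_fract (W (a @ b)) else 0)"
    by (auto simp: const_fract_add const_fract_mult const_fract_numeral const_fract_sg split: if_splits)
qed (use assms in \<open>simp add: bra_like_def\<close>)

section \<open>Kets as functions of words\<close>

definition betaX :: xfield where
  "betaX = const_fract betaK"

definition bX :: "nat \<Rightarrow> xfield" where
  "bX j = const_fract (bK j)"

text \<open>The operators of the theorem other than the Hamiltonian only produce series that are constant
  in \<open>x\<close>.\<close>

definition const_ket :: "ket \<Rightarrow> bool" where
  "const_ket F \<longleftrightarrow> (\<forall>u \<alpha>. \<alpha> \<noteq> 0 \<longrightarrow> F u \<alpha> = 0)"

text \<open>For a ket that is constant in x the coefficient at the monomial 1 is everything; it is
  embedded in \<open>xfield\<close>, where the amplitudes live.\<close>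

definition word_ket :: "ket \<Rightarrow> int list \<Rightarrow> xfield" where
  "word_ket F w = const_fract (F (bra w) 0)"

lemma const_ket_sum: "(\<And>i. const_ket (F i)) \<Longrightarrow> const_ket (ket_sum F)"
  by (simp add: const_ket_def ket_sum_def)

lemma const_ket_scale: "const_ket F \<Longrightarrow> const_ket (ket_scale c F)"
  by (simp add: const_ket_def ket_scale_def)

lemma const_ket_act: "const_ket F \<Longrightarrow> const_ket (ket_act a F)"
  by (simp add: const_ket_def ket_act_def)

lemma const_ket_zero: "const_ket (\<lambda>_ _. 0)"
  by (simp add: const_ket_def)

lemma const_ket_phiB: "const_ket F \<Longrightarrow> const_ket (phiB n F)"
  unfolding phiB_def by (auto intro!: const_ket_sum const_ket_scale const_ket_act const_ket_zero)

lemma const_ket_PhiB: "const_ket F \<Longrightarrow> const_ket (PhiB n F)"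
  unfolding PhiB_def by (intro const_ket_sum const_ket_scale const_ket_phiB)

lemma const_ket_dressed: "(\<And>n. const_ket (P n F)) \<Longrightarrow> const_ket (dressed P k i F)"
  unfolding dressed_def by (intro const_ket_sum const_ket_scale)

lemma const_ket_boson: "const_ket F \<Longrightarrow> const_ket (boson n F)"
  unfolding boson_def by (intro const_ket_sum const_ket_scale const_ket_act)

lemma const_ket_theta: "const_ket F \<Longrightarrow> const_ket (theta_star F)"
  unfolding theta_star_def by (intro const_ket_sum const_ket_scale const_ket_boson)

lemma const_ket_exp_theta: "const_ket F \<Longrightarrow> const_ket (ket_exp theta_star F)"
proof -
  assume F: "const_ket F"
  have "const_ket ((theta_star ^^ k) F)" for k
    by (induction k) (simp_all add: F const_ket_theta)
  then show ?thesis unfolding ket_exp_def by (intro const_ket_sum const_ket_scale)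
qed

lemma word_ket_sum:
  assumes "finite A" "\<And>i. i \<notin> A \<Longrightarrow> word_ket (F i) w = 0"
  shows "word_ket (ket_sum F) w = (\<Sum>i\<in>A. word_ket (F i) w)"
proof -
  have "word_ket (ket_sum F) w = Sum_any (\<lambda>i. word_ket (F i) w)"
    by (simp add: word_ket_def ket_sum_def Sum_any_const_fract)
  then show ?thesis using Sum_any_superset[OF assms] by simp
qed

lemma word_ket_scale: "word_ket (ket_scale c F) w = const_fract c * word_ket F w"
  by (simp add: word_ket_def ket_scale_def const_fract_mult)

lemma word_ket_phi: "word_ket (ket_act (phi m) F) w = word_ket F (w @ [m])"
  by (simp add: word_ket_def ket_act_def bra_snoc)

lemma word_ket_phi_phi: "word_ket (ket_act (phi m * phi n) F) w = word_ket F (w @ [m, n])"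
  by (simp add: word_ket_def ket_act_def bra_snoc right_act_mult)

lemma const_fract_phi_coef: "const_fract (coeff ([:betaK / 2, 1:] ^ m) i) = phi_coef betaX m i"
  unfolding phi_coef_def[symmetric]
proof (induction m arbitrary: i)
  case 0
  show ?case by (simp add: phi_coef_0)
next
  case (Suc m)
  show ?case
    unfolding phi_coef_Suc Suc.IH[symmetric]
    by (simp add: const_fract_add const_fract_mult const_fract_divide const_fract_numeral betaX_def)
qed

lemma const_fract_dcoef:
  "const_fract (coeff (\<Prod>j<n. Polynomial.smult (1 / (1 + betaK * bK j)) [:1, - bK j:]) s) =
    coeff (\<Prod>j<n. Polynomial.smult (1 / (1 + betaX * bX j)) [:1, - bX j:]) s"
proof (induction n arbitrary: s)
  case 0
  show ?case by (simp add: coeff_1)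
next
  case (Suc n)
  have "const_fract (coeff (Polynomial.smult (1 / (1 + betaK * bK n)) [:1, - bK n:]) i) =
      coeff (Polynomial.smult (1 / (1 + betaX * bX n)) [:1, - bX n:]) i" for i
    by (simp add: coeff_pCons const_fract_mult const_fract_divide const_fract_add const_fract_uminus
        betaX_def bX_def split: nat.split)
  then show ?case
    by (simp only: prod.lessThan_Suc coeff_mult const_fract_sum const_fract_mult Suc.IH)
qed

lemma word_ket_phiB:
  assumes F: "bra_like (word_ket F)" and N: "N \<ge> nat (- sum_list w)"
  shows "word_ket (phiB (int n) F) w = (\<Sum>m\<le>N. phi_coef betaX m n * word_ket F (w @ [int m]))"
proof -
  have "word_ket (phiB (int n) F) w = (\<Sum>m\<le>N. word_ket (ket_scale (coeff ([:betaK / 2, 1:] ^ m) n) (ket_act (phi (int m)) F)) w)"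
    unfolding phiB_def
  proof (simp, rule word_ket_sum)
    fix m assume "m \<notin> {..N}"
    then have "word_ket F (w @ [int m]) = 0"
      using N by (intro bra_like_pos[OF F]) auto
    then show "word_ket (ket_scale (coeff ([:betaK / 2, 1:] ^ m) n) (ket_act (phi (int m)) F)) w = 0"
      by (simp add: word_ket_scale word_ket_phi)
  qed simp
  then show ?thesis by (simp add: word_ket_scale word_ket_phi const_fract_phi_coef)
qed

text \<open>Both infinite sums stop: the modes because of the total of \<open>w\<close>, the
  expansion of 1 / (2 + beta/z) because (z + beta/2)^m has degree m.\<close>

lemma word_ket_PhiB:
  assumes F: "bra_like (word_ket F)" and n: "n \<ge> 1"
  shows "word_ket (PhiB (int n) F) w = (\<Sum>m\<le>nat (- sum_list w).
    1 / 2 * (\<Sum>i\<le>m. (- betaX / 2) ^ i * phi_coef betaX m (n + i)) * word_ket F (w @ [int m]))"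
proof -
  define N where "N = nat (- sum_list w)"
  have ph: "word_ket (ket_scale ((- betaK / 2) ^ i) (phiB (int n + int i) F)) w =
      (- betaX / 2) ^ i * (\<Sum>m\<le>N. phi_coef betaX m (n + i) * word_ket F (w @ [int m]))" for i
    unfolding of_nat_add[symmetric] word_ket_scale word_ket_phiB[OF F order_refl] N_def
    by (simp add: betaX_def const_fract_power const_fract_divide const_fract_uminus const_fract_numeral)
  have z: "word_ket (ket_scale ((- betaK / 2) ^ i) (phiB (int n + int i) F)) w = 0" if "i \<notin> {..N}" for i
    unfolding ph using that by (auto intro!: sum.neutral simp: phi_coef_eq_0)
  have sm: "word_ket (ket_sum (\<lambda>i. ket_scale ((- betaK / 2) ^ i) (phiB (int n + int i) F))) w =
      (\<Sum>i\<le>N. word_ket (ket_scale ((- betaK / 2) ^ i) (phiB (int n + int i) F)) w)"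
    by (rule word_ket_sum) (simp, rule z)
  have "word_ket (PhiB (int n) F) w = 1 / 2 * (\<Sum>i\<le>N. (- betaX / 2) ^ i * (\<Sum>m\<le>N. phi_coef betaX m (n + i) * word_ket F (w @ [int m])))"
    unfolding PhiB_def word_ket_scale[of "1 / 2"]
    unfolding sm ph by (simp only: const_fract_divide const_fract_numeral const_fract_1)
  also have "\<dots> = (\<Sum>m\<le>N. \<Sum>i\<le>N. 1 / 2 * ((- betaX / 2) ^ i * phi_coef betaX m (n + i) * word_ket F (w @ [int m])))"
    unfolding sum_distrib_left by (subst sum.swap) (simp only: mult.assoc)
  also have "\<dots> = (\<Sum>m\<le>N. \<Sum>i\<le>m. 1 / 2 * ((- betaX / 2) ^ i * phi_coef betaX m (n + i) * word_ket F (w @ [int m])))"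
    by (intro sum.cong refl sum.mono_neutral_right) (auto simp: phi_coef_eq_0)
  finally show ?thesis
    by (simp add: N_def sum_distrib_left sum_distrib_right mult_ac)
qed

text \<open>The dressing polynomial has k - 1 linear factors, so the modes of \<open>P\<close> that
  occur have index at least 1 and the negative ones never enter.\<close>

lemma word_ket_dressed:
  assumes k: "k \<ge> 1"
  shows "word_ket (dressed P k (int k) F) w = (\<Sum>s<k. dcoef betaX bX k s * word_ket (P (int (k - s)) F) w)"
proof -
  have P: "coeff (\<Prod>j<k - 1. Polynomial.smult (1 / (1 + betaK * bK j)) [:1, - bK j:]) s = 0" if "s \<ge> k" for s
  proof (rule coeff_eq_0)
    have "degree (\<Prod>j<k - 1. Polynomial.smult (1 / (1 + betaK * bK j)) [:1, - bK j:]) \<le>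
        sum (degree \<circ> (\<lambda>j. Polynomial.smult (1 / (1 + betaK * bK j)) [:1, - bK j:])) {..<k - 1}"
      by (rule degree_prod_sum_le) simp
    also have "\<dots> \<le> (\<Sum>j<k - 1. 1)" by (intro sum_mono) auto
    finally show "degree (\<Prod>j<k - 1. Polynomial.smult (1 / (1 + betaK * bK j)) [:1, - bK j:]) < s"
      using k that by simp
  qed
  let ?d = "\<lambda>s. coeff (\<Prod>j<k - 1. Polynomial.smult (1 / (1 + betaK * bK j)) [:1, - bK j:]) s"
  have z: "word_ket (ket_scale (?d s) (P (int k - int s) F)) w = 0" if "s \<notin> {..<k}" for s
  proof -
    have "?d s = 0" by (rule P) (use that in simp)
    then show ?thesis by (simp only: word_ket_scale const_fract_0 mult_zero_left)
  qed
  have sm: "word_ket (ket_sum (\<lambda>s. ket_scale (?d s) (P (int k - int s) F))) w =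
      (\<Sum>s<k. word_ket (ket_scale (?d s) (P (int k - int s) F)) w)"
    by (rule word_ket_sum) (simp, rule z)
  show ?thesis unfolding dressed_def sm
  proof (rule sum.cong[OF refl])
    fix s assume "s \<in> {..<k}"
    then have "int k - int s = int (k - s)" by simp
    then show "word_ket (ket_scale (?d s) (P (int k - int s) F)) w = dcoef betaX bX k s * word_ket (P (int (k - s)) F) w"
      by (simp only: word_ket_scale const_fract_dcoef dcoef_def)
  qed
qed

lemma word_ket_dressed_phiB:
  assumes F: "bra_like (word_ket F)" and k: "k \<ge> 1"
  shows "word_ket (dressed phiB k (int k) F) = letter_op (letterQ betaX bX k) (word_ket F)"
proof
  fix w
  show "word_ket (dressed phiB k (int k) F) w = letter_op (letterQ betaX bX k) (word_ket F) w"
    unfolding word_ket_dressed[OF k] word_ket_phiB[OF F order_refl] letter_op_def letterQ_def fps_nth_Abs_fps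
      sum_distrib_left sum_distrib_right
    by (subst sum.swap) (simp only: mult.assoc)
qed

lemma word_ket_dressed_PhiB:
  assumes F: "bra_like (word_ket F)" and k: "k \<ge> 1"
  shows "word_ket (dressed PhiB k (int k) F) = letter_op (letterP betaX bX k) (word_ket F)"
proof
  fix w
  have "word_ket (dressed PhiB k (int k) F) w = (\<Sum>s<k. dcoef betaX bX k s * (\<Sum>m\<le>nat (- sum_list w).
    1 / 2 * (\<Sum>i\<le>m. (- betaX / 2) ^ i * phi_coef betaX m (k - s + i)) * word_ket F (w @ [int m])))"
    unfolding word_ket_dressed[OF k]
    by (intro sum.cong refl arg_cong2[where f = times] word_ket_PhiB[OF F]) simp
  then show "word_ket (dressed PhiB k (int k) F) w = letter_op (letterP betaX bX k) (word_ket F) w"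
    unfolding letter_op_def letterP_def fps_nth_Abs_fps
    by (simp only: sum_distrib_left[of "dcoef _ _ _ _"] sum_distrib_right[of _ _ "word_ket _ _"] mult.assoc)
      (subst sum.swap, simp only:)
qed

lemma word_ket_phiB_0:
  assumes F: "bra_like (word_ket F)"
  shows "word_ket (phiB 0 F) = letter_op (letter0 betaX) (word_ket F)"
  using word_ket_phiB[OF F order_refl, where n = 0]
  by (simp add: fun_eq_iff letter_op_def letter0_def phi_coef_const)

lemma word_ket_boson:
  assumes F: "bra_like (word_ket F)" and n: "odd n"
  shows "word_ket (boson n F) w = 1 / 4 * Bos n (word_ket F) w"
  unfolding boson_def word_ket_scale
  by (subst word_ket_sum[where A = "{sum_list w - n..- sum_list w}"])
    (auto simp: word_ket_scale word_ket_phi_phi Bos_range[OF F n] Bos_def powi_minus_one const_fract_sg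
      const_fract_divide const_fract_numeral)

text \<open>b_(-n) is minus the derivation that raises letters by n. For odd n this sign goes into
  (-beta/2)^n, and the exponential becomes \<open>qgen (- betaX / 2)\<close>.\<close>

definition theta_series :: "xfield fps" where
  "theta_series = Abs_fps (\<lambda>n. if odd n then 2 * (- betaX / 2) ^ n / of_nat n else 0)"

lemma word_ket_theta:
  assumes F: "bra_like (word_ket F)"
  shows "word_ket (theta_star F) = raise_der theta_series (word_ket F)"
proof
  fix w
  let ?N = "nat (- sum_list w)"
  have t: "word_ket (ket_scale (if odd n then 2 * (betaK / 2) ^ n / of_nat n else 0) (boson (- int n) F)) w =
      (- theta_series $ n / 4) * Bos (- int n) (word_ket F) w" for n
    by (simp add: word_ket_scale word_ket_boson[OF F] theta_series_def const_fract_mult const_fract_divide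
        const_fract_power const_fract_of_nat const_fract_numeral betaX_def)
  have 0: "Bos (- int n) (word_ket F) w = 0" if "n \<notin> {..?N}" "odd n" for n
    unfolding Bos_neg[OF F that(2)]
    using that(1) by (auto intro!: shift_der_eq_0 bra_like_pos[OF F])
  have "word_ket (theta_star F) w = (\<Sum>n\<le>?N. (- theta_series $ n / 4) * Bos (- int n) (word_ket F) w)"
    unfolding theta_star_def
    by (subst word_ket_sum[where A = "{..?N}"]) (use 0 in \<open>auto simp: t theta_series_def\<close>)
  then show "word_ket (theta_star F) w = raise_der theta_series (word_ket F) w"
    using raise_der_Bos[OF F _ order_refl, of theta_series w] by (simp add: theta_series_def)
qed

lemma word_ket_exp_theta:
  assumes F: "bra_like (word_ket F)"
  shows "word_ket (ket_exp theta_star F) = raise_op (qgen (- betaX / 2)) (word_ket F)"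
proof
  fix w
  have br: "bra_like ((raise_der theta_series ^^ k) (word_ket F))" for k
    by (induction k) (simp_all add: F raise_der_bra_like theta_series_def)
  have pw: "word_ket ((theta_star ^^ k) F) = (raise_der theta_series ^^ k) (word_ket F)" for k
  proof (induction k)
    case (Suc k)
    have "bra_like (word_ket ((theta_star ^^ k) F))" unfolding Suc.IH by (rule br)
    from word_ket_theta[OF this] show ?case by (simp add: Suc.IH)
  qed simp
  let ?N = "nat (- sum_list w)"
  have h_nth_0: "theta_series $ 0 = 0" by (simp add: theta_series_def)
  have "word_ket (ket_exp theta_star F) w = (\<Sum>k\<le>?N. 1 / of_nat (fact k) * (raise_der theta_series ^^ k) (word_ket F) w)"
    unfolding ket_exp_def
    by (subst word_ket_sum[where A = "{..?N}"])
      (auto simp: word_ket_scale pw raise_der_pow_eq_0[OF h_nth_0] const_fract_divide const_fract_of_nat[of "fact _"] simp del: of_nat_fact)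
  also have "\<dots> = raise_op (fps_expo (\<lambda>k. 1 / of_nat (fact k)) theta_series) (word_ket F) w"
    by (rule exp_raise_der[OF fact_inv_field h_nth_0 order_refl])
  also have "fps_expo (\<lambda>k. 1 / of_nat (fact k)) theta_series = qgen (- betaX / 2)"
  proof -
    have "of_nat n * theta_series $ n = (if odd n then 2 * (\<Sum>k\<in>{0::nat}. (- betaX / 2) ^ n) else 0)" for n
      by (cases "n = 0") (auto simp: theta_series_def)
    from fps_expo_eq_prod_qgen[OF fact_inv_field _ this h_nth_0] show ?thesis by simp
  qed
  finally show "word_ket (ket_exp theta_star F) w = raise_op (qgen (- betaX / 2)) (word_ket F) w" .
qed

lemma letter_op_bra_like:
  assumes W: "bra_like W"
  shows "bra_like (letter_op C W)"
  unfolding letter_op_def using bra_like_append[OF W] by (intro bra_like_sum_cong) auto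

definition vacK :: "(fock_dual \<Rightarrow> fock \<Rightarrow> qbeta) \<Rightarrow> int list \<Rightarrow> xfield" where
  "vacK B w = const_fract (const_fract (vac_word B w))"

lemma word_ket_vac: "word_ket (vac B) = vacK B"
  by (simp add: fun_eq_iff word_ket_def vac_def vacK_def vac_word_def)

text \<open>The claims are proved together along the list, because an operator becomes a finite sum
  on words only if the ket that it acts on is \<open>bra_like\<close>.\<close>

lemma word_ket_of:
  assumes B: "fock_pairing B" and l: "0 \<notin> set l"
    and P: "\<And>k F. k \<ge> 1 \<Longrightarrow> bra_like (word_ket F) \<Longrightarrow> word_ket (dressed P k (int k) F) = letter_op (L k) (word_ket F)"
    and Pc: "\<And>n F. const_ket F \<Longrightarrow> const_ket (P n F)"
  shows "word_ket (ket_of P B l) = chain (qgen (- betaX / 2)) (map L l @ end_letters betaX l) (vacK B)"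
    and "const_ket (ket_of P B l)" and "bra_like (word_ket (ket_of P B l))"
proof -
  have V: "bra_like (vacK B)"
    unfolding vacK_def[abs_def] by (intro bra_like_const_fract vac_word_bra_like B)
  define E where "E = (if even (length l) then vac B else phiB 0 (ket_exp theta_star (vac B)))"
  have vc: "const_ket (vac B)" by (simp add: const_ket_def vac_def)
  have E: "word_ket E = chain (qgen (- betaX / 2)) (end_letters betaX l) (vacK B)"
    using word_ket_phiB_0[of "ket_exp theta_star (vac B)"] word_ket_exp_theta[of "vac B"] V
    by (auto simp: E_def end_letters_def chain_def word_ket_vac raise_op_bra_like qgen_involution)
  have Ec: "const_ket E" by (simp add: E_def vc const_ket_phiB const_ket_exp_theta)
  have Eb: "bra_like (word_ket E)"
    unfolding E chain_def end_letters_def using V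
    by (auto intro!: letter_op_bra_like raise_op_bra_like qgen_involution)
  have R: "word_ket (foldr (\<lambda>k F. dressed P k (int k) (ket_exp theta_star F)) l E) =
        chain (qgen (- betaX / 2)) (map L l) (word_ket E) \<and>
      const_ket (foldr (\<lambda>k F. dressed P k (int k) (ket_exp theta_star F)) l E) \<and>
      bra_like (word_ket (foldr (\<lambda>k F. dressed P k (int k) (ket_exp theta_star F)) l E))"
    using l
  proof (induction l)
    case (Cons k l)
    let ?F = "foldr (\<lambda>k F. dressed P k (int k) (ket_exp theta_star F)) l E"
    have IH: "word_ket ?F = chain (qgen (- betaX / 2)) (map L l) (word_ket E)" "const_ket ?F" "bra_like (word_ket ?F)"
      using Cons.IH Cons.prems by auto
    have k: "k \<ge> 1" using Cons.prems by (cases k) auto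
    have e: "word_ket (ket_exp theta_star ?F) = raise_op (qgen (- betaX / 2)) (word_ket ?F)"
      by (rule word_ket_exp_theta[OF IH(3)])
    have eb: "bra_like (word_ket (ket_exp theta_star ?F))"
      unfolding e by (rule raise_op_bra_like[OF IH(3) qgen_involution])
    have "word_ket (dressed P k (int k) (ket_exp theta_star ?F)) = letter_op (L k) (raise_op (qgen (- betaX / 2)) (word_ket ?F))"
      using P[OF k eb] e by simp
    moreover have "const_ket (dressed P k (int k) (ket_exp theta_star ?F))"
      by (intro const_ket_dressed Pc const_ket_exp_theta IH)
    moreover have "bra_like (letter_op (L k) (raise_op (qgen (- betaX / 2)) (word_ket ?F)))"
      using eb unfolding e by (rule letter_op_bra_like)
    ultimately show ?case using IH by (simp add: chain_def)
  qed (simp add: chain_def Ec Eb)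
  have K: "ket_of P B l = foldr (\<lambda>k F. dressed P k (int k) (ket_exp theta_star F)) l E"
    by (simp only: ket_of_def E_def)
  show "word_ket (ket_of P B l) = chain (qgen (- betaX / 2)) (map L l @ end_letters betaX l) (vacK B)"
    using R unfolding K E by (simp add: chain_def)
  show "const_ket (ket_of P B l)" "bra_like (word_ket (ket_of P B l))"
    using R unfolding K by blast+
qed

section \<open>Series restricted to finitely many variables\<close>

definition mdeg :: "(nat \<Rightarrow>\<^sub>0 nat) \<Rightarrow> nat" where
  "mdeg \<alpha> = (\<Sum>k\<in>Poly_Mapping.keys \<alpha>. Poly_Mapping.lookup \<alpha> k)"

definition divs :: "(nat \<Rightarrow>\<^sub>0 nat) \<Rightarrow> (nat \<Rightarrow>\<^sub>0 nat) set" where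
  "divs \<alpha> = {\<gamma>. \<exists>\<delta>. \<alpha> = \<gamma> + \<delta>}"

definition monomials :: "nat \<Rightarrow> nat \<Rightarrow> (nat \<Rightarrow>\<^sub>0 nat) set" where
  "monomials n d = {\<alpha>. Poly_Mapping.keys \<alpha> \<subseteq> {..<n} \<and> mdeg \<alpha> = d}"

lemma mdeg_superset: "finite S \<Longrightarrow> Poly_Mapping.keys \<alpha> \<subseteq> S \<Longrightarrow> mdeg \<alpha> = (\<Sum>k\<in>S. Poly_Mapping.lookup \<alpha> k)"
  unfolding mdeg_def by (rule sum.mono_neutral_left) (auto simp: in_keys_iff)

lemma keys_add_nat: "Poly_Mapping.keys (\<alpha> + \<beta> :: nat \<Rightarrow>\<^sub>0 nat) = Poly_Mapping.keys \<alpha> \<union> Poly_Mapping.keys \<beta>"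
  by (auto simp: in_keys_iff lookup_add)

lemma mdeg_add: "mdeg (\<alpha> + \<beta>) = mdeg \<alpha> + mdeg \<beta>"
  using mdeg_superset[of "Poly_Mapping.keys \<alpha> \<union> Poly_Mapping.keys \<beta>"]
  by (simp add: keys_add_nat lookup_add sum.distrib)

lemma mdeg_single: "mdeg (Poly_Mapping.single i e) = e"
  by (simp add: mdeg_def)

lemma mdeg_0 [simp]: "mdeg 0 = 0"
  by (simp add: mdeg_def)

lemma mdeg_eq_0_iff: "mdeg \<alpha> = 0 \<longleftrightarrow> \<alpha> = 0"
proof
  assume "mdeg \<alpha> = 0"
  then have "Poly_Mapping.lookup \<alpha> k = 0" for k
    by (cases "k \<in> Poly_Mapping.keys \<alpha>") (auto simp: mdeg_def in_keys_iff)
  then show "\<alpha> = 0" by (intro poly_mapping_eqI) simp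
qed simp

lemma lookup_le_mdeg: "Poly_Mapping.lookup \<alpha> k \<le> mdeg \<alpha>"
  by (cases "k \<in> Poly_Mapping.keys \<alpha>") (auto simp: mdeg_def in_keys_iff intro: member_le_sum)

lemma finite_monomials:
  assumes "finite S"
  shows "finite {\<alpha> :: nat \<Rightarrow>\<^sub>0 nat. Poly_Mapping.keys \<alpha> \<subseteq> S \<and> mdeg \<alpha> \<le> N}"
proof (rule inj_on_finite[of Poly_Mapping.lookup])
  show "finite {f :: nat \<Rightarrow> nat. \<forall>x. (x \<in> S \<longrightarrow> f x \<in> {..N}) \<and> (x \<notin> S \<longrightarrow> f x = 0)}"
    by (rule finite_set_of_finite_funs) (use assms in auto)
  show "inj_on Poly_Mapping.lookup {\<alpha> :: nat \<Rightarrow>\<^sub>0 nat. Poly_Mapping.keys \<alpha> \<subseteq> S \<and> mdeg \<alpha> \<le> N}"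
    by (auto intro!: inj_onI)
  show "Poly_Mapping.lookup ` {\<alpha> :: nat \<Rightarrow>\<^sub>0 nat. Poly_Mapping.keys \<alpha> \<subseteq> S \<and> mdeg \<alpha> \<le> N} \<subseteq>
      {f. \<forall>x. (x \<in> S \<longrightarrow> f x \<in> {..N}) \<and> (x \<notin> S \<longrightarrow> f x = 0)}"
    by (auto simp: subset_iff in_keys_iff intro: order.trans[OF lookup_le_mdeg])
qed

lemma finite_monomials_deg [simp]: "finite (monomials n d)"
  by (rule finite_subset[OF _ finite_monomials[of "{..<n}" d]]) (auto simp: monomials_def)

lemma finite_divs [simp]: "finite (divs \<alpha>)"
  by (rule finite_subset[OF _ finite_monomials[of "Poly_Mapping.keys \<alpha>" "mdeg \<alpha>"]])
    (auto simp: divs_def keys_add_nat mdeg_add)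

lemma prod_fun_divs:
  fixes p f :: "(nat \<Rightarrow>\<^sub>0 nat) \<Rightarrow> 'a::semiring_0"
  shows "prod_fun p f \<alpha> = (\<Sum>\<gamma>\<in>divs \<alpha>. p \<gamma> * f (\<alpha> - \<gamma>))"
proof -
  have inner: "(\<Sum>q. (f q when \<alpha> = \<gamma> + q)) = (if \<gamma> \<in> divs \<alpha> then f (\<alpha> - \<gamma>) else 0)" for \<gamma>
  proof (cases "\<gamma> \<in> divs \<alpha>")
    case True
    then have "\<alpha> = \<gamma> + q \<longleftrightarrow> q = \<alpha> - \<gamma>" for q by (auto simp: divs_def)
    then show ?thesis using True by (simp add: Sum_any_when_equal)
  next
    case False
    then have "\<alpha> \<noteq> \<gamma> + q" for q by (auto simp: divs_def)
    then show ?thesis using False by simp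
  qed
  show ?thesis unfolding prod_fun_def inner
    by (subst Sum_any_superset[where A = "divs \<alpha>"]) auto
qed

section \<open>Finitely many variables, graded by the power of t\<close>

definition mon :: "(nat \<Rightarrow>\<^sub>0 nat) \<Rightarrow> xfield" where
  "mon \<alpha> = Fraction_Field.Fract (Poly_Mapping.single \<alpha> 1) 1"

lemma mon_add: "mon (\<alpha> + \<beta>) = mon \<alpha> * mon \<beta>"
  by (simp add: mon_def mult_single)

lemma mon_0: "mon 0 = 1"
  using const_fract_1 unfolding mon_def const_fract_def .

lemma mon_single: "mon (Poly_Mapping.single i e) = var_fract i ^ e"
proof (induction e)
  case (Suc e)
  have "Poly_Mapping.single i (Suc e) = Poly_Mapping.single i 1 + Poly_Mapping.single i e"
    by (simp flip: single_add)
  then show ?case by (simp add: mon_add Suc.IH) (simp add: mon_def var_fract_def)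
qed (simp add: mon_0)

text \<open>The series \<open>f\<close> at \<open>(x\<^sub>1 t, \<dots>, x\<^sub>n t, 0, 0, \<dots>)\<close>.\<close>

definition psi :: "nat \<Rightarrow> series \<Rightarrow> xfield fps" where
  "psi n f = Abs_fps (\<lambda>d. \<Sum>\<alpha>\<in>monomials n d. const_fract (f \<alpha>) * mon \<alpha>)"

lemma psi_nth: "psi n f $ d = (\<Sum>\<alpha>\<in>monomials n d. const_fract (f \<alpha>) * mon \<alpha>)"
  by (simp add: psi_def)

text \<open>Pairs of a monomial and a divisor correspond to pairs of factors, sorted by the degree
  of the first factor.\<close>

lemma psi_mult: "psi n (prod_fun f g) = psi n f * psi n g"
proof (rule fps_ext)
  fix d
  have "psi n (prod_fun f g) $ d = (\<Sum>(\<alpha>, \<gamma>)\<in>(SIGMA \<alpha>:monomials n d. divs \<alpha>).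
      const_fract (f \<gamma>) * const_fract (g (\<alpha> - \<gamma>)) * mon \<alpha>)"
    by (simp add: psi_nth prod_fun_divs const_fract_sum const_fract_mult sum_distrib_right sum.Sigma)
  also have "\<dots> = (\<Sum>(e, \<gamma>, \<delta>)\<in>(SIGMA e:{..d}. monomials n e \<times> monomials n (d - e)).
      (const_fract (f \<gamma>) * mon \<gamma>) * (const_fract (g \<delta>) * mon \<delta>))"
    by (rule sum.reindex_bij_witness[of _ "\<lambda>(e, \<gamma>, \<delta>). (\<gamma> + \<delta>, \<gamma>)" "\<lambda>(\<alpha>, \<gamma>). (mdeg \<gamma>, \<gamma>, \<alpha> - \<gamma>)"])
      (auto simp: monomials_def divs_def keys_add_nat mdeg_add mon_add mult_ac)
  also have "\<dots> = (\<Sum>e\<le>d. psi n f $ e * psi n g $ (d - e))"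
    by (subst sum.Sigma[symmetric]) (auto simp: psi_nth sum_product sum.cartesian_product)
  finally show "psi n (prod_fun f g) $ d = (psi n f * psi n g) $ d"
    by (simp add: fps_mult_nth atLeast0AtMost)
qed

definition power_base :: "bfield fps" where
  "power_base = fps_X / (1 + fps_const (betaK / 2) * fps_X)"

lemma power_base_mult: "power_base * (1 + fps_const (betaK / 2) * fps_X) = fps_X"
  unfolding power_base_def by (subst fps_divide_unit) (auto simp: mult.assoc inverse_mult_eq_1)

lemma power_base_0: "power_base $ 0 = 0"
  using arg_cong[OF power_base_mult, of "\<lambda>f. f $ 0"] by simp

lemma power_base_pow: "j < m \<Longrightarrow> (power_base ^ m) $ j = 0"
  using fps_pow_nth_eq_0[OF power_base_0] .

lemma in_var_low: "mdeg \<gamma> < m \<Longrightarrow> in_var i (power_base ^ m) \<gamma> = 0"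
  using mdeg_superset[of "{i}" \<gamma>] by (auto simp: in_var_def power_base_pow)

lemma power_sum_low: "mdeg \<gamma> < m \<Longrightarrow> power_sum m \<gamma> = 0"
  by (simp add: power_sum_def in_var_low flip: power_base_def)

text \<open>For m \<ge> 1 a variable outside the monomial contributes nothing, whereas for m = 0
  every variable would contribute 1 at the monomial 1.\<close>

lemma power_sum_finite:
  assumes "m \<ge> 1" "Poly_Mapping.keys \<alpha> \<subseteq> {..<n}"
  shows "power_sum m \<alpha> = (\<Sum>i<n. in_var i (power_base ^ m) \<alpha>)"
  unfolding power_sum_def power_base_def[symmetric]
proof (rule Sum_any_superset)
  fix i assume "i \<notin> {..<n}"
  then have "Poly_Mapping.lookup \<alpha> i = 0" using assms(2) by (auto simp: in_keys_iff)
  then show "in_var i (power_base ^ m) \<alpha> = 0" using assms(1) by (simp add: in_var_def power_base_pow)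
qed simp

definition fps_subst_var :: "xfield \<Rightarrow> bfield fps \<Rightarrow> xfield fps" where
  "fps_subst_var y f = Abs_fps (\<lambda>e. const_fract (f $ e) * y ^ e)"

lemma fps_subst_var_mult: "fps_subst_var y (f * g) = fps_subst_var y f * fps_subst_var y g"
proof (rule fps_ext)
  fix e
  have "const_fract (f $ i * g $ (e - i)) * y ^ e = (const_fract (f $ i) * y ^ i) * (const_fract (g $ (e - i)) * y ^ (e - i))"
    if "i \<le> e" for i
  proof -
    have "y ^ e = y ^ i * y ^ (e - i)" using that by (simp flip: power_add)
    then show ?thesis by (simp add: const_fract_mult mult_ac)
  qed
  then show "fps_subst_var y (f * g) $ e = (fps_subst_var y f * fps_subst_var y g) $ e"
    by (simp add: fps_subst_var_def fps_mult_nth const_fract_sum sum_distrib_right)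
qed

lemma fps_subst_var_one: "fps_subst_var y 1 = 1"
  by (rule fps_ext) (simp add: fps_subst_var_def)

lemma fps_subst_var_power: "fps_subst_var y (f ^ m) = fps_subst_var y f ^ m"
  by (induction m) (simp_all add: fps_subst_var_one fps_subst_var_mult)

lemma fps_subst_var_power_base: "fps_subst_var (var_fract i) power_base = xbar betaX var_fract i"
proof -
  have "fps_subst_var (var_fract i) (1 + fps_const (betaK / 2) * fps_X) = xden betaX var_fract i"
    by (rule fps_ext)
      (auto simp: fps_subst_var_def xden_def xt_def fps_X_def betaX_def const_fract_divide const_fract_numeral)
  moreover have "fps_subst_var (var_fract i) fps_X = xt var_fract i"
    by (rule fps_ext) (auto simp: fps_subst_var_def xt_def fps_X_def)
  ultimately have "fps_subst_var (var_fract i) power_base * xden betaX var_fract i = xt var_fract i"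
    using arg_cong[OF power_base_mult, of "fps_subst_var (var_fract i)"] by (simp add: fps_subst_var_mult)
  then show ?thesis using xbar_xden[of betaX var_fract i] xden_nonzero[of betaX var_fract i] by (metis mult_right_cancel)
qed

lemma psi_power_sum:
  assumes "m \<ge> 1"
  shows "psi n (power_sum m) = (\<Sum>i<n. xbar betaX var_fract i ^ m)"
proof (rule fps_ext)
  fix e
  have "psi n (power_sum m) $ e = (\<Sum>\<alpha>\<in>monomials n e. \<Sum>i<n. const_fract (in_var i (power_base ^ m) \<alpha>) * mon \<alpha>)"
    unfolding psi_nth
    by (intro sum.cong refl) (simp add: monomials_def power_sum_finite[OF assms, of _ n] const_fract_sum sum_distrib_right)
  also have "\<dots> = (\<Sum>i<n. \<Sum>\<alpha>\<in>monomials n e. const_fract (in_var i (power_base ^ m) \<alpha>) * mon \<alpha>)"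
    by (rule sum.swap)
  also have "\<dots> = (\<Sum>i<n. const_fract ((power_base ^ m) $ e) * var_fract i ^ e)"
  proof (rule sum.cong[OF refl])
    fix i assume i: "i \<in> {..<n}"
    have "(\<Sum>\<alpha>\<in>monomials n e. const_fract (in_var i (power_base ^ m) \<alpha>) * mon \<alpha>) =
        (\<Sum>\<alpha>\<in>{Poly_Mapping.single i e}. const_fract (in_var i (power_base ^ m) \<alpha>) * mon \<alpha>)"
    proof (rule sum.mono_neutral_right)
      show "\<forall>\<alpha>\<in>monomials n e - {Poly_Mapping.single i e}. const_fract (in_var i (power_base ^ m) \<alpha>) * mon \<alpha> = 0"
      proof
        fix \<alpha> assume \<alpha>: "\<alpha> \<in> monomials n e - {Poly_Mapping.single i e}"
        have "\<not> Poly_Mapping.keys \<alpha> \<subseteq> {i}"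
        proof
          assume k: "Poly_Mapping.keys \<alpha> \<subseteq> {i}"
          then have "Poly_Mapping.lookup \<alpha> i = e" using \<alpha> mdeg_superset[of "{i}" \<alpha>] by (simp add: monomials_def)
          moreover have "Poly_Mapping.lookup \<alpha> j = 0" if "j \<noteq> i" for j
            using k that by (auto simp: in_keys_iff)
          ultimately have "\<alpha> = Poly_Mapping.single i e"
            by (intro poly_mapping_eqI) (auto simp: lookup_single when_def)
          with \<alpha> show False by simp
        qed
        then show "const_fract (in_var i (power_base ^ m) \<alpha>) * mon \<alpha> = 0" by (simp add: in_var_def)
      qed
      show "{Poly_Mapping.single i e} \<subseteq> monomials n e"
        using i by (auto simp: monomials_def mdeg_single split: if_splits)
    qed simp
    then show "(\<Sum>\<alpha>\<in>monomials n e. const_fract (in_var i (power_base ^ m) \<alpha>) * mon \<alpha>) =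
        const_fract ((power_base ^ m) $ e) * var_fract i ^ e"
      by (simp add: in_var_def mon_single)
  qed
  also have "\<dots> = (\<Sum>i<n. xbar betaX var_fract i ^ m $ e)"
    unfolding fps_subst_var_power_base[symmetric] fps_subst_var_power[symmetric]
    by (simp add: fps_subst_var_def)
  finally show "psi n (power_sum m) $ e = (\<Sum>i<n. xbar betaX var_fract i ^ m) $ e"
    by (simp add: fps_sum_nth)
qed

section \<open>The Hamiltonian on kets\<close>

text \<open>The Hamiltonian leads out of the kets that are constant in x, so \<open>bra_like\<close>
  is demanded of every coefficient in x.\<close>

definition good_ket :: "ket \<Rightarrow> bool" where
  "good_ket G \<longleftrightarrow> (\<forall>\<alpha>. bra_like (\<lambda>w. G (bra w) \<alpha>))"

lemma boson_good:
  assumes G: "good_ket G" and n: "odd n"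
  shows "boson n G (bra w) \<alpha> = 1 / 4 * Bos n (\<lambda>w. G (bra w) \<alpha>) w"
proof -
  have br: "bra_like (\<lambda>w. G (bra w) \<alpha>)" using G by (simp add: good_ket_def)
  have "boson n G (bra w) \<alpha> = 1 / 4 * Sum_any (\<lambda>i. sg i * G (bra (w @ [- i - n, i])) \<alpha>)"
    by (simp add: boson_def ket_scale_def ket_sum_def ket_act_def right_act_mult bra_snoc powi_minus_one)
  also have "Sum_any (\<lambda>i. sg i * G (bra (w @ [- i - n, i])) \<alpha>) = Bos n (\<lambda>w. G (bra w) \<alpha>) w"
    unfolding Bos_def using Bos_range[OF br n] by (intro Sum_any_superset) auto
  finally show ?thesis .
qed

definition ham_coef :: "nat \<Rightarrow> bfield" where
  "ham_coef m = (if odd m then 2 / of_nat m else 0)"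

lemma hamiltonian_good:
  assumes G: "good_ket G"
  shows "hamiltonian G (bra w) \<alpha> = (\<Sum>m\<le>mdeg \<alpha>. ham_coef m *
    prod_fun (power_sum m) (\<lambda>\<delta>. 1 / 4 * Bos (int m) (\<lambda>w. G (bra w) \<delta>) w) \<alpha>)"
proof -
  have "hamiltonian G (bra w) \<alpha> = Sum_any (\<lambda>m. ham_coef m * prod_fun (power_sum m) (boson (int m) G (bra w)) \<alpha>)"
    by (simp add: hamiltonian_def ket_sum_def ket_scale_def ket_mult_def ham_coef_def)
  also have "\<dots> = (\<Sum>m\<le>mdeg \<alpha>. ham_coef m * prod_fun (power_sum m) (boson (int m) G (bra w)) \<alpha>)"
  proof (rule Sum_any_superset)
    fix m assume m: "m \<notin> {..mdeg \<alpha>}"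
    have "power_sum m \<gamma> = 0" if "\<gamma> \<in> divs \<alpha>" for \<gamma>
      using that m by (intro power_sum_low) (auto simp: divs_def mdeg_add)
    then show "ham_coef m * prod_fun (power_sum m) (boson (int m) G (bra w)) \<alpha> = 0"
      by (simp add: prod_fun_divs)
  qed simp
  also have "\<dots> = (\<Sum>m\<le>mdeg \<alpha>. ham_coef m *
    prod_fun (power_sum m) (\<lambda>\<delta>. 1 / 4 * Bos (int m) (\<lambda>w. G (bra w) \<delta>) w) \<alpha>)"
  proof (rule sum.cong[OF refl])
    fix m
    show "ham_coef m * prod_fun (power_sum m) (boson (int m) G (bra w)) \<alpha> =
      ham_coef m * prod_fun (power_sum m) (\<lambda>\<delta>. 1 / 4 * Bos (int m) (\<lambda>w. G (bra w) \<delta>) w) \<alpha>"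
    proof (cases "odd m")
      case True
      then have "boson (int m) G (bra w) = (\<lambda>\<delta>. 1 / 4 * Bos (int m) (\<lambda>w. G (bra w) \<delta>) w)"
        using boson_good[OF G, of "int m" w] by (intro ext) simp
      then show ?thesis by simp
    qed (simp add: ham_coef_def)
  qed
  finally show ?thesis .
qed

lemma good_ket_hamiltonian:
  assumes G: "good_ket G" shows "good_ket (hamiltonian G)"
proof -
  have "bra_like (\<lambda>w. G (bra w) \<beta>)" for \<beta> using G by (simp add: good_ket_def)
  then show ?thesis
    unfolding good_ket_def hamiltonian_good[OF G] prod_fun_divs
    by (intro allI bra_like_sum bra_like_scale Bos_bra_like)
qed

lemma good_ket_hamiltonian_pow: "good_ket F \<Longrightarrow> good_ket ((hamiltonian ^^ k) F)"
  by (induction k) (simp_all add: good_ket_hamiltonian)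

text \<open>Only odd power sums occur in the Hamiltonian, so each application raises the degree in x
  by at least one. Hence its exponential is a finite sum at every monomial.\<close>

lemma hamiltonian_pow_low:
  assumes F: "good_ket F"
  shows "mdeg \<alpha> < k \<Longrightarrow> (hamiltonian ^^ k) F (bra w) \<alpha> = 0"
proof (induction k arbitrary: \<alpha> w)
  case (Suc k)
  let ?G = "(hamiltonian ^^ k) F"
  have "ham_coef m * prod_fun (power_sum m) (\<lambda>\<delta>. 1 / 4 * Bos (int m) (\<lambda>w. ?G (bra w) \<delta>) w) \<alpha> = 0" for m
  proof (cases "odd m")
    case True
    have "power_sum m \<gamma> * (1 / 4 * Bos (int m) (\<lambda>w. ?G (bra w) (\<alpha> - \<gamma>)) w) = 0" if "\<gamma> \<in> divs \<alpha>" for \<gamma>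
    proof (cases "mdeg \<gamma> < m")
      case False
      then have "mdeg \<gamma> \<ge> 1" using True by (cases m) auto
      then have "mdeg (\<alpha> - \<gamma>) < k" using that Suc.prems by (auto simp: divs_def mdeg_add)
      then have "(\<lambda>w. ?G (bra w) (\<alpha> - \<gamma>)) = (\<lambda>w. 0)" using Suc.IH by simp
      then show ?thesis by (simp add: Bos_def)
    qed (simp add: power_sum_low)
    then have "prod_fun (power_sum m) (\<lambda>\<delta>. 1 / 4 * Bos (int m) (\<lambda>w. ?G (bra w) \<delta>) w) \<alpha> = 0"
      unfolding prod_fun_divs by (intro sum.neutral) blast
    then show ?thesis by (simp only: mult_zero_right)
  qed (simp add: ham_coef_def)
  then show ?case
    unfolding funpow.simps o_apply hamiltonian_good[OF good_ket_hamiltonian_pow[OF F]]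
    by (intro sum.neutral ballI)
qed simp

text \<open>\<open>psi\<close> is multiplicative and sends the m-th power sum to the sum of the
  X_i^m, so the Hamiltonian becomes one step of the recursion of \<open>ham\<close>.\<close>

lemma psi_hamiltonian:
  assumes G: "good_ket G"
  shows "psi n (hamiltonian G (bra w)) $ d = (\<Sum>e\<le>d. \<Sum>m\<le>e. ham_series betaX var_fract n $ m $ e / 4 *
    Bos (int m) (\<lambda>w. psi n (G (bra w)) $ (d - e)) w)"
proof -
  define P where "P m = (\<lambda>\<delta>. 1 / 4 * Bos (int m) (\<lambda>w. G (bra w) \<delta>) w)" for m
  have P: "psi n (P m) $ i = 1 / 4 * Bos (int m) (\<lambda>w. psi n (G (bra w)) $ i) w" for m i
  proof -
    have "Bos (int m) (\<lambda>w. psi n (G (bra w)) $ i) w = (\<Sum>\<alpha>\<in>monomials n i. mon \<alpha> * Bos (int m) (\<lambda>w. const_fract (G (bra w) \<alpha>)) w)"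
      unfolding psi_nth mult.commute[of _ "mon _"] by (rule Bos_sum)
    moreover have "Bos (int m) (\<lambda>w. const_fract (G (bra w) \<alpha>)) w = const_fract (Bos (int m) (\<lambda>w. G (bra w) \<alpha>) w)" for \<alpha>
      by (simp add: Bos_def const_fract_sum const_fract_mult const_fract_sg)
    ultimately show ?thesis
      by (simp add: psi_nth P_def const_fract_mult const_fract_divide const_fract_numeral sum_distrib_left mult_ac)
  qed
  have h: "const_fract (ham_coef m) * psi n (power_sum m) $ e = ham_series betaX var_fract n $ m $ e" for m e
  proof (cases "odd m")
    case True
    then have "m \<ge> 1" by (cases m) auto
    then show ?thesis using True
      by (simp add: ham_coef_def psi_power_sum ham_series_def const_fract_divide const_fract_of_nat const_fract_numeral)
  qed (simp add: ham_coef_def ham_series_def)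
  have "psi n (hamiltonian G (bra w)) $ d =
      (\<Sum>\<alpha>\<in>monomials n d. \<Sum>m\<le>d. const_fract (ham_coef m) * (const_fract (prod_fun (power_sum m) (P m) \<alpha>) * mon \<alpha>))"
    unfolding psi_nth
    by (intro sum.cong refl)
      (simp add: hamiltonian_good[OF G] monomials_def P_def const_fract_sum const_fract_mult sum_distrib_right mult.assoc)
  also have "\<dots> = (\<Sum>m\<le>d. const_fract (ham_coef m) * psi n (prod_fun (power_sum m) (P m)) $ d)"
    by (subst sum.swap) (simp only: psi_nth sum_distrib_left)
  also have "\<dots> = (\<Sum>m\<le>d. \<Sum>e\<le>d. ham_series betaX var_fract n $ m $ e / 4 * Bos (int m) (\<lambda>w. psi n (G (bra w)) $ (d - e)) w)"
    unfolding psi_mult fps_mult_nth P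
    by (simp add: atLeast0AtMost sum_distrib_left h[symmetric] mult.assoc)
  also have "\<dots> = (\<Sum>e\<le>d. \<Sum>m\<le>d. ham_series betaX var_fract n $ m $ e / 4 * Bos (int m) (\<lambda>w. psi n (G (bra w)) $ (d - e)) w)"
    by (rule sum.swap)
  also have "\<dots> = (\<Sum>e\<le>d. \<Sum>m\<le>e. ham_series betaX var_fract n $ m $ e / 4 * Bos (int m) (\<lambda>w. psi n (G (bra w)) $ (d - e)) w)"
    by (intro sum.cong refl sum.mono_neutral_right) (auto simp: tameD[OF ham_series_tame])
  finally show ?thesis .
qed

lemma monomials_0: "monomials n 0 = {0}"
  by (auto simp: monomials_def mdeg_eq_0_iff)

lemma psi_const:
  assumes "const_ket F"
  shows "psi n (F (bra w)) $ d = (if d = 0 then word_ket F w else 0)"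
proof (cases "d = 0")
  case True
  then show ?thesis by (simp add: psi_nth monomials_0 mon_0 word_ket_def)
next
  case False
  then have "\<alpha> \<noteq> 0" if "\<alpha> \<in> monomials n d" for \<alpha> using that by (auto simp: monomials_def)
  then show ?thesis using False assms by (auto simp: psi_nth const_ket_def intro!: sum.neutral)
qed

lemma psi_hamiltonian_pow:
  assumes "const_ket F" "good_ket F"
  shows "psi n ((hamiltonian ^^ k) F (bra w)) $ d = ham (ham_series betaX var_fract n) k d (word_ket F) w"
proof (induction k arbitrary: d w)
  case 0
  show ?case by (simp add: psi_const[OF assms(1)])
next
  case (Suc k)
  have "(\<lambda>w. psi n ((hamiltonian ^^ k) F (bra w)) $ d) = ham (ham_series betaX var_fract n) k d (word_ket F)" for d
    by (rule ext) (rule Suc.IH)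
  then show ?case by (simp add: psi_hamiltonian[OF good_ket_hamiltonian_pow[OF assms(2)]])
qed

lemma psi_expectation:
  assumes "const_ket F" "good_ket F"
  shows "psi n (expectation F) = Abs_fps (\<lambda>d. \<Sum>k\<le>d. 1 / of_nat (fact k) *
    ham (ham_series betaX var_fract n) k d (word_ket F) [])"
proof (rule fps_ext)
  fix d
  have ex: "expectation F \<alpha> = (\<Sum>k\<le>mdeg \<alpha>. 1 / of_nat (fact k) * (hamiltonian ^^ k) F (bra []) \<alpha>)" for \<alpha>
    unfolding expectation_def ket_exp_def ket_sum_def ket_scale_def bra_Nil
    by (rule Sum_any_superset) (use hamiltonian_pow_low[OF assms(2), of \<alpha> _ "[]"] in auto)
  have "psi n (expectation F) $ d = (\<Sum>\<alpha>\<in>monomials n d. \<Sum>k\<le>d. const_fract (1 / of_nat (fact k)) *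
      (const_fract ((hamiltonian ^^ k) F (bra []) \<alpha>) * mon \<alpha>))"
    unfolding psi_nth ex
    by (intro sum.cong refl) (simp only: monomials_def mem_Collect_eq const_fract_sum const_fract_mult sum_distrib_right mult.assoc)
  also have "\<dots> = (\<Sum>k\<le>d. const_fract (1 / of_nat (fact k)) * psi n ((hamiltonian ^^ k) F (bra [])) $ d)"
    by (subst sum.swap) (simp only: psi_nth sum_distrib_left)
  also have "\<dots> = (\<Sum>k\<le>d. 1 / of_nat (fact k) * ham (ham_series betaX var_fract n) k d (word_ket F) [])"
    unfolding psi_hamiltonian_pow[OF assms] by (simp only: const_fract_divide const_fract_of_nat const_fract_1)
  finally show "psi n (expectation F) $ d = Abs_fps (\<lambda>d. \<Sum>k\<le>d. 1 / of_nat (fact k) *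
    ham (ham_series betaX var_fract n) k d (word_ket F) []) $ d" by simp
qed

lemma bra_like_const_fract_iff: "bra_like (\<lambda>w. const_fract (W w)) \<Longrightarrow> bra_like W"
  unfolding bra_like_def
proof (intro conjI allI impI cliffordI)
  fix a b :: "int list" and p q :: int
  assume W: "clifford (\<lambda>w. const_fract (W w)) \<and> (\<forall>m w. m > 0 \<longrightarrow> const_fract (W (m # w)) = 0)"
  have "const_fract (W (a @ p # q # b) + W (a @ q # p # b)) = const_fract (if p + q = 0 then 2 * sg p * W (a @ b) else 0)"
    using cliffordD[OF conjunct1[OF W], of a p q b]
    by (auto simp: const_fract_add const_fract_mult const_fract_numeral const_fract_sg)
  then show "W (a @ p # q # b) + W (a @ q # p # b) = (if p + q = 0 then 2 * sg p * W (a @ b) else 0)"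
    by (simp only: const_fract_eq_iff)
qed auto

lemma good_ket_const:
  assumes "const_ket F" "bra_like (word_ket F)"
  shows "good_ket F"
  unfolding good_ket_def
proof
  fix \<alpha>
  show "bra_like (\<lambda>w. F (bra w) \<alpha>)"
  proof (cases "\<alpha> = 0")
    case True
    then show ?thesis using bra_like_const_fract_iff[of "\<lambda>w. F (bra w) 0"] assms(2)
      by (simp add: word_ket_def[abs_def])
  next
    case False
    then have "(\<lambda>w. F (bra w) \<alpha>) = (\<lambda>w. 0)" using assms(1) by (simp add: const_ket_def)
    then show ?thesis by (simp add: bra_like_def clifford_def clifford_at_def)
  qed
qed

section \<open>The stable limit\<close>

lemma sum_mon_eq_Fract:
  assumes "finite A"
  shows "(\<Sum>\<alpha>\<in>A. const_fract (f \<alpha>) * mon \<alpha>) = Fraction_Field.Fract (\<Sum>\<alpha>\<in>A. Poly_Mapping.single \<alpha> (f \<alpha>)) 1"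
  using assms
  by (induction A rule: finite_induct)
    (simp_all add: Zero_fract_def const_fract_def mon_def mult_single)

lemma lookup_sum_single:
  "finite A \<Longrightarrow> Poly_Mapping.lookup (\<Sum>\<alpha>\<in>A. Poly_Mapping.single \<alpha> (f \<alpha>)) \<beta> = (if \<beta> \<in> A then f \<beta> else 0)"
  by (induction A rule: finite_induct) (auto simp: lookup_add lookup_single when_def)

text \<open>Above the degree of \<open>P\<close> the homogeneous parts of \<open>f\<close> in n
  variables vanish, and so do their coefficients because monomials are linearly independent. The
  finitely many parts that remain are added up at t = 1.\<close>

lemma psi_polynomial:
  assumes "psi n f = fps_of_poly P"
  obtains p where "\<And>\<alpha>. Poly_Mapping.lookup p \<alpha> = (if Poly_Mapping.keys \<alpha> \<subseteq> {..<n} then f \<alpha> else 0)"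
    "Fraction_Field.Fract p 1 = poly P 1"
proof -
  define A where "A = (\<Union>d\<in>{..degree P}. monomials n d)"
  define p where "p = (\<Sum>\<alpha>\<in>A. Poly_Mapping.single \<alpha> (f \<alpha>))"
  have A: "finite A" by (simp add: A_def)
  have "f \<alpha> = 0" if \<alpha>: "Poly_Mapping.keys \<alpha> \<subseteq> {..<n}" "\<alpha> \<notin> A" for \<alpha>
  proof -
    let ?d = "mdeg \<alpha>"
    have m: "\<alpha> \<in> monomials n ?d" using \<alpha> by (simp add: monomials_def)
    have "?d > degree P" using \<alpha> by (auto simp: A_def monomials_def)
    then have "psi n f $ ?d = 0" by (simp add: assms coeff_eq_0)
    then have "(\<Sum>\<beta>\<in>monomials n ?d. Poly_Mapping.single \<beta> (f \<beta>)) = 0"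
      by (simp add: psi_nth sum_mon_eq_Fract Zero_fract_def eq_fract)
    then show "f \<alpha> = 0"
      using lookup_sum_single[where A = "monomials n ?d" and f = f and \<beta> = \<alpha>] m by simp
  qed
  then have "Poly_Mapping.lookup p \<alpha> = (if Poly_Mapping.keys \<alpha> \<subseteq> {..<n} then f \<alpha> else 0)" for \<alpha>
    unfolding p_def lookup_sum_single[OF A] by (auto simp: A_def monomials_def)
  moreover have "Fraction_Field.Fract p 1 = poly P 1"
  proof -
    have "Fraction_Field.Fract p 1 = (\<Sum>\<alpha>\<in>A. const_fract (f \<alpha>) * mon \<alpha>)"
      by (simp add: p_def sum_mon_eq_Fract[OF A])
    also have "\<dots> = (\<Sum>d\<le>degree P. psi n f $ d)"
      unfolding A_def psi_nth by (rule sum.UNION_disjoint) (simp_all, auto simp: monomials_def)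
    also have "\<dots> = poly P 1" by (simp add: assms poly_altdef)
    finally show ?thesis .
  qed
  ultimately show thesis by (rule that)
qed

text \<open>For uniqueness, a monomial involves finitely many variables, so its coefficient is
  visible in some G n with n \<ge> r.\<close>

lemma stable_limit_eqI:
  assumes "\<And>n. n \<ge> r \<Longrightarrow> poly_value (psi n f) (G n)"
  shows "stable_limit r G = f"
  unfolding stable_limit_def
proof (rule the_equality)
  show "\<forall>n\<ge>r. \<exists>p. (\<forall>\<alpha>. Poly_Mapping.lookup p \<alpha> = (if Poly_Mapping.keys \<alpha> \<subseteq> {..<n} then f \<alpha> else 0)) \<and>
      Fraction_Field.Fract p 1 = G n"
  proof (intro allI impI)
    fix n assume "r \<le> n"
    from assms[OF this] obtain P where P: "psi n f = fps_of_poly P" "poly P 1 = G n"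
      by (auto simp: poly_value_def)
    from psi_polynomial[OF P(1)] P(2)
    show "\<exists>p. (\<forall>\<alpha>. Poly_Mapping.lookup p \<alpha> = (if Poly_Mapping.keys \<alpha> \<subseteq> {..<n} then f \<alpha> else 0)) \<and>
      Fraction_Field.Fract p 1 = G n" by metis
  qed
  then show "g = f" if g: "\<forall>n\<ge>r. \<exists>p. (\<forall>\<alpha>. Poly_Mapping.lookup p \<alpha> = (if Poly_Mapping.keys \<alpha> \<subseteq> {..<n} then g \<alpha> else 0)) \<and>
      Fraction_Field.Fract p 1 = G n" for g
  proof (intro ext)
    fix \<alpha> :: "nat \<Rightarrow>\<^sub>0 nat"
    obtain N where N: "Poly_Mapping.keys \<alpha> \<subseteq> {..<N}"
      using finite_nat_set_iff_bounded[of "Poly_Mapping.keys \<alpha>"] by auto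
    define n where "n = max r N"
    have n: "n \<ge> r" "Poly_Mapping.keys \<alpha> \<subseteq> {..<n}" using N by (auto simp: n_def)
    from g n obtain p where p: "\<And>\<alpha>. Poly_Mapping.lookup p \<alpha> = (if Poly_Mapping.keys \<alpha> \<subseteq> {..<n} then g \<alpha> else 0)"
      "Fraction_Field.Fract p 1 = G n" by blast
    from \<open>\<forall>n\<ge>r. \<exists>p. (\<forall>\<alpha>. Poly_Mapping.lookup p \<alpha> = (if Poly_Mapping.keys \<alpha> \<subseteq> {..<n} then f \<alpha> else 0)) \<and>
      Fraction_Field.Fract p 1 = G n\<close> n
    obtain q where q: "\<And>\<alpha>. Poly_Mapping.lookup q \<alpha> = (if Poly_Mapping.keys \<alpha> \<subseteq> {..<n} then f \<alpha> else 0)"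
      "Fraction_Field.Fract q 1 = G n" by blast
    have "Fraction_Field.Fract p 1 = Fraction_Field.Fract q 1" by (simp only: p(2) q(2))
    then have "p = q" by (simp add: eq_fract)
    then show "g \<alpha> = f \<alpha>" using p(1)[of \<alpha>] q(1)[of \<alpha>] n by simp
  qed
qed

lemma var_fract_nonzero: "(var_fract k :: xfield) \<noteq> 0"
proof -
  have "Poly_Mapping.single (Poly_Mapping.single k (1::nat)) (1 :: bfield) \<noteq> 0"
    by (metis lookup_single_eq lookup_zero zero_neq_one)
  then show ?thesis by (simp add: var_fract_def Zero_fract_def eq_fract)
qed

lemma var_fract_inj: "inj (var_fract :: nat \<Rightarrow> xfield)"
proof (rule injI)
  fix i j assume "(var_fract i :: xfield) = var_fract j"
  then have "Poly_Mapping.single (Poly_Mapping.single i (1::nat)) (1 :: bfield) = Poly_Mapping.single (Poly_Mapping.single j 1) 1"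
    by (simp add: var_fract_def eq_fract)
  from arg_cong[OF this, of Poly_Mapping.keys]
  have "Poly_Mapping.single i (1::nat) = Poly_Mapping.single j 1" by simp
  from arg_cong[OF this, of Poly_Mapping.keys] show "i = j" by simp
qed

lemma vacK_vacuum:
  assumes "fock_pairing B"
  shows "bra_like (vacK B)" "m < 0 \<Longrightarrow> vacK B (w @ [m]) = 0" "vacK B [] = 1"
  using assms unfolding vacK_def[abs_def]
  by (auto intro!: bra_like_const_fract vac_word_bra_like simp: vac_word_kill vac_word_Nil)

lemma psi_expectation_ket_of:
  assumes B: "fock_pairing B" and l: "0 \<notin> set l"
    and P: "\<And>k F. k \<ge> 1 \<Longrightarrow> bra_like (word_ket F) \<Longrightarrow> word_ket (dressed P k (int k) F) = letter_op (L k) (word_ket F)"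
    and Pc: "\<And>n F. const_ket F \<Longrightarrow> const_ket (P n F)"
  shows "psi n (expectation (ket_of P B l)) = amplitude betaX var_fract {..<n} L (end_letters betaX l) l"
proof -
  have K: "word_ket (ket_of P B l) = chain (qgen (- betaX / 2)) (map L l @ end_letters betaX l) (vacK B)"
    "const_ket (ket_of P B l)" "bra_like (word_ket (ket_of P B l))"
    by (rule word_ket_of[where L = L, OF B l]; (rule P | rule Pc); assumption)+
  show ?thesis
    unfolding psi_expectation[OF K(2) good_ket_const[OF K(2,3)]] K(1)
    by (rule ham_chain_eq_amplitude[OF vacK_vacuum[OF B]])
qed

theorem theorem3p8:
  fixes l :: "nat list" and B :: "fock_dual \<Rightarrow> fock \<Rightarrow> qbeta"
  assumes "strict_partition l" and "fock_pairing B"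
  shows "GP l = expectation (ket_GP B l) \<and> GQ l = expectation (ket_GQ B l)"
proof
  have l: "0 \<notin> set l" using assms(1) by (auto simp: strict_partition_def)
  have inj: "inj_on (var_fract :: nat \<Rightarrow> xfield) {..<n}" for n
    using var_fract_inj by (rule inj_on_subset) simp
  show "GP l = expectation (ket_GP B l)"
    unfolding GP_def ket_GP_def
  proof (rule stable_limit_eqI)
    fix n assume "n \<ge> length l"
    have "psi n (expectation (ket_of PhiB B l)) =
        amplitude betaX var_fract {..<n} (letterP betaX bX) (end_letters betaX l) l"
      by (rule psi_expectation_ket_of[OF assms(2) l]) (auto intro: word_ket_dressed_PhiB const_ket_PhiB)
    then show "poly_value (psi n (expectation (ket_of PhiB B l)))
        (GP_finite (const_fract betaK) (\<lambda>j. const_fract (bK j)) l n var_fract)"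
      using amplitude_GP[OF var_fract_nonzero inj \<open>n \<ge> length l\<close> l, of betaX bX] by (simp add: betaX_def bX_def[abs_def])
  qed
  show "GQ l = expectation (ket_GQ B l)"
    unfolding GQ_def ket_GQ_def
  proof (rule stable_limit_eqI)
    fix n assume "n \<ge> length l"
    have "psi n (expectation (ket_of phiB B l)) =
        amplitude betaX var_fract {..<n} (letterQ betaX bX) (end_letters betaX l) l"
      by (rule psi_expectation_ket_of[OF assms(2) l]) (auto intro: word_ket_dressed_phiB const_ket_phiB)
    then show "poly_value (psi n (expectation (ket_of phiB B l)))
        (GQ_finite (const_fract betaK) (\<lambda>j. const_fract (bK j)) l n var_fract)"
      using amplitude_GQ[OF var_fract_nonzero inj \<open>n \<ge> length l\<close> l, of betaX bX] by (simp add: betaX_def bX_def[abs_def])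
  qed
qed

end
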